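(* There is a numerical constant $C>0$, independent of all problem parameters, such that the following holds. For all $x\in\mathcal{X}$ and $n\in\mathbb{N}$, every objective $\mathcal{L}$ of the general form given in the context satisfies $0\le \mathcal{L}(x;P_0)-\overline{\mathcal{L}}(x;n)$, and moreover: (i) if $\mathcal{L}=\mathcal{L}_{\mathrm{CVaR}}$, then $\mathcal{L}(x;P_0)-\overline{\mathcal{L}}(x;n)\le C\,B\min\{1,(\alpha n)^{-1/2}\}$; (ii) if $\mathcal{L}=\mathcal{L}_{\chi^2}$, then $\mathcal{L}(x;P_0)-\overline{\mathcal{L}}(x;n)\le C\,B\sqrt{(1+\rho)(\log n)/n}$; (iii) if $\mathcal{L}=\mathcal{L}_{\chi^2\text{-pen}}$, then $\mathcal{L}(x;P_0)-\overline{\mathcal{L}}(x;n)\le C\,B^2(\lambda n)^{-1}$; (iv) if for each $x\in\mathcal{X}$ the inverse cdf of $\ell(x;S)$, $S\sim P_0$, is $G_{\mathrm{icdf}}$-Lipschitz, then for every objective $\mathcal{L}$ of the general form, $\mathcal{L}(x;P_0)-\overline{\mathcal{L}}(x;n)\le C\,G_{\mathrm{icdf}}\,n^{-1}$.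
   Context: Setting: $\mathcal{X}\subset\mathbb{R}^d$ is closed and convex with $\|x-y\|\le R$ for all $x,y\in\mathcal{X}$; $P_0$ is a probability distribution on a sample space $\mathbb{S}$; the loss $\ell:\mathcal{X}\times\mathbb{S}\to[0,B]$ is convex and $G$-Lipschitz in $x$. General form of the objective: for closed convex $\phi,\psi:\mathbb{R}_+\to\mathbb{R}\cup\{+\infty\}$ with $\phi(1)=\psi(1)=0$, write $D_\phi(Q,P)=\int\phi(\frac{dQ}{dP})\,dP$ for $Q\ll P$ (similarly $D_\psi$); for a constraint radius $\rho\ge 0$ and penalty $\lambda\ge 0$, $$\mathcal{L}(x;P)=\sup_{Q\ll P:\,D_\phi(Q,P)\le\rho}\{\mathbb{E}_{S\sim Q}\ell(x;S)-\lambda D_\psi(Q,P)\}.$$ Special cases, with $D_{\chi^2}(Q,P)=\frac12\int(\frac{dQ}{dP}-1)^2dP$: $\mathcal{L}_{\mathrm{CVaR}}(x;P)=\sup\{\mathbb{E}_Q\ell(x;S): Q\ll P,\ \frac{dQ}{dP}\le \frac1\alpha\}$ (CVaR at level $\alpha\in(0,1]$); $\mathcal{L}_{\chi^2}(x;P)=\sup\{\mathbb{E}_Q\ell(x;S): Q\ll P,\ D_{\chi^2}(Q,P)\le\rho\}$; $\mathcal{L}_{\chi^2\text{-pen}}(x;P)=\sup_{Q\ll P}\{\mathbb{E}_Q\ell(x;S)-\lambda D_{\chi^2}(Q,P)\}$. For a sample $s_1^n=(s_1,\dots,s_n)$, $\mathcal{L}(x;s_1^n)$ denotes $\mathcal{L}(x;\hat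 P)$ with $\hat P$ the uniform distribution on $s_1,\dots,s_n$ (counted with multiplicity). The mini-batch surrogate is $\overline{\mathcal{L}}(x;n)=\mathbb{E}\,\mathcal{L}(x;S_1^n)$ with $S_1,\dots,S_n$ i.i.d. from $P_0$. Inverse cdf: for fixed $x$, $F(t)=\mathbb{P}(\ell(x;S)\le t)$ and $F^{-1}(u)=\inf\{t:F(t)>u\}$.
   Formalization: Part (ii) is stated only for n ≥ 2: at n = 1 its right-hand side is 0 since log 1 = 0, while the gap is positive for any non-constant loss with ρ > 0. Part (iii) is stated for λ > 0, where its bound is defined. *)

theory Defs
  imports "HOL-Probability.Probability"
begin

locale dro_problem = prob_space P0
  for P0 :: "'s measure" +
  fixes X :: "(real ^ 'd) set" and R :: real
    and loss :: "real ^ 'd \<Rightarrow> 's \<Rightarrow> real" and B G :: real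
  assumes closed_X: "closed X"
    and convex_X: "convex X"
    and diameter_X: "x \<in> X \<Longrightarrow> y \<in> X \<Longrightarrow> norm (x - y) \<le> R"
    and loss_measurable: "x \<in> X \<Longrightarrow> loss x \<in> borel_measurable P0"
    and loss_range: "x \<in> X \<Longrightarrow> s \<in> space P0 \<Longrightarrow> loss x s \<in> {0..B}"
    and loss_convex: "s \<in> space P0 \<Longrightarrow> convex_on X (\<lambda>x. loss x s)"
    and loss_lipschitz: "s \<in> space P0 \<Longrightarrow> G-lipschitz_on X (\<lambda>x. loss x s)"

text \<open>
  A function from the nonnegative reals to the reals with \<open>+\<infinity>\<close> is represented by a total
  function into \<^typ>\<open>ereal\<close> whose values at negative arguments are irrelevant.
  It is closed and convex iff its epigraph is.
\<close>

definition epi :: "(real \<Rightarrow> ereal) \<Rightarrow> (real \<times> real) set" where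
  "epi \<phi> = {(t, y). 0 \<le> t \<and> \<phi> t \<le> ereal y}"

definition divergence_fun :: "(real \<Rightarrow> ereal) \<Rightarrow> bool" where
  "divergence_fun \<phi> \<longleftrightarrow>
     (\<forall>t\<ge>0. \<phi> t \<noteq> -\<infinity>) \<and> closed (epi \<phi>) \<and> convex (epi \<phi>) \<and> \<phi> 1 = 0"

text \<open>
  The integral of an extended-real function, as the integral of the positive part minus the
  integral of the negative part (\<^const>\<open>e2ennreal\<close> maps negative values to \<open>0\<close>).
  In every use below the negative part has a finite integral: a closed convex \<open>\<phi>\<close> has an affine
  minorant, and the objectives are nonnegative.
\<close>

definition eintegral :: "'a measure \<Rightarrow> ('a \<Rightarrow> ereal) \<Rightarrow> ereal" where
  "eintegral M f =
     enn2ereal (\<integral>\<^sup>+ x. e2ennreal (f x) \<partial>M) - enn2ereal (\<integral>\<^sup>+ x. e2ennreal (- f x) \<partial>M)"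

definition f_div :: "(real \<Rightarrow> ereal) \<Rightarrow> 's measure \<Rightarrow> 's measure \<Rightarrow> ereal" where
  "f_div \<phi> Q P = eintegral P (\<lambda>s. \<phi> (enn2real (RN_deriv P Q s)))"

definition ac_probs :: "'s measure \<Rightarrow> 's measure set" where
  "ac_probs P = {Q. prob_space Q \<and> sets Q = sets P \<and> absolutely_continuous P Q}"

text \<open>
  The objectives are \<^typ>\<open>ereal\<close>-valued because the penalty may be infinite. When \<open>lam = 0\<close>, the
  convention \<open>0 * \<infinity> = 0\<close> drops the penalty altogether.
\<close>

definition dro_objective ::
  "(real \<Rightarrow> ereal) \<Rightarrow> (real \<Rightarrow> ereal) \<Rightarrow> real \<Rightarrow> real \<Rightarrow> ('x \<Rightarrow> 's \<Rightarrow> real) \<Rightarrow> 'x \<Rightarrow> 's measure \<Rightarrow> ereal"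
where
  "dro_objective \<phi> \<psi> \<rho> lam loss x P =
     (SUP Q\<in>{Q \<in> ac_probs P. f_div \<phi> Q P \<le> ereal \<rho>}.
        ereal (\<integral>s. loss x s \<partial>Q) - ereal lam * f_div \<psi> Q P)"

definition chi2_fun :: "real \<Rightarrow> ereal" where
  "chi2_fun t = ereal ((t - 1)\<^sup>2 / 2)"

definition chi2_div :: "'s measure \<Rightarrow> 's measure \<Rightarrow> ereal" where
  "chi2_div = f_div chi2_fun"

definition cvar_objective :: "real \<Rightarrow> ('x \<Rightarrow> 's \<Rightarrow> real) \<Rightarrow> 'x \<Rightarrow> 's measure \<Rightarrow> ereal" where
  "cvar_objective \<alpha> loss x P =
     (SUP Q\<in>{Q \<in> ac_probs P. AE s in P. RN_deriv P Q s \<le> ennreal (1 / \<alpha>)}.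
        ereal (\<integral>s. loss x s \<partial>Q))"

definition chi2_objective :: "real \<Rightarrow> ('x \<Rightarrow> 's \<Rightarrow> real) \<Rightarrow> 'x \<Rightarrow> 's measure \<Rightarrow> ereal" where
  "chi2_objective \<rho> loss x P =
     (SUP Q\<in>{Q \<in> ac_probs P. chi2_div Q P \<le> ereal \<rho>}. ereal (\<integral>s. loss x s \<partial>Q))"

definition chi2_pen_objective :: "real \<Rightarrow> ('x \<Rightarrow> 's \<Rightarrow> real) \<Rightarrow> 'x \<Rightarrow> 's measure \<Rightarrow> ereal" where
  "chi2_pen_objective lam loss x P =
     (SUP Q\<in>ac_probs P. ereal (\<integral>s. loss x s \<partial>Q) - ereal lam * chi2_div Q P)"

text \<open>
  The push-forward of the uniform distribution on the indices counts repeated sample points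
  with multiplicity; it lives on the \<open>\<sigma>\<close>-algebra of \<open>P0\<close>.
\<close>

definition empirical :: "'s measure \<Rightarrow> nat \<Rightarrow> (nat \<Rightarrow> 's) \<Rightarrow> 's measure" where
  "empirical P0 n s = distr (uniform_count_measure {..<n}) P0 s"

definition minibatch :: "('s measure \<Rightarrow> ereal) \<Rightarrow> 's measure \<Rightarrow> nat \<Rightarrow> ereal" where
  "minibatch L P0 n = eintegral (Pi\<^sub>M {..<n} (\<lambda>_. P0)) (\<lambda>s. L (empirical P0 n s))"

definition inverse_cdf :: "'s measure \<Rightarrow> ('s \<Rightarrow> real) \<Rightarrow> real \<Rightarrow> real" where
  "inverse_cdf P Z u = Inf {t. cdf (distr P borel Z) t > u}"

lemma f_div_zero: "f_div (\<lambda>_. 0) Q P = 0"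
  by (simp add: f_div_def eintegral_def)

lemma chi2_objective_eq_dro:
  "chi2_objective \<rho> loss x P = dro_objective chi2_fun \<psi> \<rho> 0 loss x P"
  by (simp add: chi2_objective_def dro_objective_def chi2_div_def flip: zero_ereal_def)

lemma chi2_pen_objective_eq_dro:
  "chi2_pen_objective lam loss x P = dro_objective (\<lambda>_. 0) chi2_fun 0 lam loss x P"
  by (simp add: chi2_pen_objective_def dro_objective_def chi2_div_def f_div_zero)

definition cvar_fun :: "real \<Rightarrow> real \<Rightarrow> ereal" where
  "cvar_fun \<alpha> t = (if t \<le> 1 / \<alpha> then 0 else \<infinity>)"

lemma f_div_cvar_fun:
  assumes P: "prob_space P" and Q: "Q \<in> ac_probs P" and "0 < \<alpha>"
  shows "f_div (cvar_fun \<alpha>) Q P \<le> 0 \<longleftrightarrow> (AE s in P. RN_deriv P Q s \<le> ennreal (1 / \<alpha>))"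
proof -
  interpret P: prob_space P by (rule P)
  interpret Q: prob_space Q using Q by (simp add: ac_probs_def)
  have fin: "AE s in P. RN_deriv P Q s \<noteq> \<infinity>"
    using Q by (intro P.RN_deriv_finite) (auto simp: ac_probs_def Q.sigma_finite_measure_axioms)
  let ?r = "\<lambda>s. enn2real (RN_deriv P Q s)"
  have neg: "e2ennreal (- cvar_fun \<alpha> t) = 0" for t
    by (simp add: cvar_fun_def e2ennreal_neg)
  have pos: "e2ennreal (cvar_fun \<alpha> t) = (if t \<le> 1 / \<alpha> then 0 else \<infinity>)" for t
    by (simp add: cvar_fun_def e2ennreal_infty)
  have "f_div (cvar_fun \<alpha>) Q P = enn2ereal (\<integral>\<^sup>+ s. (if ?r s \<le> 1 / \<alpha> then 0 else \<infinity>) \<partial>P)"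
    by (simp add: f_div_def eintegral_def neg pos zero_ennreal.rep_eq)
  also have "\<dots> \<le> 0 \<longleftrightarrow> (\<integral>\<^sup>+ s. (if ?r s \<le> 1 / \<alpha> then 0 else \<infinity>) \<partial>P) = 0"
    by (metis antisym enn2ereal_nonneg zero_ennreal.rep_eq enn2ereal_inject order_refl)
  also have "\<dots> \<longleftrightarrow> (AE s in P. ?r s \<le> 1 / \<alpha>)"
    by (subst nn_integral_0_iff_AE) (auto intro!: AE_cong)
  also have "\<dots> \<longleftrightarrow> (AE s in P. RN_deriv P Q s \<le> ennreal (1 / \<alpha>))"
  proof (rule iffI)
    assume "AE s in P. ?r s \<le> 1 / \<alpha>"
    with fin show "AE s in P. RN_deriv P Q s \<le> ennreal (1 / \<alpha>)"
      by eventually_elim (metis ennreal_enn2real ennreal_leI infinity_ennreal_def top.not_eq_extremum)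
  next
    assume "AE s in P. RN_deriv P Q s \<le> ennreal (1 / \<alpha>)"
    then show "AE s in P. ?r s \<le> 1 / \<alpha>"
      by eventually_elim (use \<open>0 < \<alpha>\<close> in \<open>simp add: enn2real_leI\<close>)
  qed
  finally show ?thesis .
qed

lemma cvar_objective_eq_dro:
  assumes "prob_space P" "0 < \<alpha>"
  shows "cvar_objective \<alpha> loss x P = dro_objective (cvar_fun \<alpha>) \<psi> 0 0 loss x P"
proof -
  have "{Q \<in> ac_probs P. AE s in P. RN_deriv P Q s \<le> ennreal (1 / \<alpha>)} =
        {Q \<in> ac_probs P. f_div (cvar_fun \<alpha>) Q P \<le> ereal 0}"
    using f_div_cvar_fun[OF assms(1) _ assms(2)] by (auto simp flip: zero_ereal_def)
  then show ?thesis
    by (simp add: cvar_objective_def dro_objective_def flip: zero_ereal_def)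
qed

lemma divergence_fun_zero: "divergence_fun (\<lambda>_. 0)"
proof -
  have "epi (\<lambda>_. 0) = {0..} \<times> {0..}"
    by (auto simp: epi_def)
  then show ?thesis
    by (simp add: divergence_fun_def closed_Times convex_Times)
qed

lemma divergence_fun_cvar:
  assumes "0 < \<alpha>" "\<alpha> \<le> 1"
  shows "divergence_fun (cvar_fun \<alpha>)"
proof -
  have "epi (cvar_fun \<alpha>) = {0..1 / \<alpha>} \<times> {0..}"
    by (auto simp: epi_def cvar_fun_def split: if_splits)
  then show ?thesis
    using assms by (simp add: divergence_fun_def closed_Times convex_Times cvar_fun_def)
qed

lemma divergence_fun_chi2: "divergence_fun chi2_fun"
proof -
  have epi: "epi chi2_fun = {p. 0 \<le> fst p} \<inter> {p. (fst p - 1)\<^sup>2 / 2 \<le> snd p}"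
    by (auto simp: epi_def chi2_fun_def)
  have "closed (epi chi2_fun)"
    unfolding epi by (intro closed_Int closed_Collect_le continuous_intros) auto
  moreover have "convex (epi chi2_fun)"
  proof (rule convexI)
    fix p q :: "real \<times> real" and u v :: real
    assume pq: "p \<in> epi chi2_fun" "q \<in> epi chi2_fun" and uv: "0 \<le> u" "0 \<le> v" "u + v = 1"
    have "u * (fst p - 1)\<^sup>2 + v * (fst q - 1)\<^sup>2 - (u * fst p + v * fst q - 1)\<^sup>2
        = u * v * (fst p - fst q)\<^sup>2"
    proof -
      have v: "v = 1 - u" using uv by simp
      show ?thesis unfolding v by (simp add: power2_eq_square algebra_simps)
    qed
    then have "(u * fst p + v * fst q - 1)\<^sup>2 \<le> u * (fst p - 1)\<^sup>2 + v * (fst q - 1)\<^sup>2"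
      using uv by (smt (verit) mult_nonneg_nonneg zero_le_power2)
    moreover have "u * ((fst p - 1)\<^sup>2 / 2) \<le> u * snd p" "v * ((fst q - 1)\<^sup>2 / 2) \<le> v * snd q"
      using pq uv mult_left_mono[of "(fst p - 1)\<^sup>2 / 2" "snd p" u]
        mult_left_mono[of "(fst q - 1)\<^sup>2 / 2" "snd q" v]
      unfolding epi by blast+
    ultimately show "u *\<^sub>R p + v *\<^sub>R q \<in> epi chi2_fun"
      using pq uv by (auto simp: epi)
  qed
  ultimately show ?thesis
    by (simp add: divergence_fun_def chi2_fun_def)
qed

end

theory Submission
  imports Defs
begin

text \<open>
  Everything is reduced to one-dimensional statements about the law of the loss. Replacing a
  measure \<open>Q \<ll> P\<close> by its density turns the objective into a supremum over densities
  (\<open>dro_objective_eq_dro_value\<close>). Since closed convex functions are suprema of affine ones, densities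
  can be pushed forward along any measurable map without increasing any divergence
  (\<open>data_processing\<close>); hence the objective depends on the law of the loss only
  (\<open>dro_value_cong_distr\<close>), and the empirical objective is that of a reweighted sample.

  The gap is nonnegative because the objective is concave in \<open>P\<close>: mixing the near-optimal
  reweightings of all samples gives a competitor for \<open>P\<close> whose divergences are at most the expected
  ones (\<open>mixture_bound\<close>). A countable family of reweightings suffices, so that near-optimal ones can
  be selected measurably (\<open>nn_integral_emp_value_le\<close>).

  For the upper bounds, realise the law of a loss with values in \<open>[0, B]\<close> on the unit interval by its
  quantile function. There only nondecreasing densities \<open>r\<close> matter (\<open>Hardy_Littlewood\<close>), and with
  \<open>tail r c = \<integral>\<^bsub>c\<^esub>\<^bsup>1\<^esup> r\<close> and \<open>F\<close> the cdf of the loss the linear part of the objective becomes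
  \<open>\<integral>\<^bsub>0\<^esub>\<^bsup>B\<^esup> tail r (F t) dt\<close> (\<open>dro_value_spectral\<close>). The same \<open>r\<close> may be used for a sample, with \<open>F\<close>
  replaced by the empirical cdf. The number of sample losses below \<open>t\<close> is binomial, so in
  expectation \<open>tail r (F t)\<close> is replaced by its Bernstein polynomial at \<open>F t\<close>, and the gap is at most
  the integrated Bernstein approximation error of the concave function \<open>tail r\<close>
  (\<open>dro_value_le_of_bias_bound\<close>).

  \<^item> If \<open>tail r c \<le> K * sqrt (1 - c)\<close>, this error is at most \<open>K / sqrt n\<close> pointwise
    (\<open>Bernstein_operator_tail_ge\<close>). CVaR at level \<open>\<alpha>\<close> has \<open>K = 1 / sqrt \<alpha>\<close>, and a chi-square ball of
    radius \<open>\<rho>\<close> has \<open>K = sqrt (1 + 2 * \<rho>)\<close>, by Cauchy-Schwarz.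
  \<^item> If the quantile function \<open>g\<close> is \<open>G\<close>-Lipschitz, then \<open>G * u - g u\<close> is nondecreasing in \<open>u\<close>. The gap
    is a linear functional of \<open>g\<close> that is nonnegative on nondecreasing functions, so it is at most
    \<open>G\<close> times its value at the identity, which is at most \<open>1 / (n + 1)\<close> (\<open>bias_le_of_lipschitz\<close>).
  \<^item> For the chi-square penalty the optimal density is a truncated affine function \<open>w\<close> of the loss.
    Unless its sample mean \<open>m\<close> is small, \<open>w / m\<close> is a competitor for the sample; in any case the
    sample objective is below the dual one by at most \<open>5 * (lam + B) * (m - 1)\<^sup>2\<close>, a second-order
    quantity whose expectation is proportional to a variance divided by \<open>n\<close> (\<open>chi2_pen_bias\<close>).
\<close>

section \<open>Closed convex functions as suprema of affine functions\<close>

text \<open>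
  The point \<open>(t, y)\<close> lies outside the closed convex epigraph and is strictly separated from it. The
  separating line is the graph of an affine function unless it is vertical; a non-vertical one exists
  because \<open>\<phi> 1 = 0\<close> puts \<open>(1, -1)\<close> strictly below the epigraph.
\<close>
lemma divergence_fun_affine_minorant_above:
  assumes \<phi>: "divergence_fun \<phi>" and t: "0 \<le> t" and y: "ereal y < \<phi> t"
  shows "\<exists>a b. (\<forall>s\<ge>0. ereal (a * s + b) \<le> \<phi> s) \<and> y < a * t + b"
proof -
  have closed: "closed (epi \<phi>)" and conv: "convex (epi \<phi>)" and one: "\<phi> 1 = 0"
    and fin: "\<And>s. 0 \<le> s \<Longrightarrow> \<phi> s \<noteq> -\<infinity>"
    using \<phi> by (auto simp: divergence_fun_def)
  have sep: "\<exists>a c b. 0 \<le> c \<and> a * t0 + c * y0 < b \<and> (\<forall>s z. 0 \<le> s \<and> \<phi> s \<le> ereal z \<longrightarrow> b < a * s + c * z)"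
    if "0 \<le> t0" "ereal y0 < \<phi> t0" for t0 y0
  proof -
    have "(t0, y0) \<notin> epi \<phi>" using that by (simp add: epi_def not_le)
    from separating_hyperplane_closed_point[OF conv closed this]
    obtain p b where p: "inner p (t0, y0) < b" "\<And>q. q \<in> epi \<phi> \<Longrightarrow> b < inner p q" by blast
    have all: "b < fst p * s + snd p * z" if "0 \<le> s" "\<phi> s \<le> ereal z" for s z
      using p(2)[of "(s, z)"] that by (simp add: epi_def inner_prod_def)
    have "0 \<le> snd p"
    proof (rule ccontr)
      assume neg: "\<not> 0 \<le> snd p"
      define z where "z = max 0 ((b - fst p) / snd p)"
      have "b < fst p + snd p * z" using all[of 1 z] one by (simp add: z_def max_def)
      moreover have "snd p * z \<le> snd p * ((b - fst p) / snd p)"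
        using neg by (intro mult_left_mono_neg) (auto simp: z_def)
      moreover have "snd p * ((b - fst p) / snd p) = b - fst p" using neg by simp
      ultimately show False by linarith
    qed
    with p(1) all show ?thesis
      by (intro exI[of _ "fst p"] exI[of _ "snd p"] exI[of _ b]) (auto simp: inner_prod_def)
  qed
  have steep: "ereal (- a / c * s + b / c) \<le> \<phi> s"
    if "0 < c" "\<forall>s z. 0 \<le> s \<and> \<phi> s \<le> ereal z \<longrightarrow> b < a * s + c * z" "0 \<le> s" for a b c s
  proof (cases "\<phi> s")
    case (real z)
    then have "b < a * s + c * z" using that by auto
    then have "- a / c * s + b / c < z" using that(1) by (simp add: field_simps)
    then show ?thesis using real by simp
  qed (use fin[OF that(3)] in auto)
  obtain a1 c1 b1 where s1: "0 \<le> c1" "a1 - c1 < b1"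
      "\<forall>s z. 0 \<le> s \<and> \<phi> s \<le> ereal z \<longrightarrow> b1 < a1 * s + c1 * z"
    using sep[of 1 "-1"] one by auto
  then have "b1 < a1 * 1 + c1 * 0" using one by (metis order_refl zero_ereal_def zero_le_one)
  with s1 have c1: "0 < c1" by linarith
  note base = steep[OF c1 s1(3)]
  obtain a c b where s: "0 \<le> c" "a * t + c * y < b"
      "\<forall>s z. 0 \<le> s \<and> \<phi> s \<le> ereal z \<longrightarrow> b < a * s + c * z"
    using sep[OF t y] by auto
  show ?thesis
  proof (cases "c = 0")
    case False
    with s have c: "0 < c" by simp
    have "y < - a / c * t + b / c" using s(2) c by (simp add: field_simps)
    with steep[OF c s(3)] show ?thesis by blast
  next
    \<comment> \<open>A vertical separating line is tilted by adding a large multiple of it to a non-vertical one.\<close>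
    case True
    define v where "v = - a1 / c1 * t + b1 / c1"
    \<comment> \<open>The multiple is large enough to lift the value \<open>v\<close> of the non-vertical minorant at \<open>t\<close> above \<open>y\<close>.\<close>
    define N where "N = max 0 ((y - v + 1) / (b - a * t))"
    have pos: "0 < b - a * t" using s(2) True by simp
    have "y - v + 1 = (y - v + 1) / (b - a * t) * (b - a * t)" using pos by simp
    also have "\<dots> \<le> N * (b - a * t)" using pos by (intro mult_right_mono) (auto simp: N_def)
    finally have up: "y < (- a1 / c1 - N * a) * t + (b1 / c1 + N * b)"
      by (simp add: v_def algebra_simps)
    have "ereal ((- a1 / c1 - N * a) * s + (b1 / c1 + N * b)) \<le> \<phi> s" if "0 \<le> s" for s
    proof (cases "\<phi> s")
      case (real z)
      then have "b < a * s" using s(3)[rule_format, of s z] True that by simp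
      then have "N * (b - a * s) \<le> 0" by (intro mult_nonneg_nonpos) (auto simp: N_def)
      then have "(- a1 / c1 - N * a) * s + (b1 / c1 + N * b) \<le> - a1 / c1 * s + b1 / c1"
        by (simp add: algebra_simps)
      also have "\<dots> \<le> z" using base[OF that] real by simp
      finally show ?thesis using real by simp
    qed (use fin[OF that] in auto)
    with up show ?thesis by blast
  qed
qed

text \<open>
  Affine minorants form a subset of the plane, of which a countable dense part gives the same
  supremum.
\<close>
lemma divergence_fun_SUP_affine:
  assumes \<phi>: "divergence_fun \<phi>"
  shows "\<exists>a b :: nat \<Rightarrow> real. \<forall>t\<ge>0. \<phi> t = (SUP k. ereal (a k * t + b k))"
proof -
  define K where "K = {p :: real \<times> real. \<forall>s\<ge>0. ereal (fst p * s + snd p) \<le> \<phi> s}"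
  obtain T where T: "countable T" "T \<subseteq> K" "K \<subseteq> closure T"
    using separable[of K] by metis
  have "\<phi> 1 = 0" using \<phi> by (simp add: divergence_fun_def)
  then have "ereal (-1) < \<phi> 1" by simp
  from divergence_fun_affine_minorant_above[OF \<phi> _ this]
  obtain a0 b0 where "\<forall>s\<ge>0. ereal (a0 * s + b0) \<le> \<phi> s"
    by auto
  then have "(a0, b0) \<in> K" by (simp add: K_def)
  then have "T \<noteq> {}" using T(3) by auto
  define p where "p = from_nat_into T"
  have range: "range p = T" using T(1) \<open>T \<noteq> {}\<close> by (simp add: p_def range_from_nat_into)
  have "\<phi> t = (SUP k. ereal (fst (p k) * t + snd (p k)))" if t: "0 \<le> t" for t
  proof (rule antisym)
    show "(SUP k. ereal (fst (p k) * t + snd (p k))) \<le> \<phi> t"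
      using range T(2) t by (intro SUP_least) (auto simp: K_def)
    show "\<phi> t \<le> (SUP k. ereal (fst (p k) * t + snd (p k)))"
    proof (rule ccontr)
      assume "\<not> ?thesis"
      then have "(SUP k. ereal (fst (p k) * t + snd (p k))) < \<phi> t" by (simp only: not_le)
      from ereal_dense2[OF this]
      obtain y where y: "(SUP k. ereal (fst (p k) * t + snd (p k))) < ereal y" "ereal y < \<phi> t"
        by blast
      have le: "fst q * t + snd q \<le> y" if q: "q \<in> T" for q
      proof -
        obtain k where "q = p k" using range q by blast
        then have "ereal (fst q * t + snd q) \<le> (SUP k. ereal (fst (p k) * t + snd (p k)))"
          by (auto intro: SUP_upper)
        from le_less_trans[OF this y(1)] have "ereal (fst q * t + snd q) < ereal y" .
        then show ?thesis by simp
      qed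
      have "closed {q :: real \<times> real. fst q * t + snd q \<le> y}"
        by (intro closed_Collect_le continuous_intros)
      then have "closure T \<subseteq> {q. fst q * t + snd q \<le> y}"
        using le by (intro closure_minimal) auto
      moreover obtain a b where "\<forall>s\<ge>0. ereal (a * s + b) \<le> \<phi> s" "y < a * t + b"
        using divergence_fun_affine_minorant_above[OF \<phi> t y(2)] by auto
      moreover from this have "(a, b) \<in> K" by (simp add: K_def)
      then have "(a, b) \<in> closure T" using T(3) by (rule set_rev_mp)
      ultimately have "a * t + b \<le> y" by (metis (mono_tags, lifting) fst_conv mem_Collect_eq snd_conv subsetD)
      with \<open>y < a * t + b\<close> show False by simp
    qed
  qed
  then show ?thesis by (intro exI[of _ "\<lambda>k. fst (p k)"] exI[of _ "\<lambda>k. snd (p k)"]) simp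
qed

text \<open>
  Monotone convergence for integrals with values in the extended reals. Integrability of \<open>g 0\<close> bounds
  the negative parts, so that the difference of the limits is defined.
\<close>
lemma eintegral_SUP:
  fixes g :: "nat \<Rightarrow> 'a \<Rightarrow> real"
  assumes int: "\<And>k. integrable M (g k)"
    and mono: "\<And>k x. g k x \<le> g (Suc k) x"
    and F: "\<And>x. F x = (SUP k. ereal (g k x))"
  shows "eintegral M F = (SUP k. ereal (integral\<^sup>L M (g k)))"
proof -
  have [measurable]: "g k \<in> borel_measurable M" for k using int by auto
  have inc: "incseq (\<lambda>k. g k x)" for x using mono by (simp add: incseq_SucI)
  have limF: "(\<lambda>k. ereal (g k x)) \<longlonglongrightarrow> F x" for x
    unfolding F using inc[of x] by (intro LIMSEQ_SUP) (auto simp: incseq_def)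
  define p n where "p k = (\<integral>\<^sup>+x. ennreal (g k x) \<partial>M)" and "n k = (\<integral>\<^sup>+x. ennreal (- g k x) \<partial>M)" for k
  have p: "p \<longlonglongrightarrow> (\<integral>\<^sup>+x. e2ennreal (F x) \<partial>M)"
  proof -
    have *: "incseq (\<lambda>k x. ennreal (g k x))"
      using inc by (auto simp: incseq_def le_fun_def intro!: ennreal_leI)
    have "(\<lambda>k. ennreal (g k x)) \<longlonglongrightarrow> e2ennreal (F x)" for x
      using tendsto_e2ennrealI[OF limF[of x]] by simp
    moreover have "(\<lambda>k. ennreal (g k x)) \<longlonglongrightarrow> (SUP k. ennreal (g k x))" for x
      using * by (intro LIMSEQ_SUP) (auto simp: incseq_def le_fun_def)
    ultimately have "e2ennreal (F x) = (SUP k. ennreal (g k x))" for x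
      using LIMSEQ_unique by blast
    then have "(\<integral>\<^sup>+x. e2ennreal (F x) \<partial>M) = (SUP k. p k)"
      unfolding p_def by (simp add: nn_integral_monotone_convergence_SUP[OF *])
    moreover have "incseq p"
      using * by (auto simp: p_def incseq_def le_fun_def intro!: nn_integral_mono)
    ultimately show ?thesis by (simp add: LIMSEQ_SUP)
  qed
  have fin0: "n 0 < \<infinity>" unfolding n_def
    using integrable_minus[OF int[of 0]] by (simp add: real_integrable_def top.not_eq_extremum)
  have n: "n \<longlonglongrightarrow> (\<integral>\<^sup>+x. e2ennreal (- F x) \<partial>M)"
  proof -
    have *: "decseq (\<lambda>k x. ennreal (- g k x))"
      using mono by (intro decseq_SucI) (auto simp: le_fun_def intro!: ennreal_leI)
    have "(\<lambda>k. ennreal (- g k x)) \<longlonglongrightarrow> e2ennreal (- F x)" for x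
      using tendsto_e2ennrealI[OF tendsto_uminus_ereal[OF limF[of x]]] by simp
    moreover have "(\<lambda>k. ennreal (- g k x)) \<longlonglongrightarrow> (INF k. ennreal (- g k x))" for x
      using mono by (intro LIMSEQ_INF decseq_SucI ennreal_leI) simp
    ultimately have "e2ennreal (- F x) = (INF k. ennreal (- g k x))" for x
      using LIMSEQ_unique by blast
    then have "(\<integral>\<^sup>+x. e2ennreal (- F x) \<partial>M) = (INF k. n k)"
      unfolding n_def using fin0
      by (simp add: nn_integral_monotone_convergence_INF_decseq[OF *, of M 0] n_def)
    moreover have "decseq n"
      unfolding n_def using mono by (intro decseq_SucI nn_integral_mono ennreal_leI) simp
    ultimately show ?thesis by (simp add: LIMSEQ_INF)
  qed
  have finn: "n k < \<infinity>" and finp: "p k < \<infinity>" for k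
    using int[of k] integrable_minus[OF int[of k]]
    by (auto simp: n_def p_def real_integrable_def top.not_eq_extremum)
  have eq: "ereal (integral\<^sup>L M (g k)) = enn2ereal (p k) - enn2ereal (n k)" for k
    using finn[of k] finp[of k]
    unfolding real_lebesgue_integral_def[OF int[of k]] p_def[symmetric] n_def[symmetric]
    by (cases "p k"; cases "n k") (auto simp: top.not_eq_extremum)
  have "(\<integral>\<^sup>+x. e2ennreal (- F x) \<partial>M) \<le> n 0"
    unfolding n_def using F
    by (intro nn_integral_mono) (metis SUP_upper UNIV_I e2ennreal_ereal e2ennreal_mono ereal_minus_le_minus uminus_ereal.simps(1))
  then have finN: "(\<integral>\<^sup>+x. e2ennreal (- F x) \<partial>M) \<noteq> \<infinity>"
    using fin0 by (auto simp: top_unique)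
  have "(\<lambda>k. ereal (integral\<^sup>L M (g k))) \<longlonglongrightarrow> eintegral M F"
    unfolding eq eintegral_def using finN
    by (intro tendsto_diff_ereal_general tendsto_enn2erealI p n) auto
  moreover have "(\<lambda>k. ereal (integral\<^sup>L M (g k))) \<longlonglongrightarrow> (SUP k. ereal (integral\<^sup>L M (g k)))"
    using int mono by (intro LIMSEQ_SUP incseq_SucI) (auto intro!: integral_mono)
  ultimately show ?thesis by (rule LIMSEQ_unique)
qed

section \<open>Objectives as suprema over densities\<close>

text \<open>
  Densities are nonnegative everywhere, not just almost everywhere: divergence functions are
  constrained only on nonnegative arguments.
\<close>
definition densities :: "'a measure \<Rightarrow> ('a \<Rightarrow> real) set" where
  "densities M = {f \<in> borel_measurable M. (\<forall>x. 0 \<le> f x) \<and> integrable M f \<and> integral\<^sup>L M f = 1}"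

definition density_div :: "(real \<Rightarrow> ereal) \<Rightarrow> 'a measure \<Rightarrow> ('a \<Rightarrow> real) \<Rightarrow> ereal" where
  "density_div \<phi> M f = eintegral M (\<lambda>x. \<phi> (f x))"

definition dro_value ::
  "(real \<Rightarrow> ereal) \<Rightarrow> (real \<Rightarrow> ereal) \<Rightarrow> real \<Rightarrow> real \<Rightarrow> 'a measure \<Rightarrow> ('a \<Rightarrow> real) \<Rightarrow> ereal" where
  "dro_value \<phi> \<psi> \<rho> lam M Z =
     (SUP f\<in>{f \<in> densities M. density_div \<phi> M f \<le> ereal \<rho>}.
        ereal (\<integral>x. f x * Z x \<partial>M) - ereal lam * density_div \<psi> M f)"

lemma densitiesD:
  assumes "f \<in> densities M"
  shows "f \<in> borel_measurable M" "0 \<le> f x" "integrable M f" "integral\<^sup>L M f = 1"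
  using assms by (auto simp: densities_def)

lemma integrable_mult_bounded:
  fixes f g :: "'a \<Rightarrow> real"
  assumes "integrable M f" "g \<in> borel_measurable M" "\<And>x. x \<in> space M \<Longrightarrow> \<bar>g x\<bar> \<le> C"
  shows "integrable M (\<lambda>x. f x * g x)"
proof (rule Bochner_Integration.integrable_bound[OF integrable_mult_left[OF assms(1), of C]])
  show "AE x in M. norm (f x * g x) \<le> norm (f x * C)"
    using assms(3) by (intro AE_I2) (auto simp: abs_mult intro!: mult_left_mono order_trans[OF assms(3) abs_ge_self])
qed (use assms in auto)

lemma eintegral_cong_AE:
  assumes "AE x in M. f x = g x"
  shows "eintegral M f = eintegral M g"
proof -
  have "(\<integral>\<^sup>+x. e2ennreal (f x) \<partial>M) = (\<integral>\<^sup>+x. e2ennreal (g x) \<partial>M)"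
    "(\<integral>\<^sup>+x. e2ennreal (- f x) \<partial>M) = (\<integral>\<^sup>+x. e2ennreal (- g x) \<partial>M)"
    by (rule nn_integral_cong_AE, use assms in eventually_elim, simp)+
  then show ?thesis by (simp add: eintegral_def)
qed

lemma RN_deriv_density:
  assumes P: "prob_space P" and Q: "Q \<in> ac_probs P"
  defines "h \<equiv> \<lambda>x. enn2real (RN_deriv P Q x)"
  shows "h \<in> densities P" "density P (\<lambda>x. ennreal (h x)) = Q"
proof -
  interpret P: prob_space P by (rule P)
  interpret Q: prob_space Q using Q by (simp add: ac_probs_def)
  have ac: "absolutely_continuous P Q" and sets: "sets Q = sets P"
    using Q by (auto simp: ac_probs_def)
  have fin: "AE x in P. RN_deriv P Q x \<noteq> \<infinity>"
    using ac sets by (intro P.RN_deriv_finite) (auto simp: Q.sigma_finite_measure_axioms)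
  have [measurable]: "h \<in> borel_measurable P" unfolding h_def by measurable
  have "density P (\<lambda>x. ennreal (h x)) = density P (RN_deriv P Q)"
    using fin by (intro density_cong) (auto simp: h_def top.not_eq_extremum)
  also have "\<dots> = Q" by (rule P.density_RN_deriv[OF ac sets])
  finally show eq: "density P (\<lambda>x. ennreal (h x)) = Q" .
  have "(\<integral>\<^sup>+x. ennreal (h x) \<partial>P) = emeasure (density P (\<lambda>x. ennreal (h x))) (space P)"
    by (simp add: emeasure_density cong: nn_integral_cong)
  also have "\<dots> = 1" using Q.emeasure_space_1 sets_eq_imp_space_eq[OF sets] by (simp add: eq)
  finally have one: "(\<integral>\<^sup>+x. ennreal (h x) \<partial>P) = ennreal 1" by simp
  then have "integrable P h" by (intro integrableI_nonneg) (auto simp: h_def)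
  moreover have "integral\<^sup>L P h = 1"
    using one by (subst integral_eq_nn_integral) (auto simp: h_def)
  ultimately show "h \<in> densities P" by (simp add: densities_def h_def)
qed

lemma density_in_ac_probs:
  assumes P: "prob_space P" and f: "f \<in> densities P"
  shows "density P (\<lambda>x. ennreal (f x)) \<in> ac_probs P"
    and "AE x in P. enn2real (RN_deriv P (density P (\<lambda>x. ennreal (f x))) x) = f x"
proof -
  let ?Q = "density P (\<lambda>x. ennreal (f x))"
  interpret P: prob_space P by (rule P)
  have [measurable]: "f \<in> borel_measurable P" and f0: "\<And>x. 0 \<le> f x"
    using densitiesD[OF f] by auto
  have "emeasure ?Q (space ?Q) = (\<integral>\<^sup>+x. ennreal (f x) \<partial>P)"
    by (simp add: emeasure_density cong: nn_integral_cong)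
  also have "\<dots> = ennreal 1"
    using densitiesD[OF f] by (subst nn_integral_eq_integral) auto
  finally have Q: "prob_space ?Q" by (intro prob_spaceI) simp
  then show "?Q \<in> ac_probs P" by (simp add: ac_probs_def absolutely_continuousI_density)
  have "AE x in P. ennreal (f x) = RN_deriv P ?Q x"
    by (rule P.RN_deriv_unique) auto
  then show "AE x in P. enn2real (RN_deriv P ?Q x) = f x"
    by eventually_elim (metis enn2real_ennreal f0)
qed

text \<open>
  The Radon-Nikodym theorem identifies the measures \<open>Q \<ll> P\<close> with the densities, up to null sets.
\<close>
lemma dro_objective_eq_dro_value:
  assumes P: "prob_space P" and Z: "loss x \<in> borel_measurable P"
  shows "dro_objective \<phi> \<psi> \<rho> lam loss x P = dro_value \<phi> \<psi> \<rho> lam P (loss x)"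
proof -
  have int: "(\<integral>s. loss x s \<partial>density P (\<lambda>s. ennreal (f s))) = (\<integral>s. f s * loss x s \<partial>P)"
    if "f \<in> densities P" for f
    using Z densitiesD[OF that] by (subst integral_density) auto
  show ?thesis
  proof (rule antisym)
    show "dro_objective \<phi> \<psi> \<rho> lam loss x P \<le> dro_value \<phi> \<psi> \<rho> lam P (loss x)"
      unfolding dro_objective_def
    proof (rule SUP_least)
      fix Q assume Q: "Q \<in> {Q \<in> ac_probs P. f_div \<phi> Q P \<le> ereal \<rho>}"
      define h where "h = (\<lambda>x. enn2real (RN_deriv P Q x))"
      have h: "h \<in> densities P" "density P (\<lambda>x. ennreal (h x)) = Q"
        using RN_deriv_density[OF P, of Q] Q by (auto simp: h_def)
      have div: "f_div \<phi>' Q P = density_div \<phi>' P h" for \<phi>'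
        by (simp add: f_div_def density_div_def h_def)
      show "ereal (\<integral>s. loss x s \<partial>Q) - ereal lam * f_div \<psi> Q P \<le> dro_value \<phi> \<psi> \<rho> lam P (loss x)"
        unfolding dro_value_def using Q h int[OF h(1)] by (intro SUP_upper2[of h]) (auto simp: div)
    qed
    show "dro_value \<phi> \<psi> \<rho> lam P (loss x) \<le> dro_objective \<phi> \<psi> \<rho> lam loss x P"
      unfolding dro_value_def
    proof (rule SUP_least)
      fix f assume f: "f \<in> {f \<in> densities P. density_div \<phi> P f \<le> ereal \<rho>}"
      let ?Q = "density P (\<lambda>x. ennreal (f x))"
      have div: "f_div \<phi>' ?Q P = density_div \<phi>' P f" for \<phi>'
        unfolding f_div_def density_div_def
        by (rule eintegral_cong_AE) (use f density_in_ac_probs(2)[OF P, of f] in auto)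
      show "ereal (\<integral>s. f s * loss x s \<partial>P) - ereal lam * density_div \<psi> P f
          \<le> dro_objective \<phi> \<psi> \<rho> lam loss x P"
        unfolding dro_objective_def using f int[of f] density_in_ac_probs(1)[OF P, of f]
        by (intro SUP_upper2[of ?Q]) (auto simp: div)
    qed
  qed
qed

primrec max_affine :: "(nat \<Rightarrow> real) \<Rightarrow> (nat \<Rightarrow> real) \<Rightarrow> nat \<Rightarrow> real \<Rightarrow> real" where
  "max_affine a b 0 t = a 0 * t + b 0"
| "max_affine a b (Suc m) t = max (a (Suc m) * t + b (Suc m)) (max_affine a b m t)"

lemma max_affine_ge: "k \<le> m \<Longrightarrow> a k * t + b k \<le> max_affine a b m t"
  by (induction m) (auto simp: le_Suc_eq le_max_iff_disj)

lemma SUP_max_affine: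
  "(SUP m. ereal (max_affine a b m t)) = (SUP k. ereal (a k * t + b k))"
proof (rule antisym)
  have "ereal (max_affine a b m t) \<le> (SUP k. ereal (a k * t + b k))" for m
  proof (induction m)
    case (Suc m)
    have "ereal (a (Suc m) * t + b (Suc m)) \<le> (SUP k. ereal (a k * t + b k))"
      by (rule SUP_upper) simp
    with Suc show ?case by (simp add: max_def)
  qed (auto intro: SUP_upper2[of 0])
  then show "(SUP m. ereal (max_affine a b m t)) \<le> (SUP k. ereal (a k * t + b k))"
    by (rule SUP_least)
  show "(SUP k. ereal (a k * t + b k)) \<le> (SUP m. ereal (max_affine a b m t))"
    by (intro SUP_mono) (auto intro: max_affine_ge)
qed

lemma borel_measurable_max_affine [measurable]: "max_affine a b m \<in> borel_measurable borel"
proof (induction m)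
  case (Suc m)
  have eq: "max_affine a b (Suc m) = (\<lambda>t. max (a (Suc m) * t + b (Suc m)) (max_affine a b m t))"
    by (rule ext) simp
  note [measurable] = Suc
  show ?case unfolding eq by measurable
qed (simp add: max_affine.simps(1)[abs_def])

lemma integrable_max_affine:
  assumes "finite_measure M" "integrable M f"
  shows "integrable M (\<lambda>x. max_affine a b m (f x))"
proof -
  interpret finite_measure M by fact
  show ?thesis using assms(2) by (induction m) auto
qed

text \<open>
  The slope \<open>\<alpha> t\<close> and intercept \<open>\<beta> t\<close> of an affine piece that is active at \<open>t\<close>, chosen measurably.
\<close>
lemma max_affine_selection:
  "\<exists>\<alpha> \<beta>. \<alpha> \<in> borel_measurable borel \<and> \<beta> \<in> borel_measurable borel \<and> (\<exists>C. \<forall>t. \<bar>\<alpha> t\<bar> \<le> C) \<and> (\<exists>C. \<forall>t. \<bar>\<beta> t\<bar> \<le> C) \<and>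
     (\<forall>t. max_affine a b m t = \<alpha> t * t + \<beta> t) \<and> (\<forall>t s. \<alpha> t * s + \<beta> t \<le> max_affine a b m s)"
proof (induction m)
  case 0
  show ?case by (intro exI[of _ "\<lambda>_. a 0"] exI[of _ "\<lambda>_. b 0"]) auto
next
  case (Suc m)
  then obtain \<alpha> \<beta> C D where [measurable]: "\<alpha> \<in> borel_measurable borel" "\<beta> \<in> borel_measurable borel"
    and C: "\<And>t. \<bar>\<alpha> t\<bar> \<le> C" and D: "\<And>t. \<bar>\<beta> t\<bar> \<le> D"
    and eq: "\<And>t. max_affine a b m t = \<alpha> t * t + \<beta> t"
    and le: "\<And>t s. \<alpha> t * s + \<beta> t \<le> max_affine a b m s" by blast
  define S where "S = {t. max_affine a b m t \<le> a (Suc m) * t + b (Suc m)}"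
  have [measurable]: "S \<in> sets borel" unfolding S_def by measurable
  let ?\<alpha> = "\<lambda>t. if t \<in> S then a (Suc m) else \<alpha> t" and ?\<beta> = "\<lambda>t. if t \<in> S then b (Suc m) else \<beta> t"
  have 1: "?\<alpha> \<in> borel_measurable borel" "?\<beta> \<in> borel_measurable borel" by measurable
  have 2: "\<bar>?\<alpha> t\<bar> \<le> max \<bar>a (Suc m)\<bar> C" "\<bar>?\<beta> t\<bar> \<le> max \<bar>b (Suc m)\<bar> D" for t
    using C[of t] D[of t] by auto
  have 3: "max_affine a b (Suc m) t = ?\<alpha> t * t + ?\<beta> t" for t
    by (simp add: S_def eq[symmetric])
  have 4: "?\<alpha> t * s + ?\<beta> t \<le> max_affine a b (Suc m) s" for t s
    using le[of t s] by (simp add: le_max_iff_disj)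
  show ?case
    by (rule exI[of _ ?\<alpha>], rule exI[of _ ?\<beta>], intro conjI 1 exI allI, (rule 2 3 4)+)
qed

lemma divergence_fun_max_affine:
  assumes "divergence_fun \<phi>"
  shows "\<exists>a b. \<forall>t\<ge>0. \<phi> t = (SUP m. ereal (max_affine a b m t))"
  using divergence_fun_SUP_affine[OF assms] by (simp only: SUP_max_affine)

text \<open>
  This expresses a divergence by integrals of real-valued, integrable functions, which are additive and
  monotone without side conditions.
\<close>
lemma density_div_eq_SUP:
  assumes M: "finite_measure M" and f: "f \<in> densities M"
    and \<phi>: "\<forall>t\<ge>0. \<phi> t = (SUP m. ereal (max_affine a b m t))"
  shows "density_div \<phi> M f = (SUP m. ereal (\<integral>x. max_affine a b m (f x) \<partial>M))"
  unfolding density_div_def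
  by (rule eintegral_SUP)
     (auto intro!: integrable_max_affine M densitiesD[OF f] \<phi>[rule_format])

text \<open>
  Jensen's inequality: the affine piece active at \<open>1\<close> integrates to its value at \<open>1\<close>.
\<close>
lemma density_div_nonneg:
  assumes M: "prob_space M" and f: "f \<in> densities M" and \<phi>: "divergence_fun \<phi>"
  shows "0 \<le> density_div \<phi> M f"
proof -
  interpret prob_space M by fact
  obtain a b where ab': "\<forall>t\<ge>0. \<phi> t = (SUP m. ereal (max_affine a b m t))"
    using divergence_fun_max_affine[OF \<phi>] by blast
  then have ab: "\<And>t. 0 \<le> t \<Longrightarrow> \<phi> t = (SUP m. ereal (max_affine a b m t))" by simp
  have fin: "finite_measure M" by unfold_locales
  have "ereal (max_affine a b m 1) \<le> ereal (\<integral>x. max_affine a b m (f x) \<partial>M)" for m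
  proof -
    obtain \<alpha> \<beta> :: "real \<Rightarrow> real" where eq: "\<And>t. max_affine a b m t = \<alpha> t * t + \<beta> t"
      and le: "\<And>t s. \<alpha> t * s + \<beta> t \<le> max_affine a b m s"
      using max_affine_selection[of a b m] by blast
    have "max_affine a b m 1 = (\<integral>x. \<alpha> 1 * f x + \<beta> 1 \<partial>M)"
      using densitiesD[OF f] by (simp add: eq prob_space)
    also have "\<dots> \<le> (\<integral>x. max_affine a b m (f x) \<partial>M)"
      using densitiesD[OF f] le by (intro integral_mono integrable_max_affine fin) auto
    finally show ?thesis by simp
  qed
  then have "(SUP m. ereal (max_affine a b m 1)) \<le> density_div \<phi> M f"
    unfolding density_div_eq_SUP[OF fin f ab'] by (intro SUP_mono) auto
  moreover have "(SUP m. ereal (max_affine a b m 1)) = 0"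
    using ab[of 1] \<phi> by (simp add: divergence_fun_def)
  ultimately show ?thesis by simp
qed

text \<open>
  The density \<open>h\<close> is the conditional expectation of \<open>f\<close> given \<open>X\<close>, obtained as the Radon-Nikodym
  derivative of the push-forward. The divergence cannot increase: at each point of the target choose
  the affine piece active at \<open>h\<close>. Integrals of \<open>h\<close> against functions on the target equal those of \<open>f\<close>
  against their pull-backs, and on the source the chosen pieces are minorants.
\<close>
lemma data_processing:
  assumes M: "prob_space M" and X[measurable]: "X \<in> measurable M N" and f: "f \<in> densities M"
  obtains h where "h \<in> densities (distr M N X)"
    and "\<And>Z. Z \<in> borel_measurable N \<Longrightarrow> (\<integral>y. h y * Z y \<partial>distr M N X) = (\<integral>x. f x * Z (X x) \<partial>M)"
    and "\<And>\<phi>. divergence_fun \<phi> \<Longrightarrow> density_div \<phi> (distr M N X) h \<le> density_div \<phi> M f"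
proof -
  interpret M: prob_space M by fact
  have [measurable]: "f \<in> borel_measurable M" and f0: "\<And>x. 0 \<le> f x" using densitiesD[OF f] by auto
  define P where "P = distr M N X"
  define D where "D = density M (\<lambda>x. ennreal (f x))"
  define Q where "Q = distr D N X"
  have XD[measurable]: "X \<in> measurable D N" by (simp add: D_def)
  interpret P: prob_space P unfolding P_def by (rule M.prob_space_distr) simp
  have "prob_space D"
    using density_in_ac_probs(1)[OF M f] by (simp add: ac_probs_def D_def)
  then interpret D: prob_space D .
  interpret Q: prob_space Q unfolding Q_def by (rule D.prob_space_distr) simp
  have "absolutely_continuous P Q"
    unfolding absolutely_continuous_def
  proof
    fix A assume A: "A \<in> null_sets P"
    then have "X -` A \<inter> space M \<in> null_sets M"
      unfolding P_def by (simp add: null_sets_distr_iff)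
    moreover have "absolutely_continuous M D" unfolding D_def by (rule absolutely_continuousI_density) simp
    ultimately have "X -` A \<inter> space D \<in> null_sets D"
      by (auto simp: absolutely_continuous_def D_def)
    with A show "A \<in> null_sets Q" by (simp add: Q_def P_def null_sets_distr_iff)
  qed
  then have Q: "Q \<in> ac_probs P" using Q.prob_space_axioms by (simp add: ac_probs_def) (simp add: Q_def P_def)
  define h where "h = (\<lambda>x. enn2real (RN_deriv P Q x))"
  have h: "h \<in> densities P" "density P (\<lambda>x. ennreal (h x)) = Q"
    using RN_deriv_density[OF P.prob_space_axioms Q] by (auto simp: h_def)
  have hm[measurable]: "h \<in> borel_measurable P" and hm'[measurable]: "h \<in> borel_measurable N"
    using densitiesD(1)[OF h(1)] by (auto simp: P_def)
  have int: "(\<integral>y. h y * Z y \<partial>P) = (\<integral>x. f x * Z (X x) \<partial>M)" if [measurable]: "Z \<in> borel_measurable N" for Z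
  proof -
    have Z': "Z \<in> borel_measurable P" by (simp add: P_def)
    have "(\<integral>y. h y * Z y \<partial>P) = integral\<^sup>L (density P (\<lambda>x. ennreal (h x))) Z"
      using densitiesD(2)[OF h(1)] Z' by (subst integral_density) auto
    also have "\<dots> = (\<integral>x. Z (X x) \<partial>D)"
      unfolding h(2) unfolding Q_def by (rule integral_distr) auto
    also have "\<dots> = (\<integral>x. f x * Z (X x) \<partial>M)"
      unfolding D_def using f0 by (subst integral_density) auto
    finally show ?thesis .
  qed
  have div: "density_div \<phi> P h \<le> density_div \<phi> M f" if \<phi>: "divergence_fun \<phi>" for \<phi>
  proof -
    obtain a b where ab': "\<forall>t\<ge>0. \<phi> t = (SUP m. ereal (max_affine a b m t))"
      using divergence_fun_max_affine[OF \<phi>] by blast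
    have "ereal (\<integral>y. max_affine a b m (h y) \<partial>P) \<le> ereal (\<integral>x. max_affine a b m (f x) \<partial>M)" for m
    proof -
      obtain \<alpha> \<beta> C C' where [measurable]: "\<alpha> \<in> borel_measurable borel" "\<beta> \<in> borel_measurable borel"
        and C: "\<And>t. \<bar>\<alpha> t\<bar> \<le> C" "\<And>t. \<bar>\<beta> t\<bar> \<le> C'"
        and eq: "\<And>t. max_affine a b m t = \<alpha> t * t + \<beta> t"
        and le: "\<And>t s. \<alpha> t * s + \<beta> t \<le> max_affine a b m s"
        using max_affine_selection[of a b m] by blast
      have i1: "integrable P (\<lambda>y. h y * \<alpha> (h y))"
        using C(1) by (intro integrable_mult_bounded[of _ _ _ C] densitiesD(3)[OF h(1)]) auto
      have i2: "integrable P (\<lambda>y. \<beta> (h y))"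
        using C(2) by (intro P.integrable_const_bound[of _ C']) auto
      have i3: "integrable M (\<lambda>x. f x * \<alpha> (h (X x)))"
        using C(1) by (intro integrable_mult_bounded[of _ _ _ C] densitiesD(3)[OF f]) auto
      have i4: "integrable M (\<lambda>x. \<beta> (h (X x)))"
        using C(2) by (intro M.integrable_const_bound[of _ C']) auto
      have "(\<integral>y. max_affine a b m (h y) \<partial>P) = (\<integral>y. h y * \<alpha> (h y) + \<beta> (h y) \<partial>P)"
        by (simp add: eq mult.commute)
      also have "\<dots> = (\<integral>y. h y * \<alpha> (h y) \<partial>P) + (\<integral>y. \<beta> (h y) \<partial>P)"
        using i1 i2 by simp
      also have "(\<integral>y. h y * \<alpha> (h y) \<partial>P) = (\<integral>x. f x * \<alpha> (h (X x)) \<partial>M)"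
        by (rule int) simp
      also have "(\<integral>y. \<beta> (h y) \<partial>P) = (\<integral>x. \<beta> (h (X x)) \<partial>M)"
        unfolding P_def by (rule integral_distr) auto
      also have "(\<integral>x. f x * \<alpha> (h (X x)) \<partial>M) + (\<integral>x. \<beta> (h (X x)) \<partial>M) = (\<integral>x. f x * \<alpha> (h (X x)) + \<beta> (h (X x)) \<partial>M)"
        using i3 i4 by simp
      also have "\<dots> \<le> (\<integral>x. max_affine a b m (f x) \<partial>M)"
        using i3 i4 le by (intro integral_mono integrable_max_affine densitiesD(3)[OF f])
          (auto simp: M.finite_measure_axioms mult.commute)
      finally show ?thesis by simp
    qed
    then show ?thesis
      unfolding density_div_eq_SUP[OF M.finite_measure_axioms f ab'] density_div_eq_SUP[OF P.finite_measure_axioms h(1) ab']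
      by (intro SUP_mono) auto
  qed
  show ?thesis using that h(1) int div unfolding P_def by blast
qed

lemma divergence_fun_measurable:
  assumes "divergence_fun \<phi>" "f \<in> borel_measurable M" "\<And>x. 0 \<le> f x"
  shows "(\<lambda>x. \<phi> (f x)) \<in> borel_measurable M"
proof -
  obtain a b where ab': "\<forall>t\<ge>0. \<phi> t = (SUP m. ereal (max_affine a b m t))"
    using divergence_fun_max_affine[OF assms(1)] by blast
  then have ab: "\<And>t. 0 \<le> t \<Longrightarrow> \<phi> t = (SUP m. ereal (max_affine a b m t))" by simp
  note [measurable] = assms(2)
  have "(\<lambda>x. SUP m. ereal (max_affine a b m (f x))) \<in> borel_measurable M" by measurable
  then show ?thesis using ab assms(3) by simp
qed

lemma density_div_distr:
  assumes X[measurable]: "X \<in> measurable M N" and h: "h \<in> borel_measurable N" "\<And>y. 0 \<le> h y"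
    and \<phi>: "divergence_fun \<phi>"
  shows "density_div \<phi> (distr M N X) h = density_div \<phi> M (\<lambda>x. h (X x))"
proof -
  note [measurable] = divergence_fun_measurable[OF \<phi> h]
  show ?thesis
    unfolding density_div_def eintegral_def by (simp add: nn_integral_distr)
qed

lemma densities_distr:
  assumes X[measurable]: "X \<in> measurable M N" and h: "h \<in> densities (distr M N X)"
  shows "(\<lambda>x. h (X x)) \<in> densities M"
proof -
  have [measurable]: "h \<in> borel_measurable N" using densitiesD(1)[OF h] by simp
  show ?thesis
    using densitiesD[OF h] by (auto simp: densities_def integral_distr integrable_distr_eq)
qed

text \<open>
  Densities on the target pull back with the same divergences, and densities on the source push
  forward by \<open>data_processing\<close>.
\<close>
lemma dro_value_distr:
  assumes M: "prob_space M" and X[measurable]: "X \<in> measurable M N" and Z[measurable]: "Z \<in> borel_measurable N"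
    and \<phi>: "divergence_fun \<phi>" and \<psi>: "divergence_fun \<psi>" and lam: "0 \<le> lam"
  shows "dro_value \<phi> \<psi> \<rho> lam (distr M N X) Z = dro_value \<phi> \<psi> \<rho> lam M (\<lambda>x. Z (X x))"
proof (rule antisym)
  show "dro_value \<phi> \<psi> \<rho> lam (distr M N X) Z \<le> dro_value \<phi> \<psi> \<rho> lam M (\<lambda>x. Z (X x))"
    unfolding dro_value_def
  proof (rule SUP_least)
    fix h assume h: "h \<in> {h \<in> densities (distr M N X). density_div \<phi> (distr M N X) h \<le> ereal \<rho>}"
    then have [measurable]: "h \<in> borel_measurable N" and h0: "\<And>y. 0 \<le> h y"
      using densitiesD[of h] by auto
    have "(\<integral>y. h y * Z y \<partial>distr M N X) = (\<integral>x. h (X x) * Z (X x) \<partial>M)"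
      by (rule integral_distr) auto
    with h h0 show "ereal (\<integral>y. h y * Z y \<partial>distr M N X) - ereal lam * density_div \<psi> (distr M N X) h
        \<le> (SUP f\<in>{f \<in> densities M. density_div \<phi> M f \<le> ereal \<rho>}.
              ereal (\<integral>x. f x * Z (X x) \<partial>M) - ereal lam * density_div \<psi> M f)"
      by (intro SUP_upper2[of "\<lambda>x. h (X x)"])
         (auto simp: density_div_distr \<phi> \<psi> intro: densities_distr[OF X])
  qed
  show "dro_value \<phi> \<psi> \<rho> lam M (\<lambda>x. Z (X x)) \<le> dro_value \<phi> \<psi> \<rho> lam (distr M N X) Z"
    unfolding dro_value_def
  proof (rule SUP_least)
    fix f assume f: "f \<in> {f \<in> densities M. density_div \<phi> M f \<le> ereal \<rho>}"
    then obtain h where h: "h \<in> densities (distr M N X)"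
      and int: "\<And>Z. Z \<in> borel_measurable N \<Longrightarrow> (\<integral>y. h y * Z y \<partial>distr M N X) = (\<integral>x. f x * Z (X x) \<partial>M)"
      and div: "\<And>\<phi>. divergence_fun \<phi> \<Longrightarrow> density_div \<phi> (distr M N X) h \<le> density_div \<phi> M f"
      using data_processing[OF M X, of f] by blast
    show "ereal (\<integral>x. f x * Z (X x) \<partial>M) - ereal lam * density_div \<psi> M f
        \<le> (SUP h\<in>{h \<in> densities (distr M N X). density_div \<phi> (distr M N X) h \<le> ereal \<rho>}.
              ereal (\<integral>y. h y * Z y \<partial>distr M N X) - ereal lam * density_div \<psi> (distr M N X) h)"
      using h int[OF Z] div[OF \<phi>] div[OF \<psi>] f lam
      by (intro SUP_upper2[of h] ereal_minus_mono ereal_mult_left_mono) auto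
  qed
qed

lemma dro_value_cong_distr:
  fixes Z :: "'a \<Rightarrow> real" and Z' :: "'b \<Rightarrow> real"
  assumes "prob_space M" "prob_space M'"
    and [measurable]: "Z \<in> borel_measurable M" "Z' \<in> borel_measurable M'"
    and "distr M borel Z = distr M' borel Z'"
    and "divergence_fun \<phi>" "divergence_fun \<psi>" "0 \<le> lam"
  shows "dro_value \<phi> \<psi> \<rho> lam M Z = dro_value \<phi> \<psi> \<rho> lam M' Z'"
  using dro_value_distr[of M Z borel "\<lambda>z. z" \<phi> \<psi> lam \<rho>] dro_value_distr[of M' Z' borel "\<lambda>z. z" \<phi> \<psi> lam \<rho>] assms
  by simp

lemma dro_value_bounds:
  assumes M: "prob_space M" and Z[measurable]: "Z \<in> borel_measurable M"
    and rng: "\<And>x. x \<in> space M \<Longrightarrow> Z x \<in> {0..B}"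
    and \<phi>: "divergence_fun \<phi>" and \<psi>: "divergence_fun \<psi>" and lam: "0 \<le> lam" and \<rho>: "0 \<le> \<rho>"
  shows "0 \<le> dro_value \<phi> \<psi> \<rho> lam M Z" "dro_value \<phi> \<psi> \<rho> lam M Z \<le> ereal B"
proof -
  interpret prob_space M by fact
  have 1: "(\<lambda>_. 1) \<in> densities M" by (simp add: densities_def prob_space)
  have d0: "density_div \<phi>' M (\<lambda>_. 1) = 0" if "divergence_fun \<phi>'" for \<phi>'
    using that by (simp add: density_div_def eintegral_def divergence_fun_def)
  have "0 \<le> (\<integral>x. Z x \<partial>M)" using rng by (intro integral_nonneg_AE AE_I2) auto
  then show "0 \<le> dro_value \<phi> \<psi> \<rho> lam M Z"
    unfolding dro_value_def using 1 d0[OF \<phi>] d0[OF \<psi>] \<rho> by (intro SUP_upper2[of "\<lambda>_. 1"]) auto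
  show "dro_value \<phi> \<psi> \<rho> lam M Z \<le> ereal B"
    unfolding dro_value_def
  proof (rule SUP_least)
    fix f assume f: "f \<in> {f \<in> densities M. density_div \<phi> M f \<le> ereal \<rho>}"
    then have f': "f \<in> densities M" by simp
    note [measurable] = densitiesD(1)[OF f']
    have i: "integrable M (\<lambda>x. f x * Z x)"
      using rng by (intro integrable_mult_bounded[of _ _ _ B] densitiesD(3)[OF f']) auto
    have "(\<integral>x. f x * Z x \<partial>M) \<le> (\<integral>x. f x * B \<partial>M)"
      using densitiesD[OF f'] i rng by (intro integral_mono) (auto intro!: mult_left_mono)
    also have "\<dots> = B" using densitiesD[OF f'] by simp
    finally have "ereal (\<integral>x. f x * Z x \<partial>M) - ereal lam * density_div \<psi> M f \<le> ereal B - 0"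
      using density_div_nonneg[OF M f' \<psi>] lam
      by (intro ereal_minus_mono) (auto simp: ereal_zero_le_0_iff)
    then show "ereal (\<integral>x. f x * Z x \<partial>M) - ereal lam * density_div \<psi> M f \<le> ereal B" by simp
  qed
qed

section \<open>Mixtures of reweighted samples\<close>

lemma measurable_argmax:
  fixes g :: "nat \<Rightarrow> 'a \<Rightarrow> real"
  assumes [measurable]: "\<And>k. g k \<in> borel_measurable M"
  shows "\<exists>\<kappa> \<in> measurable M (count_space UNIV). \<forall>x. \<kappa> x \<le> m \<and> (\<forall>k\<le>m. g k x \<le> g (\<kappa> x) x)"
proof (induction m)
  case 0
  show ?case by (intro bexI[of _ "\<lambda>_. 0"]) auto
next
  case (Suc m)
  then obtain \<kappa> where \<kappa>[measurable]: "\<kappa> \<in> measurable M (count_space UNIV)"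
    and le: "\<And>x. \<kappa> x \<le> m" and max: "\<And>x k. k \<le> m \<Longrightarrow> g k x \<le> g (\<kappa> x) x" by blast
  have [measurable]: "(\<lambda>x. g (\<kappa> x) x) \<in> borel_measurable M"
    by (rule measurable_compose_countable[OF _ \<kappa>]) simp
  let ?\<kappa> = "\<lambda>x. if g (\<kappa> x) x \<le> g (Suc m) x then Suc m else \<kappa> x"
  have "?\<kappa> \<in> measurable M (count_space UNIV)" by measurable
  moreover have "\<forall>x. ?\<kappa> x \<le> Suc m \<and> (\<forall>k\<le>Suc m. g k x \<le> g (?\<kappa> x) x)"
  proof
    fix x show "?\<kappa> x \<le> Suc m \<and> (\<forall>k\<le>Suc m. g k x \<le> g (?\<kappa> x) x)"
  proof (cases "g (\<kappa> x) x \<le> g (Suc m) x")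
    case True
    have "g k x \<le> g (Suc m) x" if "k \<le> Suc m" for k
      using max[of k x] that True by (cases "k = Suc m") (simp_all add: le_Suc_eq)
    then show ?thesis unfolding if_P[OF True] by blast
  next
    case False
    have "g k x \<le> g (\<kappa> x) x" if "k \<le> Suc m" for k
      using that max[of k x] False by (cases "k = Suc m") (simp_all add: le_Suc_eq)
    then show ?thesis unfolding if_not_P[OF False] using le_SucI[OF le[of x]] by blast
    qed
  qed
  ultimately show ?case by (intro bexI[of _ ?\<kappa>])
qed

text \<open>
  The loss at a fixed decision as a bounded random variable \<open>Z\<close>, together with a sample size.
\<close>
locale loss_sample = prob_space P for P :: "'s measure" +
  fixes Z :: "'s \<Rightarrow> real" and B :: real and n :: nat
  assumes Z_measurable[measurable]: "Z \<in> borel_measurable P"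
    and Z_range: "\<And>s. s \<in> space P \<Longrightarrow> 0 \<le> Z s \<and> Z s \<le> B"
    and n_pos: "0 < n"
begin

abbreviation "U\<^sub>n \<equiv> uniform_count_measure {..<n}"
abbreviation "S\<^sub>n \<equiv> Pi\<^sub>M {..<n} (\<lambda>_. P)"

sublocale U: prob_space "U\<^sub>n"
  using n_pos by (intro prob_space_uniform_count_measure) auto

sublocale S: prob_space "S\<^sub>n"
  by (rule prob_space_PiM) unfold_locales

sublocale T: pair_prob_space "U\<^sub>n" "S\<^sub>n" ..

lemma integral_U: "integral\<^sup>L U\<^sub>n f = (\<Sum>i<n. f i) / real n"
  by (simp add: integral_uniform_count_measure)

lemma measurable_U [measurable]: "f \<in> borel_measurable U\<^sub>n"
  by (simp add: measurable_def space_uniform_count_measure)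

lemma integrable_U: "integrable U\<^sub>n (f :: nat \<Rightarrow> real)"
  by (rule U.integrable_const_bound[of _ "\<Sum>i<n. \<bar>f i\<bar>"])
     (auto intro!: AE_I2 member_le_sum simp: space_uniform_count_measure)

lemma densities_U: "f \<in> densities U\<^sub>n \<longleftrightarrow> (\<forall>i. 0 \<le> f i) \<and> (\<Sum>i<n. f i) = real n"
  using n_pos by (auto simp: densities_def integral_U integrable_U field_simps)

lemma Z_component_measurable [measurable]: "i < n \<Longrightarrow> (\<lambda>s. Z (s i)) \<in> borel_measurable S\<^sub>n"
  by measurable

lemma Z_component_range: "s \<in> space S\<^sub>n \<Longrightarrow> i < n \<Longrightarrow> 0 \<le> Z (s i) \<and> Z (s i) \<le> B"
  by (intro Z_range) (auto simp: space_PiM)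

lemma B_nonneg: "0 \<le> B"
  using Z_range not_empty by force

text \<open>
  The objective of the empirical distribution of \<open>s\<close>, as an objective on the set of indices.
\<close>
definition emp_value :: "(real \<Rightarrow> ereal) \<Rightarrow> (real \<Rightarrow> ereal) \<Rightarrow> real \<Rightarrow> real \<Rightarrow> (nat \<Rightarrow> 's) \<Rightarrow> ereal" where
  "emp_value \<phi> \<psi> \<rho> lam s = dro_value \<phi> \<psi> \<rho> lam U\<^sub>n (\<lambda>i. Z (s i))"

definition expected_emp_value :: "(real \<Rightarrow> ereal) \<Rightarrow> (real \<Rightarrow> ereal) \<Rightarrow> real \<Rightarrow> real \<Rightarrow> ereal" where
  "expected_emp_value \<phi> \<psi> \<rho> lam = enn2ereal (\<integral>\<^sup>+s. e2ennreal (emp_value \<phi> \<psi> \<rho> lam s) \<partial>S\<^sub>n)"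

lemma sample_point_measurable [measurable]: "(\<lambda>(i, s). s i) \<in> measurable (U\<^sub>n \<Otimes>\<^sub>M S\<^sub>n) P"
proof -
  have eq: "(\<lambda>(i, s). s i) = (\<lambda>p. (\<lambda>i p. snd p i) (fst p) p)" by (auto simp: fun_eq_iff)
  have *: "fst \<in> measurable (U\<^sub>n \<Otimes>\<^sub>M S\<^sub>n) (count_space {..<n})"
    by (rule measurable_compose[OF measurable_fst]) (simp add: measurable_def space_uniform_count_measure)
  show ?thesis unfolding eq
    by (rule measurable_compose_countable'[OF _ *]) auto
qed

text \<open>
  A uniformly chosen point of an i.i.d. sample has the law \<open>P\<close>. This makes the product of the uniform
  measure on indices and the sample space the source of a data processing step with target \<open>P\<close>.
\<close>
lemma distr_sample_point: "distr (U\<^sub>n \<Otimes>\<^sub>M S\<^sub>n) P (\<lambda>(i, s). s i) = P" (is "distr ?T P ?X = P")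
proof (rule measure_eqI)
  fix A assume "A \<in> sets (distr ?T P ?X)"
  then have A[measurable]: "A \<in> sets P" by simp
  have comp: "emeasure S\<^sub>n (Pair i -` (?X -` A \<inter> space ?T)) = emeasure P A" if i: "i < n" for i
  proof -
    have "Pair i -` (?X -` A \<inter> space ?T) = (\<lambda>s. s i) -` A \<inter> space S\<^sub>n"
      using i by (auto simp: space_pair_measure space_uniform_count_measure)
    also have "emeasure S\<^sub>n \<dots> = emeasure (distr S\<^sub>n P (\<lambda>s. s i)) A"
      using i by (intro emeasure_distr[symmetric]) auto
    also have "distr S\<^sub>n P (\<lambda>s. s i) = P"
      using i by (intro distr_PiM_component) (auto intro: prob_space_axioms)
    finally show ?thesis .
  qed
  have "emeasure (distr ?T P ?X) A = emeasure ?T (?X -` A \<inter> space ?T)"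
    by (rule emeasure_distr) auto
  also have "\<dots> = (\<integral>\<^sup>+i. emeasure S\<^sub>n (Pair i -` (?X -` A \<inter> space ?T)) \<partial>U\<^sub>n)"
    by (rule S.emeasure_pair_measure_alt) measurable
  also have "\<dots> = (\<integral>\<^sup>+i. emeasure P A \<partial>U\<^sub>n)"
    by (intro nn_integral_cong comp) (simp add: space_uniform_count_measure)
  finally show "emeasure (distr ?T P ?X) A = emeasure P A" by (simp add: U.emeasure_space_1)
qed simp

text \<open>
  The selected weights define the density \<open>(i, s) \<mapsto> w (\<kappa> s) i\<close> on pairs of an index and a sample. Its
  divergences are expectations of those of the selected weights, and pushing it forward to \<open>P\<close> along
  \<open>(i, s) \<mapsto> s i\<close> gives a feasible density there.
\<close>
lemma mixture_bound:
  fixes w :: "nat \<Rightarrow> nat \<Rightarrow> real" and c :: "nat \<Rightarrow> real"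
  assumes \<kappa>[measurable]: "\<kappa> \<in> measurable S\<^sub>n (count_space UNIV)" and \<kappa>m: "\<And>s. \<kappa> s \<le> m"
    and w: "\<And>k. w k \<in> densities U\<^sub>n" and w\<phi>: "\<And>k. density_div \<phi> U\<^sub>n (w k) \<le> ereal \<rho>"
    and w\<psi>: "\<And>k. ereal lam * density_div \<psi> U\<^sub>n (w k) \<le> ereal (c k)"
    and \<phi>: "divergence_fun \<phi>" and \<psi>: "divergence_fun \<psi>" and lam: "0 \<le> lam"
  shows "ereal (\<integral>s. (\<Sum>i<n. w (\<kappa> s) i * Z (s i)) / real n - c (\<kappa> s) \<partial>S\<^sub>n) \<le> dro_value \<phi> \<psi> \<rho> lam P Z"
proof -
  let ?T = "U\<^sub>n \<Otimes>\<^sub>M S\<^sub>n" and ?X = "\<lambda>(i, s). s i"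
  define f where "f = (\<lambda>(i, s). w (\<kappa> s) i)"
  have w0: "0 \<le> w k i" for k i using densitiesD(2)[OF w] .
  have \<kappa>T: "(\<lambda>p. \<kappa> (snd p)) \<in> measurable ?T (count_space UNIV)" by measurable
  have fm[measurable]: "f \<in> borel_measurable ?T"
  proof -
    have eq: "f = (\<lambda>p. (\<lambda>k p. w k (fst p)) (\<kappa> (snd p)) p)" by (auto simp: f_def)
    show ?thesis unfolding eq by (rule measurable_compose_countable[OF _ \<kappa>T]) measurable
  qed
  have cm: "(\<lambda>s. d (\<kappa> s)) \<in> borel_measurable S\<^sub>n" for d :: "nat \<Rightarrow> real"
    by (rule measurable_compose[OF \<kappa>]) simp
  have bnd: "\<bar>d (\<kappa> s)\<bar> \<le> (\<Sum>k\<le>m. \<bar>d k\<bar>)" for s and d :: "nat \<Rightarrow> real"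
    using \<kappa>m[of s] by (intro member_le_sum) auto
  have ci: "integrable S\<^sub>n (\<lambda>s. d (\<kappa> s))" for d :: "nat \<Rightarrow> real"
    by (rule S.integrable_const_bound[OF _ cm, of _ "\<Sum>k\<le>m. \<bar>d k\<bar>"]) (simp add: bnd)
  define C where "C = (\<Sum>k\<le>m. \<Sum>i<n. w k i)"
  have fC: "\<bar>f p\<bar> \<le> C" if pT: "p \<in> space ?T" for p
  proof -
    obtain i s where p: "p = (i, s)" "i < n"
      using pT by (auto simp: space_pair_measure space_uniform_count_measure)
    have "w (\<kappa> s) i \<le> (\<Sum>i<n. w (\<kappa> s) i)" using p w0 by (intro member_le_sum) auto
    also have "\<dots> \<le> C" unfolding C_def
      using \<kappa>m[of s] w0 by (intro member_le_sum) (auto intro: sum_nonneg)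
    finally show ?thesis using w0 by (simp add: p f_def)
  qed
  have fi: "integrable ?T f" by (rule T.integrable_const_bound[of _ C]) (use fC in auto)
  have fub: "integral\<^sup>L ?T F = (\<integral>s. (\<Sum>i<n. F (i, s)) / real n \<partial>S\<^sub>n)" if "integrable ?T F" for F :: "_ \<Rightarrow> real"
    using T.integral_snd[of "\<lambda>i s. F (i, s)"] that by (simp add: integral_U)
  have f: "f \<in> densities ?T"
  proof -
    have "integral\<^sup>L ?T f = (\<integral>s. 1 \<partial>S\<^sub>n)"
      unfolding fub[OF fi] using w n_pos by (intro Bochner_Integration.integral_cong) (auto simp: f_def densities_U)
    then show ?thesis using fi w0 by (auto simp: densities_def f_def S.prob_space)
  qed
  have div: "density_div \<phi>' ?T f \<le> ereal (\<integral>s. d (\<kappa> s) \<partial>S\<^sub>n)"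
    if \<phi>': "divergence_fun \<phi>'" and d: "\<And>k. density_div \<phi>' U\<^sub>n (w k) \<le> ereal (d k)" for \<phi>' d
  proof -
    obtain a b where ab: "\<forall>t\<ge>0. \<phi>' t = (SUP m. ereal (max_affine a b m t))"
      using divergence_fun_max_affine[OF \<phi>'] by blast
    have "(\<integral>p. max_affine a b l (f p) \<partial>?T) \<le> (\<integral>s. d (\<kappa> s) \<partial>S\<^sub>n)" for l
    proof -
      have int: "integrable ?T (\<lambda>p. max_affine a b l (f p))"
        by (intro integrable_max_affine fi) unfold_locales
      have le: "(\<Sum>i<n. max_affine a b l (w k i)) / real n \<le> d k" for k
      proof -
        have "ereal (\<integral>i. max_affine a b l (w k i) \<partial>U\<^sub>n) \<le> density_div \<phi>' U\<^sub>n (w k)"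
          unfolding density_div_eq_SUP[OF U.finite_measure_axioms w ab] by (rule SUP_upper) simp
        also have "\<dots> \<le> ereal (d k)" by (rule d)
        finally show ?thesis by (simp add: integral_U)
      qed
      have "(\<integral>p. max_affine a b l (f p) \<partial>?T) = (\<integral>s. (\<Sum>i<n. max_affine a b l (w (\<kappa> s) i)) / real n \<partial>S\<^sub>n)"
        unfolding fub[OF int] by (simp add: f_def)
      also have "\<dots> \<le> (\<integral>s. d (\<kappa> s) \<partial>S\<^sub>n)"
        by (intro integral_mono le ci[of d] ci[of "\<lambda>k. (\<Sum>i<n. max_affine a b l (w k i)) / real n"])
      finally show ?thesis .
    qed
    then show ?thesis
      unfolding density_div_eq_SUP[OF T.finite_measure_axioms f ab] by (intro SUP_least) auto
  qed
  obtain h where h: "h \<in> densities P"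
    and int: "\<And>Z. Z \<in> borel_measurable P \<Longrightarrow> (\<integral>y. h y * Z y \<partial>P) = (\<integral>p. f p * Z (?X p) \<partial>?T)"
    and le: "\<And>\<phi>. divergence_fun \<phi> \<Longrightarrow> density_div \<phi> P h \<le> density_div \<phi> ?T f"
    using data_processing[OF T.prob_space_axioms sample_point_measurable f] unfolding distr_sample_point by blast
  have h\<phi>: "density_div \<phi> P h \<le> ereal \<rho>"
    using order_trans[OF le[OF \<phi>] div[OF \<phi> w\<phi>]] by (simp add: S.prob_space)
  have h\<psi>: "ereal lam * density_div \<psi> P h \<le> ereal (\<integral>s. c (\<kappa> s) \<partial>S\<^sub>n)"
  proof (cases "lam = 0")
    case True
    have "0 \<le> c k" for k
    proof -
      have "ereal 0 * density_div \<psi> U\<^sub>n (w k) \<le> ereal (c k)" using w\<psi>[of k] unfolding True .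
      then show ?thesis by (simp flip: zero_ereal_def)
    qed
    then have "0 \<le> (\<integral>s. c (\<kappa> s) \<partial>S\<^sub>n)" by (intro integral_nonneg_AE AE_I2) simp
    then show ?thesis by (simp add: True flip: zero_ereal_def)
  next
    case False
    then have l: "0 < lam" using lam by simp
    have "density_div \<psi> U\<^sub>n (w k) \<le> ereal (c k / lam)" for k
      using w\<psi>[of k] l by (cases "density_div \<psi> U\<^sub>n (w k)") (auto simp: field_simps)
    from order_trans[OF le[OF \<psi>] div[OF \<psi> this]]
    have "density_div \<psi> P h \<le> ereal ((\<integral>s. c (\<kappa> s) \<partial>S\<^sub>n) / lam)" by simp
    then have "ereal lam * density_div \<psi> P h \<le> ereal lam * ereal ((\<integral>s. c (\<kappa> s) \<partial>S\<^sub>n) / lam)"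
      using lam by (intro ereal_mult_left_mono) auto
    then show ?thesis using l by simp
  qed
  have fZi: "integrable ?T (\<lambda>p. f p * Z (?X p))"
  proof (rule integrable_mult_bounded[OF fi, of _ B])
    show "(\<lambda>p. Z (?X p)) \<in> borel_measurable ?T"
      by (rule measurable_compose[OF sample_point_measurable]) simp
    show "\<bar>Z (?X p)\<bar> \<le> B" if "p \<in> space ?T" for p
      using that Z_range[of "?X p"] measurable_space[OF sample_point_measurable that] by auto
  qed
  have sumi: "integrable S\<^sub>n (\<lambda>s. (\<Sum>i<n. w (\<kappa> s) i * Z (s i)) / real n)"
    using T.integrable_snd[of "\<lambda>i s. f (i, s) * Z (s i)"] fZi
    by (simp add: integral_U f_def case_prod_beta')
  have "(\<integral>y. h y * Z y \<partial>P) = (\<integral>s. (\<Sum>i<n. w (\<kappa> s) i * Z (s i)) / real n \<partial>S\<^sub>n)"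
    unfolding int[OF Z_measurable] fub[OF fZi] by (simp add: f_def)
  then have "ereal (\<integral>s. (\<Sum>i<n. w (\<kappa> s) i * Z (s i)) / real n - c (\<kappa> s) \<partial>S\<^sub>n)
      = ereal (\<integral>y. h y * Z y \<partial>P) - ereal (\<integral>s. c (\<kappa> s) \<partial>S\<^sub>n)"
    using sumi ci[of c] by simp
  also have "\<dots> \<le> ereal (\<integral>y. h y * Z y \<partial>P) - ereal lam * density_div \<psi> P h"
    by (intro ereal_minus_mono h\<psi>) simp
  also have "\<dots> \<le> dro_value \<phi> \<psi> \<rho> lam P Z"
    unfolding dro_value_def using h h\<phi> by (intro SUP_upper) simp
  finally show ?thesis .
qed

text \<open>
  For a fixed sample the objective is the supremum of the continuous functional
  \<open>(w, c) \<mapsto> (\<Sum>i<n. w i * Z (s i)) / n - c\<close> over a set that does not depend on the sample; a countable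
  dense subset of that set serves all samples at once. The constant weights are put first, to make all
  finite maxima nonnegative.
\<close>
lemma emp_value_countable_SUP:
  assumes \<phi>: "divergence_fun \<phi>" and \<psi>: "divergence_fun \<psi>" and lam: "0 \<le> lam" and \<rho>: "0 \<le> \<rho>"
  shows "\<exists>w c. w 0 = (\<lambda>_. 1) \<and> c 0 = (0::real) \<and>
    (\<forall>k. w k \<in> densities U\<^sub>n \<and> density_div \<phi> U\<^sub>n (w k) \<le> ereal \<rho> \<and> ereal lam * density_div \<psi> U\<^sub>n (w k) \<le> ereal (c k)) \<and>
    (\<forall>s. emp_value \<phi> \<psi> \<rho> lam s = (SUP k. ereal ((\<Sum>i<n. w (k::nat) i * Z (s i)) / real n - c k)))"
proof -
  define K where "K = {p :: (nat \<Rightarrow> real) \<times> real. fst p \<in> densities U\<^sub>n \<and> density_div \<phi> U\<^sub>n (fst p) \<le> ereal \<rho> \<and>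
    ereal lam * density_div \<psi> U\<^sub>n (fst p) \<le> ereal (snd p)}"
  define J where "J s p = (\<Sum>i<n. fst p i * Z (s i)) / real n - snd p" for s and p :: "(nat \<Rightarrow> real) \<times> real"
  have one: "((\<lambda>_. 1), 0) \<in> K"
  proof -
    have "density_div \<phi>' U\<^sub>n (\<lambda>_. 1) = 0" if "divergence_fun \<phi>'" for \<phi>'
      using that by (simp add: density_div_def eintegral_def divergence_fun_def)
    with \<phi> \<psi> \<rho> show ?thesis by (simp add: K_def densities_U)
  qed
  obtain T where T: "countable T" "T \<subseteq> K" "K \<subseteq> closure T" using separable[of K] by metis
  define p where "p = from_nat_into T"
  have ne: "T \<noteq> {}" using one T(3) by auto
  have range: "range p = T" using T(1) ne by (simp add: p_def range_from_nat_into)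
  \<comment> \<open>Prepending a point of \<open>K\<close> to the enumeration of \<open>T\<close> does not change the supremum.\<close>
  define q where "q = (\<lambda>k::nat. case k of 0 \<Rightarrow> ((\<lambda>_. 1), 0) | Suc k \<Rightarrow> p k)"
  have qK: "q k \<in> K" for k using one T(2) range by (auto simp: q_def split: nat.split)
  have "emp_value \<phi> \<psi> \<rho> lam s = (SUP k. ereal (J s (q k)))" for s
  proof (rule antisym)
    show "(SUP k. ereal (J s (q k))) \<le> emp_value \<phi> \<psi> \<rho> lam s"
    proof (rule SUP_least)
      fix k
      have "ereal (J s (q k)) = ereal (\<integral>i. fst (q k) i * Z (s i) \<partial>U\<^sub>n) - ereal (snd (q k))"
        by (simp add: J_def integral_U)
      also have "\<dots> \<le> ereal (\<integral>i. fst (q k) i * Z (s i) \<partial>U\<^sub>n) - ereal lam * density_div \<psi> U\<^sub>n (fst (q k))"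
        using qK[of k] by (intro ereal_minus_mono) (auto simp: K_def)
      also have "\<dots> \<le> emp_value \<phi> \<psi> \<rho> lam s"
        unfolding emp_value_def dro_value_def using qK[of k] by (intro SUP_upper) (simp add: K_def)
      finally show "ereal (J s (q k)) \<le> emp_value \<phi> \<psi> \<rho> lam s" .
    qed
    have le: "ereal (J s r) \<le> (SUP k. ereal (J s (q k)))" if r: "r \<in> K" for r
    proof (rule ccontr)
      assume "\<not> ?thesis"
      then have "(SUP k. ereal (J s (q k))) < ereal (J s r)" by (simp only: not_le)
      from ereal_dense2[OF this]
      obtain y where y: "(SUP k. ereal (J s (q k))) < ereal y" "ereal y < ereal (J s r)" by blast
      have "J s t \<le> y" if "t \<in> T" for t
      proof -
        have "t \<in> range p" using range that by simp
        then obtain k where "t = p k" by (rule rangeE)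
        then have "ereal (J s t) = ereal (J s (q (Suc k)))" by (simp add: q_def)
        also have "\<dots> \<le> (SUP k. ereal (J s (q k)))" by (rule SUP_upper) simp
        finally have "ereal (J s t) \<le> (SUP k. ereal (J s (q k)))" .
        from le_less_trans[OF this y(1)] show ?thesis by simp
      qed
      moreover have "closed {t. J s t \<le> y}"
        unfolding J_def divide_inverse
        by (intro closed_Collect_le continuous_intros continuous_on_product_then_coordinatewise[of UNIV fst]) 
      ultimately have "closure T \<subseteq> {t. J s t \<le> y}" by (intro closure_minimal) auto
      then have "J s r \<le> y" using r T(3) by auto
      with y(2) show False by simp
    qed
    show "emp_value \<phi> \<psi> \<rho> lam s \<le> (SUP k. ereal (J s (q k)))"
      unfolding emp_value_def dro_value_def
    proof (rule SUP_least)
      fix f assume f: "f \<in> {f \<in> densities U\<^sub>n. density_div \<phi> U\<^sub>n f \<le> ereal \<rho>}"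
      have "0 \<le> ereal lam * density_div \<psi> U\<^sub>n f"
        using density_div_nonneg[OF U.prob_space_axioms _ \<psi>, of f] f lam by (simp add: ereal_zero_le_0_iff)
      then consider "ereal lam * density_div \<psi> U\<^sub>n f = \<infinity>" | c where "ereal lam * density_div \<psi> U\<^sub>n f = ereal c"
        by (cases "ereal lam * density_div \<psi> U\<^sub>n f") auto
      then show "ereal (\<integral>i. f i * Z (s i) \<partial>U\<^sub>n) - ereal lam * density_div \<psi> U\<^sub>n f \<le> (SUP k. ereal (J s (q k)))"
      proof cases
        case 1
        show ?thesis unfolding 1 by simp
      next
        case 2
        have "(f, c) \<in> K" using f 2 by (simp add: K_def)
        from le[OF this] show ?thesis unfolding 2 J_def integral_U by simp
      qed
    qed
  qed
  then have a1: "\<forall>s. emp_value \<phi> \<psi> \<rho> lam s = (SUP k. ereal ((\<Sum>i<n. fst (q k) i * Z (s i)) / real n - snd (q k)))"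
    unfolding J_def by (rule allI)
  have a2: "fst (q 0) = (\<lambda>_. 1)" "snd (q 0) = 0" by (simp_all add: q_def)
  have a3: "\<forall>k. fst (q k) \<in> densities U\<^sub>n \<and> density_div \<phi> U\<^sub>n (fst (q k)) \<le> ereal \<rho> \<and>
      ereal lam * density_div \<psi> U\<^sub>n (fst (q k)) \<le> ereal (snd (q k))"
    using qK by (simp add: K_def)
  show ?thesis
    by (rule exI[of _ "\<lambda>k. fst (q k)"], rule exI[of _ "\<lambda>k. snd (q k)"], rule conjI[OF a2(1) conjI[OF a2(2) conjI[OF a3 a1]]])
qed

lemma nn_integral_emp_value_le:
  assumes \<phi>: "divergence_fun \<phi>" and \<psi>: "divergence_fun \<psi>" and lam: "0 \<le> lam" and \<rho>: "0 \<le> \<rho>"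
  shows "(\<integral>\<^sup>+s. e2ennreal (emp_value \<phi> \<psi> \<rho> lam s) \<partial>S\<^sub>n) \<le> e2ennreal (dro_value \<phi> \<psi> \<rho> lam P Z)"
proof -
  obtain w c where w0: "w 0 = (\<lambda>_. 1)" "c 0 = (0::real)"
    and w: "\<And>k. w k \<in> densities U\<^sub>n" "\<And>k. density_div \<phi> U\<^sub>n (w k) \<le> ereal \<rho>"
      "\<And>k. ereal lam * density_div \<psi> U\<^sub>n (w k) \<le> ereal (c k)"
    and sup: "\<And>s. emp_value \<phi> \<psi> \<rho> lam s = (SUP k. ereal ((\<Sum>i<n. w (k::nat) i * Z (s i)) / real n - c k))"
    using emp_value_countable_SUP[OF assms] by blast
  define g where "g = (\<lambda>k s. (\<Sum>i<n. w k i * Z (s i)) / real n - c k)"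
  have gm[measurable]: "g k \<in> borel_measurable S\<^sub>n" for k unfolding g_def by measurable
  have "\<exists>\<kappa>\<in>measurable S\<^sub>n (count_space UNIV). \<forall>s. \<kappa> s \<le> m \<and> (\<forall>k\<le>m. g k s \<le> g (\<kappa> s) s)" for m
    by (rule measurable_argmax) simp
  then obtain \<kappa> where \<kappa>[measurable]: "\<And>m. \<kappa> m \<in> measurable S\<^sub>n (count_space UNIV)"
    and \<kappa>m: "\<And>m s. \<kappa> m s \<le> m" and max: "\<And>m k s. k \<le> m \<Longrightarrow> g k s \<le> g (\<kappa> m s) s" by metis
  \<comment> \<open>The maximum of the first functionals, which increases to the empirical objective.\<close>
  define V where "V m s = g (\<kappa> m s) s" for m s
  have Vm[measurable]: "V m \<in> borel_measurable S\<^sub>n" for m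
    unfolding V_def by (rule measurable_compose_countable[OF _ \<kappa>]) simp
  have V0: "0 \<le> V m s" if "s \<in> space S\<^sub>n" for m s
  proof -
    have "0 \<le> g 0 s" using Z_component_range[OF that] by (auto simp: g_def w0 intro!: sum_nonneg divide_nonneg_nonneg)
    also have "\<dots> \<le> V m s" unfolding V_def by (rule max) simp
    finally show ?thesis .
  qed
  have inc: "incseq (\<lambda>m s. ennreal (V m s))"
    by (intro incseq_SucI le_funI ennreal_leI) (auto simp: V_def intro!: max le_SucI \<kappa>m)
  have supV: "e2ennreal (emp_value \<phi> \<psi> \<rho> lam s) = (SUP m. ennreal (V m s))" for s
  proof -
    have "(SUP k. ereal (g k s)) = (SUP m. ereal (V m s))"
      by (rule antisym; rule SUP_mono) (auto simp: V_def intro: max)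
    moreover have "(\<lambda>m. ereal (V m s)) \<longlonglongrightarrow> (SUP m. ereal (V m s))"
      by (intro LIMSEQ_SUP incseq_SucI) (auto simp: V_def intro!: max le_SucI \<kappa>m)
    from tendsto_e2ennrealI[OF this]
    have "(\<lambda>m. ennreal (V m s)) \<longlonglongrightarrow> e2ennreal (SUP m. ereal (V m s))" by simp
    moreover have "(\<lambda>m. ennreal (V m s)) \<longlonglongrightarrow> (SUP m. ennreal (V m s))"
      using inc by (intro LIMSEQ_SUP) (auto simp: incseq_def le_fun_def)
    ultimately have "e2ennreal (SUP k. ereal (g k s)) = (SUP m. ennreal (V m s))"
      by (simp add: LIMSEQ_unique)
    then show ?thesis by (simp only: sup g_def)
  qed
  have Vint: "integrable S\<^sub>n (V m)" for m
  proof (rule S.integrable_const_bound[of _ "\<Sum>k\<le>m. (\<Sum>i<n. w k i * B) / real n + \<bar>c k\<bar>"])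
    show "AE s in S\<^sub>n. norm (V m s) \<le> (\<Sum>k\<le>m. (\<Sum>i<n. w k i * B) / real n + \<bar>c k\<bar>)"
    proof (rule AE_I2)
      fix s assume s: "s \<in> space S\<^sub>n"
      have w0: "0 \<le> w k i" for k i using densitiesD(2)[OF w(1)] .
      have "norm (V m s) = g (\<kappa> m s) s" using V0[OF s, of m] by (simp add: V_def)
      also have "\<dots> \<le> (\<Sum>i<n. w (\<kappa> m s) i * B) / real n + \<bar>c (\<kappa> m s)\<bar>"
      proof -
        have "(\<Sum>i<n. w (\<kappa> m s) i * Z (s i)) \<le> (\<Sum>i<n. w (\<kappa> m s) i * B)"
          using Z_component_range[OF s] w0 by (intro sum_mono mult_left_mono) auto
        then have "(\<Sum>i<n. w (\<kappa> m s) i * Z (s i)) / real n \<le> (\<Sum>i<n. w (\<kappa> m s) i * B) / real n"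
          by (rule divide_right_mono) simp
        then show ?thesis unfolding g_def by linarith
      qed
      also have "\<dots> \<le> (\<Sum>k\<le>m. (\<Sum>i<n. w k i * B) / real n + \<bar>c k\<bar>)"
        using \<kappa>m[of m s] w0 B_nonneg by (intro member_le_sum) (auto intro!: add_nonneg_nonneg sum_nonneg divide_nonneg_nonneg)
      finally show "norm (V m s) \<le> (\<Sum>k\<le>m. (\<Sum>i<n. w k i * B) / real n + \<bar>c k\<bar>)" .
    qed
  qed simp
  have "(\<integral>\<^sup>+s. e2ennreal (emp_value \<phi> \<psi> \<rho> lam s) \<partial>S\<^sub>n) = (SUP m. \<integral>\<^sup>+s. ennreal (V m s) \<partial>S\<^sub>n)"
    unfolding supV by (rule nn_integral_monotone_convergence_SUP[OF inc]) simp
  also have "\<dots> \<le> e2ennreal (dro_value \<phi> \<psi> \<rho> lam P Z)"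
  proof (rule SUP_least)
    fix m
    have "(\<integral>\<^sup>+s. ennreal (V m s) \<partial>S\<^sub>n) = ennreal (\<integral>s. V m s \<partial>S\<^sub>n)"
      using V0 Vint by (intro nn_integral_eq_integral) auto
    also have "\<dots> = e2ennreal (ereal (\<integral>s. V m s \<partial>S\<^sub>n))" by simp
    also have "\<dots> \<le> e2ennreal (dro_value \<phi> \<psi> \<rho> lam P Z)"
      unfolding V_def g_def
      by (intro e2ennreal_mono mixture_bound[OF \<kappa> \<kappa>m w \<phi> \<psi> lam])
    finally show "(\<integral>\<^sup>+s. ennreal (V m s) \<partial>S\<^sub>n) \<le> e2ennreal (dro_value \<phi> \<psi> \<rho> lam P Z)" .
  qed
  finally show ?thesis .
qed

end

section \<open>Tail integrals of nondecreasing densities\<close>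

abbreviation unit_measure :: "real measure" where
  "unit_measure \<equiv> restrict_space lborel {0<..<1}"

text \<open>
  As a function of \<open>c\<close> this is the mass that the density \<open>r\<close> gives to the largest quantiles, a fraction
  \<open>1 - c\<close> of the whole. It is concave when \<open>r\<close> is nondecreasing.
\<close>
definition tail :: "(real \<Rightarrow> real) \<Rightarrow> real \<Rightarrow> real" where
  "tail r c = (\<integral>u. r u * indicator {c<..} u \<partial>unit_measure)"

definition Bernstein_operator :: "nat \<Rightarrow> (real \<Rightarrow> real) \<Rightarrow> real \<Rightarrow> real" where
  "Bernstein_operator n q x = (\<Sum>k\<le>n. q (real k / real n) * Bernstein n k x)"

lemma prob_space_unit: "prob_space unit_measure"
  by (auto simp: space_restrict_space emeasure_restrict_space intro!: prob_spaceI)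

interpretation unit: prob_space unit_measure by (rule prob_space_unit)

lemma space_unit [simp]: "space unit_measure = {0<..<1}"
  by (simp add: space_restrict_space)

lemma measurable_unit_mono:
  fixes h :: "real \<Rightarrow> real"
  assumes "mono_on {0<..<1} h"
  shows "h \<in> borel_measurable unit_measure"
  using borel_measurable_mono_on_fnc[OF assms] by (simp cong: measurable_cong_sets add: sets_restrict_space)

lemma measurable_unit_borel [measurable (raw)]:
  "h \<in> borel_measurable borel \<Longrightarrow> h \<in> borel_measurable unit_measure"
  by (intro measurable_restrict_space1) simp

lemma integral_indicator_greaterThan:
  assumes "0 \<le> c" "c \<le> 1"
  shows "(\<integral>u. indicator {c<..} u \<partial>unit_measure) = 1 - c"
proof -
  have eq: "indicator {0<..<1} u *\<^sub>R indicator {c<..} u = (indicator {c<..<1} u :: real)" for u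
    using assms by (auto split: split_indicator)
  have "(\<integral>u. indicator {c<..} u \<partial>unit_measure) = (\<integral>u. (indicator {c<..<1} u :: real) \<partial>lborel)"
    unfolding eq[symmetric] by (rule integral_restrict_space) simp
  then show ?thesis using assms by simp
qed

lemma integrable_indicator_greaterThan:
  "integrable unit_measure (indicator {c<..} :: real \<Rightarrow> real)"
  by (rule unit.integrable_const_bound[of _ 1]) (auto split: split_indicator)

lemma integrable_mult_indicator_greaterThan:
  fixes r :: "real \<Rightarrow> real"
  assumes "integrable unit_measure r"
  shows "integrable unit_measure (\<lambda>u. r u * indicator {c<..} u)"
  by (rule integrable_mult_bounded[OF assms, of _ 1]) (auto split: split_indicator)

text \<open>
  Write \<open>h x\<close> as the integral of \<open>indicator {t<..} (h x)\<close> over \<open>t\<close> and exchange the integrals. The factor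
  \<open>k\<close> may change sign.
\<close>
lemma layer_cake:
  fixes k h :: "'a \<Rightarrow> real"
  assumes "sigma_finite_measure M" and k: "integrable M k" and h[measurable]: "h \<in> borel_measurable M"
    and rng: "\<And>x. x \<in> space M \<Longrightarrow> 0 \<le> h x \<and> h x \<le> B"
  shows "(\<integral>x. k x * h x \<partial>M) = (\<integral>t. indicator {0..<B} t * (\<integral>x. k x * indicator {t<..} (h x) \<partial>M) \<partial>lborel)"
proof -
  interpret M: sigma_finite_measure M by fact
  interpret pair_sigma_finite M lborel ..
  have [measurable]: "k \<in> borel_measurable M" using k by auto
  define F where "F = (\<lambda>(x, t). k x * (indicator {0..<B} t * indicator {t<..} (h x)))"
  have [measurable]: "F \<in> borel_measurable (M \<Otimes>\<^sub>M lborel)"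
  proof -
    have *: "F p = k (fst p) * (indicator {0..<B} (snd p) * (if snd p < h (fst p) then 1 else 0))" for p
      by (cases p) (auto simp: F_def split: split_indicator)
    show ?thesis unfolding *[abs_def] by measurable
  qed
  have eq: "indicator {0..<B} t * indicator {t<..} (h x) = (indicator {0..<h x} t :: real)" if "x \<in> space M" for t x
    using rng[OF that] by (auto split: split_indicator)
  have ind: "integrable lborel (indicator {0..<a} :: real \<Rightarrow> real)" for a :: real
    by (cases "0 \<le> a") (auto simp: integrable_indicator_iff)
  have int: "(\<integral>t. indicator {0..<B} t * indicator {t<..} (h x) \<partial>lborel) = h x" if "x \<in> space M" for x
    unfolding eq[OF that] using rng[OF that] by simp
  have "integrable (M \<Otimes>\<^sub>M lborel) F"
  proof (rule Fubini_integrable)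
    have "integrable M (\<lambda>x. \<bar>k x\<bar> * h x)"
      using k rng by (intro integrable_mult_bounded[of _ _ _ B]) auto
    moreover have "(\<integral>t. norm (F (x, t)) \<partial>lborel) = \<bar>k x\<bar> * h x" if "x \<in> space M" for x
      using int[OF that] by (simp add: F_def abs_mult)
    ultimately show "integrable M (\<lambda>x. \<integral>t. norm (F (x, t)) \<partial>lborel)"
      by (simp cong: Bochner_Integration.integrable_cong)
    show "AE x in M. integrable lborel (\<lambda>t. F (x, t))"
      using ind by (intro AE_I2) (simp add: F_def eq)
  qed simp
  then have F: "integrable (M \<Otimes>\<^sub>M lborel) (case_prod (\<lambda>x t. F (x, t)))" by simp
  have "(\<integral>x. k x * h x \<partial>M) = (\<integral>x. \<integral>t. F (x, t) \<partial>lborel \<partial>M)"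
    using int by (intro Bochner_Integration.integral_cong) (auto simp: F_def)
  also have "\<dots> = (\<integral>t. \<integral>x. F (x, t) \<partial>M \<partial>lborel)"
    using Fubini_integral[OF F] by simp
  also have "\<dots> = (\<integral>t. indicator {0..<B} t * (\<integral>x. k x * indicator {t<..} (h x) \<partial>M) \<partial>lborel)"
    by (intro Bochner_Integration.integral_cong refl) (simp add: F_def mult.left_commute[of _ "indicator _ _"])
  finally show ?thesis .
qed

lemma mono_superlevel_set:
  assumes h: "mono_on {0<..<1::real} h"
  shows "\<exists>c\<in>{0..1}. AE u in unit_measure. (indicator {t<..} (h u :: real) :: real) = indicator {c<..} u"
proof (cases "\<exists>u\<in>{0<..<1}. t < h u")
  case False
  then show ?thesis by (intro bexI[of _ 1] AE_I2) (auto split: split_indicator)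
next
  case True
  define S where "S = {u\<in>{0<..<1}. t < h u}"
  have S: "S \<noteq> {}" "bdd_below S" using True by (auto simp: S_def intro: bdd_belowI[of _ 0])
  define c where "c = Inf S"
  have c: "0 \<le> c" "c \<le> 1"
    unfolding c_def using S cInf_lower[OF _ S(2)] by (auto simp: S_def intro!: cInf_greatest intro: less_imp_le order_trans)
  have "AE u in lborel. u \<noteq> c" by (rule AE_lborel_singleton)
  then have "AE u in unit_measure. u \<noteq> c" by (subst AE_restrict_space_iff) (auto elim: AE_mp)
  then have "AE u in unit_measure. indicator {t<..} (h u) = (indicator {c<..} u :: real)"
  proof (rule AE_mp, intro AE_I2 impI)
    fix u assume u: "u \<in> space unit_measure" "u \<noteq> c"
    have "t < h u \<longleftrightarrow> c < u"
    proof
      assume "t < h u"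
      then have "u \<in> S" using u by (simp add: S_def)
      then have "c \<le> u" unfolding c_def by (rule cInf_lower) (rule S(2))
      with u show "c < u" by simp
    next
      assume "c < u"
      then obtain v where v: "v \<in> S" "v < u" unfolding c_def using cInf_lessD[OF S(1)] by blast
      then have "h v \<le> h u" using u by (intro mono_onD[OF h]) (auto simp: S_def)
      with v show "t < h u" by (simp add: S_def)
    qed
    then show "indicator {t<..} (h u) = (indicator {c<..} u :: real)" by (simp split: split_indicator)
  qed
  with c show ?thesis by (intro bexI[of _ c]) auto
qed

text \<open>
  By \<open>layer_cake\<close> a nondecreasing function is, up to a constant, a mixture of the functions
  \<open>indicator {c<..}\<close>, and \<open>k\<close> integrates to zero against constants.
\<close>
lemma integral_mult_mono_nonneg:
  assumes k: "integrable unit_measure k" and tail: "\<And>c. 0 \<le> c \<Longrightarrow> c \<le> 1 \<Longrightarrow> 0 \<le> tail k c"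
    and k0: "integral\<^sup>L unit_measure k = 0"
    and h: "mono_on {0<..<1} h" and bnd: "\<And>u. u \<in> {0<..<1} \<Longrightarrow> \<bar>h u\<bar> \<le> B"
  shows "0 \<le> (\<integral>u. k u * h u \<partial>unit_measure)"
proof -
  have [measurable]: "h \<in> borel_measurable unit_measure" "k \<in> borel_measurable unit_measure"
    using measurable_unit_mono[OF h] k by auto
  have hB: "mono_on {0<..<1} (\<lambda>u. h u + B)"
    using h by (auto simp: mono_on_def)
  have "(\<integral>u. k u * indicator {t<..} (h u + B) \<partial>unit_measure) \<ge> 0" for t
  proof -
    obtain c where c: "c \<in> {0..1}" "AE u in unit_measure. (indicator {t<..} (h u + B) :: real) = indicator {c<..} u"
      using mono_superlevel_set[OF hB] by blast
    have "(\<integral>u. k u * indicator {t<..} (h u + B) \<partial>unit_measure) = tail k c"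
      unfolding tail_def using c(2) by (intro integral_cong_AE) auto
    then show ?thesis using tail c(1) by simp
  qed
  moreover have "0 \<le> h u + B \<and> h u + B \<le> 2 * B" if "u \<in> {0<..<1}" for u
    using bnd[OF that] by linarith
  ultimately have "0 \<le> (\<integral>u. k u * (h u + B) \<partial>unit_measure)"
    by (subst layer_cake[of _ _ _ "2 * B"])
      (auto intro!: integral_nonneg_AE AE_I2 unit.sigma_finite_measure_axioms k)
  also have "(\<integral>u. k u * (h u + B) \<partial>unit_measure) = (\<integral>u. k u * h u \<partial>unit_measure) + (\<integral>u. k u * B \<partial>unit_measure)"
    unfolding distrib_left
    by (intro Bochner_Integration.integral_add integrable_mult_bounded[of _ _ _ B] integrable_mult_left k)
       (use bnd in auto)
  finally show ?thesis using k0 by simp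
qed

lemma tail_diff:
  assumes "integrable unit_measure r" "integrable unit_measure r'"
  shows "tail (\<lambda>u. r u - r' u) c = tail r c - tail r' c"
  unfolding tail_def left_diff_distrib using assms
  by (intro Bochner_Integration.integral_diff integrable_mult_indicator_greaterThan)

lemma tail_0: "tail r 0 = integral\<^sup>L unit_measure r"
  unfolding tail_def by (intro Bochner_Integration.integral_cong) auto

lemma tail_1: "tail r 1 = 0"
proof -
  have "tail r 1 = (\<integral>u. 0 \<partial>unit_measure)"
    unfolding tail_def by (intro Bochner_Integration.integral_cong) auto
  then show ?thesis by simp
qed

lemma tail_nonneg:
  assumes "r \<in> densities unit_measure"
  shows "0 \<le> tail r c"
  unfolding tail_def by (intro integral_nonneg_AE AE_I2 mult_nonneg_nonneg densitiesD(2)[OF assms]) auto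

lemma tail_antimono:
  assumes r: "r \<in> densities unit_measure" and "c \<le> c'"
  shows "tail r c' \<le> tail r c"
  unfolding tail_def using assms(2) densitiesD(2)[OF r]
  by (intro integral_mono integrable_mult_indicator_greaterThan densitiesD(3)[OF r])
     (auto split: split_indicator intro!: mult_left_mono)

lemma tail_le_1:
  assumes r: "r \<in> densities unit_measure" and "0 \<le> c"
  shows "tail r c \<le> 1"
  using tail_antimono[OF assms] tail_0[of r] densitiesD(4)[OF r] by simp

lemma tail_measurable [measurable]:
  assumes r: "r \<in> densities unit_measure"
  shows "tail r \<in> borel_measurable borel"
proof -
  have "(\<lambda>c. - tail r c) \<in> borel_measurable borel"
    using tail_antimono[OF r] by (intro borel_measurable_mono) (auto simp: mono_def)
  then have "(\<lambda>c. - (- tail r c)) \<in> borel_measurable borel" by measurable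
  then show ?thesis by simp
qed

text \<open>
  Both \<open>r u - r c\<close> and \<open>u - c\<close> change sign at \<open>c\<close> only, in the same direction.
\<close>
lemma tail_supergradient:
  assumes r: "r \<in> densities unit_measure" and mono: "mono_on {0<..<1} r"
    and c: "0 < c" "c < 1" and c': "0 \<le> c'" "c' \<le> 1"
  shows "tail r c' \<le> tail r c - r c * (c' - c)"
proof -
  let ?d = "\<lambda>u. indicator {c'<..} u - indicator {c<..} u :: real"
  note i = integrable_mult_indicator_greaterThan[OF densitiesD(3)[OF r]]
  note i1 = integrable_indicator_greaterThan
  have pw: "r u * ?d u \<le> r c * ?d u" if u: "u \<in> {0<..<1}" for u
  proof (cases "u \<le> c")
    case True
    then have "r u \<le> r c" using u c by (intro mono_onD[OF mono]) auto
    with True show ?thesis by (auto split: split_indicator)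
  next
    case False
    then have "r c \<le> r u" using u c by (intro mono_onD[OF mono]) auto
    with False show ?thesis by (auto split: split_indicator)
  qed
  have "tail r c' - tail r c = (\<integral>u. r u * ?d u \<partial>unit_measure)"
    unfolding tail_def right_diff_distrib using i by simp
  also have "\<dots> \<le> (\<integral>u. r c * ?d u \<partial>unit_measure)"
    using pw i i1 by (intro integral_mono) (auto simp: right_diff_distrib)
  also have "\<dots> = r c * ((\<integral>u. indicator {c'<..} u \<partial>unit_measure) - (\<integral>u. indicator {c<..} u \<partial>unit_measure))"
    by (simp only: integral_mult_right_zero Bochner_Integration.integral_diff[OF i1 i1])
  also have "\<dots> = r c * ((1 - c') - (1 - c))"
    using c c' by (simp only: integral_indicator_greaterThan less_imp_le)
  finally show ?thesis by (simp add: algebra_simps)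
qed

text \<open>
  The average of a nondecreasing \<open>r\<close> over \<open>(c', 1)\<close> is at least its average over the longer interval
  \<open>(c, 1)\<close>.
\<close>
lemma tail_chord:
  assumes r: "r \<in> densities unit_measure" and mono: "mono_on {0<..<1} r"
    and c: "0 \<le> c" "c \<le> c'" "c' \<le> 1"
  shows "tail r c * (1 - c') \<le> tail r c' * (1 - c)"
proof (cases "c' = 0 \<or> c' = 1")
  case True
  then show ?thesis using c by (auto simp: tail_1)
next
  case False
  with c have c': "0 < c'" "c' < 1" by auto
  have 1: "tail r c \<le> tail r c' - r c' * (c - c')"
    using c by (intro tail_supergradient[OF r mono c']) auto
  have 2: "0 \<le> tail r c' - r c' * (1 - c')"
    using tail_supergradient[OF r mono c', of 1] by (simp add: tail_1)
  have "tail r c * (1 - c') \<le> (tail r c' - r c' * (c - c')) * (1 - c')"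
    using 1 c by (intro mult_right_mono) auto
  also have "\<dots> = tail r c' * (1 - c') + (c' - c) * (r c' * (1 - c'))" by (simp add: algebra_simps)
  also have "\<dots> \<le> tail r c' * (1 - c') + (c' - c) * tail r c'"
    using 2 c by (intro add_left_mono mult_left_mono) auto
  finally show ?thesis by (simp add: algebra_simps)
qed

lemma sum_Bernstein_linear:
  assumes "0 < n"
  shows "(\<Sum>k\<le>n. (real k / real n - c) * Bernstein n k c) = 0"
proof -
  have "(\<Sum>k\<le>n. (real k / real n - c) * Bernstein n k c)
      = (\<Sum>k\<le>n. real k * Bernstein n k c) / real n - c * (\<Sum>k\<le>n. Bernstein n k c)"
    by (simp add: left_diff_distrib sum_subtractf sum_distrib_left sum_divide_distrib del: sum_k_Bernstein sum_Bernstein)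
  then show ?thesis using assms by simp
qed

lemma sum_Bernstein_square:
  assumes "0 < n"
  shows "(\<Sum>k\<le>n. (real k / real n - c)\<^sup>2 * Bernstein n k c) = c * (1 - c) / real n"
proof -
  have *: "(real k / real n - c)\<^sup>2 * b = (real k * (real k - 1) * b + (1 - 2 * c * n) * (real k * b) + (c * n)\<^sup>2 * b) / (real n)\<^sup>2" for k b
    using assms by (simp add: field_simps power2_eq_square)
  have "(\<Sum>k\<le>n. (real k / real n - c)\<^sup>2 * Bernstein n k c) =
    ((\<Sum>k\<le>n. real k * (real k - 1) * Bernstein n k c) + (1 - 2 * c * n) * (\<Sum>k\<le>n. real k * Bernstein n k c)
      + (c * n)\<^sup>2 * (\<Sum>k\<le>n. Bernstein n k c)) / (real n)\<^sup>2"
    unfolding * by (simp only: sum_divide_distrib[symmetric] sum.distrib sum_distrib_left)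
  also have "\<dots> = (real n * (real n - 1) * c\<^sup>2 + (1 - 2 * c * n) * (real n * c) + (c * n)\<^sup>2 * 1) / (real n)\<^sup>2"
    by (simp only: sum_Bernstein sum_k_Bernstein sum_kk_Bernstein)
  also have "\<dots> = c * (1 - c) / real n" using assms by (simp add: field_simps power2_eq_square)
  finally show ?thesis .
qed

lemma Bernstein_0: "Bernstein n k 0 = (if k = 0 then 1 else 0)"
  by (simp add: Bernstein_def power_0_left)

lemma Bernstein_1: "k \<le> n \<Longrightarrow> Bernstein n k 1 = (if k = n then 1 else 0)"
  by (simp add: Bernstein_def power_0_left)

text \<open>
  Jensen's inequality for the concave function \<open>tail r\<close>: the Bernstein weights have mean \<open>c\<close>.
\<close>
lemma Bernstein_operator_tail_le:
  assumes r: "r \<in> densities unit_measure" and mono: "mono_on {0<..<1} r"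
    and c: "0 \<le> c" "c \<le> 1" and n: "0 < n"
  shows "Bernstein_operator n (tail r) c \<le> tail r c"
proof -
  consider "c = 0" | "c = 1" | "0 < c" "c < 1" using c by linarith
  then show ?thesis
  proof cases
    case 1
    then show ?thesis by (simp add: Bernstein_operator_def Bernstein_0 if_distrib sum.delta cong: if_cong)
  next
    case 2
    have "Bernstein_operator n (tail r) 1 = (\<Sum>k\<le>n. if k = n then tail r 1 else 0)"
      unfolding Bernstein_operator_def using n by (intro sum.cong) (auto simp: Bernstein_1)
    then show ?thesis by (simp add: 2)
  next
    case 3
    have "Bernstein_operator n (tail r) c \<le> (\<Sum>k\<le>n. (tail r c - r c * (real k / real n - c)) * Bernstein n k c)"
      unfolding Bernstein_operator_def using 3 n
      by (intro sum_mono mult_right_mono tail_supergradient[OF r mono] Bernstein_nonneg) auto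
    also have "\<dots> = tail r c * (\<Sum>k\<le>n. Bernstein n k c) - r c * (\<Sum>k\<le>n. (real k / real n - c) * Bernstein n k c)"
    proof -
      have *: "(a - b * x) * y = a * y - b * (x * y)" for a b x y :: real by (simp add: algebra_simps)
      show ?thesis unfolding * sum_subtractf sum_distrib_left ..
    qed
    finally show ?thesis using n by (simp add: sum_Bernstein_linear)
  qed
qed

text \<open>
  By concavity \<open>tail r\<close> loses at most the fraction \<open>\<bar>d\<bar> / (1 - c)\<close> of its value when the argument moves
  from \<open>c\<close> by \<open>d\<close>, and the mean deviation under the Bernstein weights is at most the standard deviation
  \<open>sqrt (c * (1 - c) / n)\<close>.
\<close>
lemma Bernstein_operator_tail_ge:
  assumes r: "r \<in> densities unit_measure" and mono: "mono_on {0<..<1} r"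
    and c: "0 \<le> c" "c \<le> 1" and n: "0 < n" and K: "tail r c \<le> K * sqrt (1 - c)" and "0 \<le> K"
  shows "tail r c - Bernstein_operator n (tail r) c \<le> K / sqrt n"
proof (cases "c = 1")
  case True
  have "0 \<le> Bernstein_operator n (tail r) 1"
    unfolding Bernstein_operator_def by (intro sum_nonneg mult_nonneg_nonneg tail_nonneg[OF r] Bernstein_nonneg) auto
  moreover have "0 \<le> K / sqrt n" using \<open>0 \<le> K\<close> by simp
  ultimately show ?thesis unfolding True tail_1 by linarith
next
  case False
  define p where "p = 1 - c"
  have p: "0 < p" using False c by (simp add: p_def)
  define \<sigma> where "\<sigma> = sqrt (p / n)"
  have \<sigma>: "0 < \<sigma>" "\<sigma>\<^sup>2 = p / n" using p n by (auto simp: \<sigma>_def)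
  have pointwise: "tail r c * (1 - ((real k / n - c)\<^sup>2 / \<sigma> + \<sigma>) / (2 * p)) \<le> tail r (real k / n)" if k: "k \<le> n" for k
  proof -
    define d where "d = real k / n - c"
    have "0 \<le> (\<bar>d\<bar> - \<sigma>)\<^sup>2 / \<sigma>" using \<sigma> by simp
    also have "\<dots> = d\<^sup>2 / \<sigma> + \<sigma> - 2 * \<bar>d\<bar>" using \<sigma> by (simp add: power2_diff field_simps) (simp add: power2_eq_square)
    finally have d: "2 * \<bar>d\<bar> \<le> d\<^sup>2 / \<sigma> + \<sigma>" by simp
    have "tail r c * (1 - \<bar>d\<bar> / p) \<le> tail r (real k / n)"
    proof (cases "d \<le> 0")
      case True
      have "tail r c * (1 - \<bar>d\<bar> / p) \<le> tail r c * 1" using p by (intro mult_left_mono tail_nonneg[OF r]) auto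
      also have "\<dots> \<le> tail r (real k / n)" using True by (simp add: d_def tail_antimono[OF r])
      finally show ?thesis .
    next
      case False
      have "tail r c * (1 - real k / n) \<le> tail r (real k / n) * (1 - c)"
        using False c k n by (intro tail_chord[OF r mono]) (auto simp: d_def)
      then have "tail r c * (1 - real k / n) / p \<le> tail r (real k / n) * p / p"
        unfolding p_def[symmetric] using p by (intro divide_right_mono) auto
      moreover have "1 - \<bar>d\<bar> / p = (1 - real k / n) / p" using False p by (simp add: d_def p_def field_simps)
      ultimately show ?thesis using p by simp
    qed
    moreover have "tail r c * (1 - (d\<^sup>2 / \<sigma> + \<sigma>) / (2 * p)) \<le> tail r c * (1 - \<bar>d\<bar> / p)"
    proof (intro mult_left_mono tail_nonneg[OF r] diff_left_mono)
      have "\<bar>d\<bar> / p = 2 * \<bar>d\<bar> / (2 * p)" using p by simp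
      also have "\<dots> \<le> (d\<^sup>2 / \<sigma> + \<sigma>) / (2 * p)" using d p by (intro divide_right_mono) auto
      finally show "\<bar>d\<bar> / p \<le> (d\<^sup>2 / \<sigma> + \<sigma>) / (2 * p)" .
    qed
    ultimately show ?thesis by (simp add: d_def)
  qed
  have "tail r c - tail r c * \<sigma> / p \<le> tail r c - tail r c * ((c * p / n) / \<sigma> + \<sigma>) / (2 * p)"
  proof -
    have "c * p / n \<le> \<sigma>\<^sup>2" using c p n unfolding \<sigma>(2) by (intro divide_right_mono) (auto simp: mult_left_le_one_le)
    then have "(c * p / n) / \<sigma> \<le> \<sigma>\<^sup>2 / \<sigma>" using \<sigma>(1) by (intro divide_right_mono) auto
    then have "(c * p / n) / \<sigma> \<le> \<sigma>" using \<sigma>(1) by (simp add: power2_eq_square)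
    then have "tail r c * ((c * p / n) / \<sigma> + \<sigma>) \<le> tail r c * (2 * \<sigma>)"
      by (intro mult_left_mono tail_nonneg[OF r]) simp
    then have "tail r c * ((c * p / n) / \<sigma> + \<sigma>) / (2 * p) \<le> tail r c * (2 * \<sigma>) / (2 * p)"
      using p by (intro divide_right_mono) auto
    then show ?thesis by simp
  qed
  also have "\<dots> = (\<Sum>k\<le>n. tail r c * (1 - ((real k / n - c)\<^sup>2 / \<sigma> + \<sigma>) / (2 * p)) * Bernstein n k c)"
  proof -
    have *: "tail r c * (1 - (x / \<sigma> + \<sigma>) / (2 * p)) * b = (tail r c - tail r c * \<sigma> / (2 * p)) * b - tail r c / (\<sigma> * (2 * p)) * (x * b)" for x b
      using p \<sigma> by (simp add: field_simps)
    show ?thesis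
      unfolding * sum_subtractf sum_distrib_left[symmetric] sum_Bernstein_square[OF n] sum_Bernstein
        p_def[symmetric]
      using p \<sigma>(1) by (simp add: field_simps)
  qed
  also have "\<dots> \<le> Bernstein_operator n (tail r) c"
    unfolding Bernstein_operator_def using c by (intro sum_mono mult_right_mono pointwise Bernstein_nonneg) auto
  finally have "tail r c - Bernstein_operator n (tail r) c \<le> tail r c * \<sigma> / p" by simp
  also have "\<dots> \<le> K * sqrt p * \<sigma> / p" using K p \<sigma> by (intro divide_right_mono mult_right_mono) (auto simp: p_def)
  also have "\<dots> = K / sqrt n" using p n by (simp add: \<sigma>_def real_sqrt_divide field_simps)
  finally show ?thesis .
qed

section \<open>Spectral representation of the objective\<close>

text \<open>
  The lower quantile; \<^const>\<open>inverse_cdf\<close> is the upper one. The lower quantile at \<open>u\<close> is at most \<open>x\<close> exactly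
  if \<open>u\<close> is at most the cdf at \<open>x\<close>.
\<close>
definition quantile :: "real measure \<Rightarrow> real \<Rightarrow> real" where
  "quantile \<nu> u = Inf {x. u \<le> cdf \<nu> x}"

lemma cdf_distribution_distr:
  assumes "prob_space M" "Z \<in> borel_measurable M"
  shows "cdf_distribution (distr M borel Z)"
  unfolding cdf_distribution_def by (rule prob_space.real_distribution_distr[OF assms])

lemma le_cdf_iff_quantile_le:
  assumes "prob_space M" "Z \<in> borel_measurable M" "0 < u" "u < 1"
  shows "u \<le> cdf (distr M borel Z) x \<longleftrightarrow> quantile (distr M borel Z) u \<le> x"
proof -
  interpret cdf_distribution "distr M borel Z" by (rule cdf_distribution_distr[OF assms(1,2)])
  show ?thesis unfolding quantile_def by (rule pseudoinverse) (use assms in auto)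
qed

lemma mono_on_quantile:
  assumes "prob_space M" "Z \<in> borel_measurable M"
  shows "mono_on {0<..<1} (quantile (distr M borel Z))"
proof -
  interpret cdf_distribution "distr M borel Z" by (rule cdf_distribution_distr[OF assms])
  show ?thesis using mono_I by (simp add: quantile_def[abs_def])
qed

lemma distr_quantile:
  assumes "prob_space M" "Z \<in> borel_measurable M"
  shows "distr unit_measure borel (quantile (distr M borel Z)) = distr M borel Z"
proof -
  interpret cdf_distribution "distr M borel Z" by (rule cdf_distribution_distr[OF assms])
  show ?thesis using distr_I_eq_M by (simp add: quantile_def[abs_def])
qed

lemma quantile_range:
  assumes M: "prob_space M" and Z: "Z \<in> borel_measurable M"
    and rng: "\<And>x. x \<in> space M \<Longrightarrow> a \<le> Z x" and u: "0 < u" "u < 1"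
  shows "a \<le> quantile (distr M borel Z) u"
proof (rule ccontr)
  interpret prob_space M by fact
  assume "\<not> ?thesis"
  then have less: "quantile (distr M borel Z) u < a" by simp
  define x where "x = quantile (distr M borel Z) u"
  have "u \<le> cdf (distr M borel Z) x" using le_cdf_iff_quantile_le[OF M Z u] by (simp add: x_def)
  also have "\<dots> = prob {y \<in> space M. Z y \<le> x}"
    using Z by (simp add: cdf_def measure_distr vimage_def Int_def conj_commute)
  also have "{y \<in> space M. Z y \<le> x} = {}" using rng less by (force simp: x_def)
  finally show False using u by simp
qed

lemma quantile_upper:
  assumes M: "prob_space M" and Z: "Z \<in> borel_measurable M"
    and rng: "\<And>x. x \<in> space M \<Longrightarrow> Z x \<le> b" and u: "0 < u" "u < 1"
  shows "quantile (distr M borel Z) u \<le> b"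
proof -
  interpret prob_space M by fact
  have "cdf (distr M borel Z) b = prob {y \<in> space M. Z y \<le> b}"
    using Z by (simp add: cdf_def measure_distr vimage_def Int_def conj_commute)
  also have "{y \<in> space M. Z y \<le> b} = space M" using rng by auto
  finally show ?thesis using le_cdf_iff_quantile_le[OF M Z u, of b] u by (simp add: prob_space)
qed

text \<open>
  The rearrangement is the quantile function of the law of \<open>r\<close>.
\<close>
lemma monotone_rearrangement:
  assumes r: "r \<in> densities unit_measure"
  shows "\<exists>r'\<in>densities unit_measure. mono_on {0<..<1} r' \<and> distr unit_measure borel r' = distr unit_measure borel r"
proof -
  note rm[measurable] = densitiesD(1)[OF r]
  define r' where "r' = (\<lambda>u. max 0 (quantile (distr unit_measure borel r) u))"
  have eq: "r' u = quantile (distr unit_measure borel r) u" if "u \<in> {0<..<1}" for u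
    using quantile_range[OF prob_space_unit rm, of 0 u] densitiesD(2)[OF r] that by (simp add: r'_def)
  have mono: "mono_on {0<..<1} r'"
    using mono_on_quantile[OF prob_space_unit rm] by (simp add: mono_on_def eq)
  have r'm[measurable]: "r' \<in> borel_measurable unit_measure" by (rule measurable_unit_mono[OF mono])
  have "distr unit_measure borel r' = distr unit_measure borel (quantile (distr unit_measure borel r))"
    by (rule distr_cong) (auto simp: eq)
  also have "\<dots> = distr unit_measure borel r" by (rule distr_quantile[OF prob_space_unit rm])
  finally have law: "distr unit_measure borel r' = distr unit_measure borel r" .
  have tr: "integrable unit_measure q = integrable (distr unit_measure borel q) (\<lambda>x. x)"
      "integral\<^sup>L unit_measure q = (\<integral>x. x \<partial>distr unit_measure borel q)"
    if "q \<in> borel_measurable unit_measure" for q :: "real \<Rightarrow> real"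
    using that by (simp_all add: integrable_distr_eq integral_distr)
  have "integrable unit_measure r'"
    using densitiesD(3)[OF r] unfolding tr(1)[OF r'm] law unfolding tr(1)[OF rm] .
  moreover have "integral\<^sup>L unit_measure r' = 1"
    using densitiesD(4)[OF r] unfolding tr(2)[OF r'm] law unfolding tr(2)[OF rm] .
  ultimately have "r' \<in> densities unit_measure" by (simp add: densities_def r'_def)
  with mono law show ?thesis by blast
qed

text \<open>
  Truncating at zero leaves densities unchanged and makes the identity on the real line a legitimate
  argument of \<open>\<phi>\<close>.
\<close>
lemma density_div_cong_distr:
  assumes r: "r \<in> densities M" and r': "r' \<in> densities M'" and law: "distr M borel r = distr M' borel r'"
    and \<phi>: "divergence_fun \<phi>"
  shows "density_div \<phi> M r = density_div \<phi> M' r'"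
proof -
  have *: "density_div \<phi> N q = density_div \<phi> (distr N borel q) (max 0)" if q: "q \<in> densities N" for N and q :: "'c \<Rightarrow> real"
  proof -
    have "density_div \<phi> (distr N borel q) (max 0) = density_div \<phi> N (\<lambda>x. max 0 (q x))"
      using \<phi> by (intro density_div_distr densitiesD(1)[OF q]) auto
    also have "(\<lambda>x. max 0 (q x)) = q" using densitiesD(2)[OF q] by (simp add: max_absorb2)
    finally show ?thesis by simp
  qed
  show ?thesis unfolding *[OF r] *[OF r'] law ..
qed

text \<open>
  With \<open>e = r' c\<close>, \<open>r\<close> is at most \<open>e\<close> plus the positive part of \<open>r - e\<close>, and the integral of the latter
  depends on the law only. For \<open>r'\<close> the resulting bound is an equality, since \<open>r' \<ge> e\<close> to the right of
  \<open>c\<close> and \<open>r' \<le> e\<close> to its left.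
\<close>
lemma tail_rearrangement_le:
  assumes r: "r \<in> densities unit_measure" and r': "r' \<in> densities unit_measure"
    and mono: "mono_on {0<..<1} r'" and law: "distr unit_measure borel r' = distr unit_measure borel r"
    and c: "0 \<le> c" "c \<le> 1"
  shows "tail r c \<le> tail r' c"
proof -
  consider "c = 0" | "c = 1" | "0 < c" "c < 1" using c by linarith
  then show ?thesis
  proof cases
    case 1
    then show ?thesis using densitiesD(4)[OF r] densitiesD(4)[OF r'] by (simp add: tail_0)
  next
    case 2
    then show ?thesis by (simp add: tail_1)
  next
    case 3
    note ind = integrable_indicator_greaterThan
    have [measurable]: "r \<in> borel_measurable unit_measure" "r' \<in> borel_measurable unit_measure"
      using densitiesD(1) r r' by auto
    \<comment> \<open>The positive part of the excess over the value of the rearrangement at \<open>c\<close>.\<close>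
    define e where "e = (\<lambda>y. max 0 (y - r' c))"
    have [measurable]: "e \<in> borel_measurable borel" unfolding e_def by measurable
    have ie: "integrable unit_measure (\<lambda>u. e (q u))" if "q \<in> densities unit_measure" for q
      unfolding e_def using densitiesD(3)[OF that] by auto
    have "tail r c \<le> (\<integral>u. r' c * indicator {c<..} u + e (r u) \<partial>unit_measure)"
      unfolding tail_def using ind ie[OF r] integrable_mult_indicator_greaterThan[OF densitiesD(3)[OF r]]
      by (intro integral_mono) (auto simp: e_def split: split_indicator)
    also have "\<dots> = (\<integral>u. r' c * indicator {c<..} u \<partial>unit_measure) + (\<integral>u. e (r u) \<partial>unit_measure)"
      using ind ie[OF r] by simp
    also have "(\<integral>u. e (r u) \<partial>unit_measure) = (\<integral>u. e (r' u) \<partial>unit_measure)"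
    proof -
      have "(\<integral>u. e (q u) \<partial>unit_measure) = (\<integral>x. e x \<partial>distr unit_measure borel q)"
        if "q \<in> borel_measurable unit_measure" for q
        using that by (simp add: integral_distr)
      from this[OF densitiesD(1)[OF r]] this[OF densitiesD(1)[OF r']] show ?thesis by (simp only: law)
    qed
    also have "(\<integral>u. r' c * indicator {c<..} u \<partial>unit_measure) + (\<integral>u. e (r' u) \<partial>unit_measure)
        = (\<integral>u. r' c * indicator {c<..} u + e (r' u) \<partial>unit_measure)"
      using ind ie[OF r'] by simp
    also have "\<dots> = tail r' c"
      unfolding tail_def
    proof (intro Bochner_Integration.integral_cong refl)
      fix u assume u: "u \<in> space unit_measure"
      show "r' c * indicator {c<..} u + e (r' u) = r' u * indicator {c<..} u"
      proof (cases "c < u")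
        case True
        then have "r' c \<le> r' u" using u 3 by (intro mono_onD[OF mono]) auto
        with True show ?thesis by (simp add: e_def)
      next
        case False
        then have "r' u \<le> r' c" using u 3 by (intro mono_onD[OF mono]) auto
        with False show ?thesis by (simp add: e_def)
      qed
    qed
    finally show ?thesis .
  qed
qed

text \<open>
  The difference \<open>r' - r\<close> has nonnegative tails and total mass zero.
\<close>
lemma Hardy_Littlewood:
  assumes r: "r \<in> densities unit_measure" and r': "r' \<in> densities unit_measure"
    and mono: "mono_on {0<..<1} r'" and law: "distr unit_measure borel r' = distr unit_measure borel r"
    and h: "mono_on {0<..<1} h" and bnd: "\<And>u. u \<in> {0<..<1} \<Longrightarrow> \<bar>h u\<bar> \<le> B"
  shows "(\<integral>u. r u * h u \<partial>unit_measure) \<le> (\<integral>u. r' u * h u \<partial>unit_measure)"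
proof -
  have i: "integrable unit_measure r" "integrable unit_measure r'" using densitiesD(3) r r' by auto
  have ih: "integrable unit_measure (\<lambda>u. q u * h u)" if "integrable unit_measure q" for q
    using that measurable_unit_mono[OF h] bnd by (intro integrable_mult_bounded[of _ _ _ B]) auto
  have "0 \<le> (\<integral>u. (r' u - r u) * h u \<partial>unit_measure)"
  proof (rule integral_mult_mono_nonneg[OF _ _ _ h bnd])
    show "0 \<le> tail (\<lambda>u. r' u - r u) c" if "0 \<le> c" "c \<le> 1" for c
      using tail_rearrangement_le[OF r r' mono law that] by (simp add: tail_diff[OF i(2,1)])
  qed (use i densitiesD(4)[OF r] densitiesD(4)[OF r'] in auto)
  then show ?thesis using ih[OF i(1)] ih[OF i(2)] by (simp add: left_diff_distrib)
qed

text \<open>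
  The quantile at \<open>u\<close> exceeds \<open>t\<close> iff \<open>u\<close> exceeds the cdf at \<open>t\<close>, so \<open>layer_cake\<close> produces tails of \<open>k\<close>.
\<close>
lemma integral_quantile_eq_tail:
  assumes M: "prob_space M" and Z: "Z \<in> borel_measurable M"
    and rng: "\<And>x. x \<in> space M \<Longrightarrow> 0 \<le> Z x \<and> Z x \<le> B" and k: "integrable unit_measure k"
  shows "(\<integral>u. k u * quantile (distr M borel Z) u \<partial>unit_measure)
    = (\<integral>t. indicator {0..<B} t * tail k (cdf (distr M borel Z) t) \<partial>lborel)"
proof -
  have *: "(\<integral>u. k u * indicator {t<..} (quantile (distr M borel Z) u) \<partial>unit_measure) = tail k (cdf (distr M borel Z) t)" for t
    unfolding tail_def using le_cdf_iff_quantile_le[OF M Z]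
    by (intro Bochner_Integration.integral_cong refl) (auto split: split_indicator simp: not_less[symmetric])
  show ?thesis
    unfolding *[symmetric]
    by (rule layer_cake)
       (use measurable_unit_mono[OF mono_on_quantile[OF M Z]] k quantile_range[OF M Z] quantile_upper[OF M Z] rng
         unit.sigma_finite_measure_axioms in auto)
qed

text \<open>
  Law invariance moves the problem to the unit interval with the quantile function as loss; replacing a
  density by its rearrangement keeps all divergences and does not decrease the linear part.
\<close>
lemma dro_value_spectral:
  assumes M: "prob_space M" and Z: "Z \<in> borel_measurable M"
    and range: "\<forall>x\<in>space M. 0 \<le> Z x \<and> Z x \<le> B"
    and \<phi>: "divergence_fun \<phi>" and \<psi>: "divergence_fun \<psi>" and lam: "0 \<le> lam"
  shows "dro_value \<phi> \<psi> \<rho> lam M Z =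
    (SUP r\<in>{r \<in> densities unit_measure. mono_on {0<..<1} r \<and> density_div \<phi> unit_measure r \<le> ereal \<rho>}.
      ereal (\<integral>t. indicator {0..<B} t * tail r (cdf (distr M borel Z) t) \<partial>lborel) - ereal lam * density_div \<psi> unit_measure r)"
    (is "_ = (SUP r\<in>?R. ?v r)")
proof -
  let ?q = "quantile (distr M borel Z)"
  have rng: "\<And>x. x \<in> space M \<Longrightarrow> 0 \<le> Z x \<and> Z x \<le> B" using range by blast
  note qmono = mono_on_quantile[OF M Z]
  have qb: "\<bar>?q u\<bar> \<le> B" if "u \<in> {0<..<1}" for u
    using quantile_range[OF M Z, of 0 u] quantile_upper[OF M Z, of B u] rng that by auto
  have eq: "dro_value \<phi> \<psi> \<rho> lam M Z = dro_value \<phi> \<psi> \<rho> lam unit_measure ?q"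
    by (rule dro_value_cong_distr)
       (use M Z \<phi> \<psi> lam distr_quantile[OF M Z] measurable_unit_mono[OF qmono] prob_space_unit in auto)
  have v: "ereal (\<integral>u. r u * ?q u \<partial>unit_measure) - ereal lam * density_div \<psi> unit_measure r = ?v r"
    if "r \<in> densities unit_measure" for r
    using integral_quantile_eq_tail[OF M Z rng densitiesD(3)[OF that]] by simp
  show ?thesis unfolding eq
  proof (rule antisym)
    show "(SUP r\<in>?R. ?v r) \<le> dro_value \<phi> \<psi> \<rho> lam unit_measure ?q"
      unfolding dro_value_def by (rule SUP_least) (auto simp: v[symmetric] intro: SUP_upper2)
    show "dro_value \<phi> \<psi> \<rho> lam unit_measure ?q \<le> (SUP r\<in>?R. ?v r)"
      unfolding dro_value_def
    proof (rule SUP_least)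
      fix r assume "r \<in> {r \<in> densities unit_measure. density_div \<phi> unit_measure r \<le> ereal \<rho>}"
      then have r: "r \<in> densities unit_measure" and r\<rho>: "density_div \<phi> unit_measure r \<le> ereal \<rho>" by auto
      obtain r' where r': "r' \<in> densities unit_measure" "mono_on {0<..<1} r'"
        and law: "distr unit_measure borel r' = distr unit_measure borel r"
        using monotone_rearrangement[OF r] by blast
      have div: "density_div \<phi>' unit_measure r' = density_div \<phi>' unit_measure r" if "divergence_fun \<phi>'" for \<phi>'
        by (rule density_div_cong_distr[OF r'(1) r law that])
      have "ereal (\<integral>u. r u * ?q u \<partial>unit_measure) - ereal lam * density_div \<psi> unit_measure r \<le> ?v r'"
        unfolding v[OF r'(1), symmetric] unfolding div[OF \<psi>]
        using Hardy_Littlewood[OF r r' law qmono qb] by (intro ereal_minus_mono) auto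
      also have "\<dots> \<le> (SUP r\<in>?R. ?v r)"
        using r' r\<rho> by (intro SUP_upper) (simp add: div[OF \<phi>])
      finally show "ereal (\<integral>u. r u * ?q u \<partial>unit_measure) - ereal lam * density_div \<psi> unit_measure r \<le> (SUP r\<in>?R. ?v r)" .
    qed
  qed
qed

section \<open>Expected value of the empirical objective\<close>

lemma sum_Pow_card:
  fixes g :: "nat \<Rightarrow> real"
  assumes "finite A"
  shows "(\<Sum>J\<in>Pow A. g (card J)) = (\<Sum>k\<le>card A. real (card A choose k) * g k)"
proof -
  have "(\<Sum>J\<in>Pow A. g (card J)) = (\<Sum>k\<le>card A. \<Sum>J | J \<in> Pow A \<and> card J = k. g (card J))"
    using assms by (intro sum.group[symmetric]) (auto intro: card_mono)
  also have "\<dots> = (\<Sum>k\<le>card A. real (card {J. J \<subseteq> A \<and> card J = k}) * g k)"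
    by (intro sum.cong refl) simp
  finally show ?thesis using assms by (simp add: n_subsets)
qed

lemma Bernstein_operator_measurable [measurable]:
  "Bernstein_operator n q \<in> borel_measurable borel"
  unfolding Bernstein_operator_def[abs_def] Bernstein_def by measurable

lemma nn_integral_ge:
  fixes h :: "'a \<Rightarrow> real"
  assumes h: "integrable M h" and le: "\<And>x. x \<in> space M \<Longrightarrow> ereal (h x) \<le> F x"
  shows "ereal (integral\<^sup>L M h) \<le> enn2ereal (\<integral>\<^sup>+x. e2ennreal (F x) \<partial>M)"
proof -
  have i: "integrable M (\<lambda>x. max 0 (h x))" using h by auto
  have "integral\<^sup>L M h \<le> (\<integral>x. max 0 (h x) \<partial>M)" using h i by (intro integral_mono) auto
  moreover have "ereal (\<integral>x. max 0 (h x) \<partial>M) = enn2ereal (ennreal (\<integral>x. max 0 (h x) \<partial>M))"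
    by (subst enn2ereal_ennreal) (auto intro: integral_nonneg_AE)
  moreover have "ennreal (\<integral>x. max 0 (h x) \<partial>M) = (\<integral>\<^sup>+x. ennreal (max 0 (h x)) \<partial>M)"
    by (rule nn_integral_eq_integral[symmetric, OF i]) auto
  moreover have "\<dots> \<le> (\<integral>\<^sup>+x. e2ennreal (F x) \<partial>M)"
  proof (rule nn_integral_mono)
    fix x assume "x \<in> space M"
    from e2ennreal_mono[OF le[OF this]] show "ennreal (max 0 (h x)) \<le> e2ennreal (F x)"
      by (simp add: max_def ennreal_neg split: if_splits)
  qed
  ultimately show ?thesis
    by (metis ereal_less_eq(3) less_eq_ennreal.rep_eq order_trans)
qed

context loss_sample
begin

text \<open>
  The sample space is partitioned according to the set \<open>J\<close> of indices whose points lie in \<open>A\<close>; each part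
  is a product set.
\<close>
lemma expectation_count:
  fixes f :: "nat \<Rightarrow> real"
  assumes A[measurable]: "A \<in> sets P"
  shows "(\<integral>s. f (card {i. i < n \<and> s i \<in> A}) \<partial>S\<^sub>n) = (\<Sum>k\<le>n. f k * Bernstein n k (prob A))"
proof -
  define E where "E J = Pi\<^sub>E {..<n} (\<lambda>i. if i \<in> J then A else space P - A)" for J
  interpret PP: finite_product_prob_space "\<lambda>_. P" "{..<n}" by unfold_locales simp
  have E[measurable]: "E J \<in> sets S\<^sub>n" for J
    unfolding E_def by (rule sets_PiM_I_finite) auto
  have measE: "measure S\<^sub>n (E J) = prob A ^ card J * (1 - prob A) ^ (n - card J)" if J: "J \<subseteq> {..<n}" for J
  proof -
    have "measure S\<^sub>n (E J) = (\<Prod>i<n. prob (if i \<in> J then A else space P - A))"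
      unfolding E_def by (rule PP.finite_measure_PiM_emb) auto
    also have "\<dots> = (\<Prod>i<n. if i \<in> J then prob A else 1 - prob A)"
      by (intro prod.cong refl) (simp add: prob_compl)
    also have "\<dots> = (\<Prod>i\<in>J. prob A) * (\<Prod>i\<in>{..<n} - J. 1 - prob A)"
      using J by (subst prod.If_cases) (auto simp: Int_absorb1 Diff_eq)
    finally show ?thesis using J by (simp add: card_Diff_subset finite_subset)
  qed
  have in_E: "s \<in> E J \<longleftrightarrow> J = {i. i < n \<and> s i \<in> A}" if s: "s \<in> space S\<^sub>n" and J: "J \<subseteq> {..<n}" for s J
  proof
    assume "s \<in> E J"
    then have sE: "s \<in> (\<Pi>\<^sub>E i\<in>{..<n}. if i \<in> J then A else space P - A)" unfolding E_def .
    have *: "s i \<in> (if i \<in> J then A else space P - A)" if "i < n" for i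
      using PiE_mem[OF sE, of i] that by simp
    show "J = {i. i < n \<and> s i \<in> A}"
    proof (rule set_eqI)
      fix i show "i \<in> J \<longleftrightarrow> i \<in> {i. i < n \<and> s i \<in> A}"
        using J *[of i] by (cases "i \<in> J") auto
    qed
  next
    assume "J = {i. i < n \<and> s i \<in> A}"
    with s show "s \<in> E J" by (auto simp: E_def space_PiM PiE_iff)
  qed
  have "(\<integral>s. f (card {i. i < n \<and> s i \<in> A}) \<partial>S\<^sub>n) = (\<integral>s. (\<Sum>J\<in>Pow {..<n}. f (card J) * indicator (E J) s) \<partial>S\<^sub>n)"
  proof (intro Bochner_Integration.integral_cong refl)
    fix s assume s: "s \<in> space S\<^sub>n"
    have "(\<Sum>J\<in>Pow {..<n}. f (card J) * indicator (E J) s)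
        = (\<Sum>J\<in>Pow {..<n}. if J = {i. i < n \<and> s i \<in> A} then f (card J) else 0)"
      using in_E[OF s] by (intro sum.cong refl) (auto split: split_indicator)
    also have "\<dots> = f (card {i. i < n \<and> s i \<in> A})" by (subst sum.delta) auto
    finally show "f (card {i. i < n \<and> s i \<in> A}) = (\<Sum>J\<in>Pow {..<n}. f (card J) * indicator (E J) s)" by simp
  qed
  also have "\<dots> = (\<Sum>J\<in>Pow {..<n}. f (card J) * measure S\<^sub>n (E J))"
    by (subst Bochner_Integration.integral_sum) (auto intro!: integrable_mult_right integrable_real_indicator S.emeasure_finite simp: less_top[symmetric])
  also have "\<dots> = (\<Sum>J\<in>Pow {..<n}. (\<lambda>k. f k * (prob A ^ k * (1 - prob A) ^ (n - k))) (card J))"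
    using measE by (intro sum.cong) auto
  also have "\<dots> = (\<Sum>k\<le>n. f k * Bernstein n k (prob A))"
    by (subst sum_Pow_card) (auto simp: Bernstein_def intro!: sum.cong)
  finally show ?thesis .
qed

abbreviation "loss_cdf \<equiv> cdf (distr P borel Z)"

definition emp_cdf :: "(nat \<Rightarrow> 's) \<Rightarrow> real \<Rightarrow> real" where
  "emp_cdf s t = real (card {i. i < n \<and> Z (s i) \<le> t}) / real n"

lemma loss_cdf_eq: "loss_cdf t = prob {x \<in> space P. Z x \<le> t}"
  by (simp add: cdf_def measure_distr vimage_def Int_def conj_commute)

lemma loss_cdf_range: "0 \<le> loss_cdf t" "loss_cdf t \<le> 1"
  by (auto simp: loss_cdf_eq)

lemma loss_cdf_measurable [measurable]: "loss_cdf \<in> borel_measurable borel"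
  by (rule cdf_distribution.measurable_C[OF cdf_distribution_distr[OF prob_space_axioms Z_measurable]])

lemma cdf_sample: "cdf (distr U\<^sub>n borel (\<lambda>i. Z (s i))) t = emp_cdf s t"
proof -
  have eq: "(\<lambda>i. Z (s i)) -` {..t} \<inter> space U\<^sub>n = {i. i < n \<and> Z (s i) \<le> t}"
    by (auto simp: space_uniform_count_measure)
  have "cdf (distr U\<^sub>n borel (\<lambda>i. Z (s i))) t = measure U\<^sub>n ((\<lambda>i. Z (s i)) -` {..t} \<inter> space U\<^sub>n)"
    unfolding cdf_def by (rule measure_distr[OF measurable_U]) simp
  also have "\<dots> = measure U\<^sub>n {i. i < n \<and> Z (s i) \<le> t}" unfolding eq ..
  also have "\<dots> = emp_cdf s t"
    unfolding emp_cdf_def by (subst measure_uniform_count_measure) auto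
  finally show ?thesis .
qed

lemma emp_cdf_sum: "emp_cdf s t = (\<Sum>i<n. if Z (s i) \<le> t then 1 else 0) / real n"
proof -
  have "{i. i < n \<and> Z (s i) \<le> t} = {..<n} \<inter> {i. Z (s i) \<le> t}" by auto
  then show ?thesis by (simp add: emp_cdf_def sum.If_cases)
qed

lemma emp_cdf_measurable [measurable]: "(\<lambda>p. emp_cdf (fst p) (snd p)) \<in> borel_measurable (S\<^sub>n \<Otimes>\<^sub>M borel)"
proof -
  have m: "(\<lambda>p. if Z (fst p i) \<le> snd p then 1 else 0 :: real) \<in> borel_measurable (S\<^sub>n \<Otimes>\<^sub>M borel)" if "i < n" for i
  proof -
    have "(\<lambda>p. Z (fst p i)) \<in> borel_measurable (S\<^sub>n \<Otimes>\<^sub>M borel)"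
      by (rule measurable_compose[OF measurable_fst Z_component_measurable[OF that]])
    then have d: "(\<lambda>p. snd p - Z (fst p i)) \<in> borel_measurable (S\<^sub>n \<Otimes>\<^sub>M borel)"
      by (intro borel_measurable_diff measurable_snd)
    have eq: "(if Z (fst p i) \<le> snd p then 1 else 0 :: real) = indicator {0..} (snd p - Z (fst p i))" for p
      by (simp split: split_indicator)
    show ?thesis unfolding eq by (rule measurable_compose[OF d]) simp
  qed
  have "(\<lambda>p. \<Sum>i<n. if Z (fst p i) \<le> snd p then 1 else 0 :: real) \<in> borel_measurable (S\<^sub>n \<Otimes>\<^sub>M borel)"
    by (rule borel_measurable_sum, rule m) simp
  then show ?thesis unfolding emp_cdf_sum by (rule borel_measurable_divide) simp
qed

lemma emp_cdf_range: "0 \<le> emp_cdf s t" "emp_cdf s t \<le> 1"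
proof -
  have "card {i. i < n \<and> Z (s i) \<le> t} \<le> card {..<n}" by (intro card_mono) auto
  then show "0 \<le> emp_cdf s t" "emp_cdf s t \<le> 1" using n_pos by (auto simp: emp_cdf_def)
qed

lemma expectation_tail_emp_cdf:
  "(\<integral>s. tail r (emp_cdf s t) \<partial>S\<^sub>n) = Bernstein_operator n (tail r) (loss_cdf t)"
proof -
  let ?A = "{x \<in> space P. Z x \<le> t}"
  have "(\<integral>s. tail r (emp_cdf s t) \<partial>S\<^sub>n) = (\<integral>s. (\<lambda>k. tail r (real k / real n)) (card {i. i < n \<and> s i \<in> ?A}) \<partial>S\<^sub>n)"
    unfolding emp_cdf_def
    by (intro Bochner_Integration.integral_cong refl arg_cong[where f="\<lambda>k. tail r (real (card k) / real n)"])
       (auto simp: space_PiM PiE_iff)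
  also have "\<dots> = Bernstein_operator n (tail r) (loss_cdf t)"
    by (subst expectation_count) (auto simp: Bernstein_operator_def loss_cdf_eq)
  finally show ?thesis .
qed

text \<open>
  By the spectral representation this is the gap between the linear parts of the objective and of the
  expected empirical objective at the same density \<open>r\<close>.
\<close>
definition Bernstein_error :: "(real \<Rightarrow> real) \<Rightarrow> real" where
  "Bernstein_error r =
    (\<integral>t. indicator {0..<B} t * (tail r (loss_cdf t) - Bernstein_operator n (tail r) (loss_cdf t)) \<partial>lborel)"

lemma integrable_indicator_bounded:
  fixes f :: "real \<Rightarrow> real"
  assumes [measurable]: "f \<in> borel_measurable borel" and "\<And>t. \<bar>f t\<bar> \<le> C"
  shows "integrable lborel (\<lambda>t. indicator {0..<B} t * f t)"
  using assms B_nonneg by (intro integrable_mult_bounded[of _ _ _ C]) (auto simp: integrable_indicator_iff)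

lemma sample_tail_integral:
  assumes r: "r \<in> densities unit_measure"
  shows "integrable S\<^sub>n (\<lambda>s. \<integral>t. indicator {0..<B} t * tail r (emp_cdf s t) \<partial>lborel)"
    and "(\<integral>s. (\<integral>t. indicator {0..<B} t * tail r (emp_cdf s t) \<partial>lborel) \<partial>S\<^sub>n)
      = (\<integral>t. indicator {0..<B} t * Bernstein_operator n (tail r) (loss_cdf t) \<partial>lborel)"
proof -
  interpret L: pair_sigma_finite "S\<^sub>n" "lborel :: real measure" ..
  let ?F = "\<lambda>s t. indicator {0..<B} t * tail r (emp_cdf s t)"
  note tail_measurable[OF r, measurable]
  have b: "0 \<le> tail r (emp_cdf s t) \<and> tail r (emp_cdf s t) \<le> 1" for s t
    using tail_nonneg[OF r] tail_le_1[OF r emp_cdf_range(1)] by auto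
  have meas: "case_prod ?F \<in> borel_measurable (S\<^sub>n \<Otimes>\<^sub>M lborel)"
  proof -
    have eq: "case_prod ?F = (\<lambda>p. indicator {0..<B} (snd p) * tail r (emp_cdf (fst p) (snd p)))" by auto
    show ?thesis unfolding eq by measurable
  qed
  have int: "integrable (S\<^sub>n \<Otimes>\<^sub>M lborel) (case_prod ?F)"
  proof (rule integrableI_bounded_set[of "space S\<^sub>n \<times> {0..<B}" _ _ 1])
    show "emeasure (S\<^sub>n \<Otimes>\<^sub>M lborel) (space S\<^sub>n \<times> {0..<B}) < \<infinity>"
      using B_nonneg by (subst lborel.emeasure_pair_measure_Times) (auto simp: S.emeasure_space_1)
    show "AE x in S\<^sub>n \<Otimes>\<^sub>M lborel. x \<in> space S\<^sub>n \<times> {0..<B} \<longrightarrow> norm (case_prod ?F x) \<le> 1"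
      using b by (intro AE_I2) (auto split: split_indicator)
    show "AE x in S\<^sub>n \<Otimes>\<^sub>M lborel. x \<notin> space S\<^sub>n \<times> {0..<B} \<longrightarrow> case_prod ?F x = 0"
      by (intro AE_I2) (auto simp: space_pair_measure indicator_def split: if_splits)
  qed (use meas in auto)
  show "integrable S\<^sub>n (\<lambda>s. \<integral>t. ?F s t \<partial>lborel)" by (rule L.integrable_fst[OF int])
  have "(\<integral>s. (\<integral>t. ?F s t \<partial>lborel) \<partial>S\<^sub>n) = (\<integral>t. (\<integral>s. ?F s t \<partial>S\<^sub>n) \<partial>lborel)"
    by (rule L.Fubini_integral[OF int, symmetric])
  then show "(\<integral>s. (\<integral>t. ?F s t \<partial>lborel) \<partial>S\<^sub>n)
      = (\<integral>t. indicator {0..<B} t * Bernstein_operator n (tail r) (loss_cdf t) \<partial>lborel)"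
    by (simp add: expectation_tail_emp_cdf)
qed

text \<open>
  A density \<open>r\<close> that is near-optimal for \<open>P\<close> is also feasible for every sample, with the same penalty.
\<close>
lemma dro_value_le_of_bias_bound:
  assumes \<phi>: "divergence_fun \<phi>" and \<psi>: "divergence_fun \<psi>" and lam: "0 \<le> lam"
    and e: "\<And>r. r \<in> densities unit_measure \<Longrightarrow> mono_on {0<..<1} r \<Longrightarrow> density_div \<phi> unit_measure r \<le> ereal \<rho> \<Longrightarrow>
      Bernstein_error r \<le> e"
  shows "dro_value \<phi> \<psi> \<rho> lam P Z \<le> expected_emp_value \<phi> \<psi> \<rho> lam + ereal e"
    (is "_ \<le> ?E + _")
proof -
  have rng: "\<forall>x\<in>space P. 0 \<le> Z x \<and> Z x \<le> B" using Z_range by blast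
  show ?thesis
    unfolding dro_value_spectral[OF prob_space_axioms Z_measurable rng \<phi> \<psi> lam]
  proof (rule SUP_least)
    fix r assume "r \<in> {r \<in> densities unit_measure. mono_on {0<..<1} r \<and> density_div \<phi> unit_measure r \<le> ereal \<rho>}"
    then have r: "r \<in> densities unit_measure" "mono_on {0<..<1} r" "density_div \<phi> unit_measure r \<le> ereal \<rho>" by auto
    note tail_measurable[OF r(1), measurable]
    let ?q = "tail r" and ?b = "Bernstein_operator n (tail r)"
    have "0 \<le> ereal lam * density_div \<psi> unit_measure r"
      using density_div_nonneg[OF prob_space_unit r(1) \<psi>] lam by (simp add: ereal_zero_le_0_iff)
    then consider "ereal lam * density_div \<psi> unit_measure r = \<infinity>" | d where "ereal lam * density_div \<psi> unit_measure r = ereal d"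
      by (cases "ereal lam * density_div \<psi> unit_measure r") auto
    then show "ereal (\<integral>t. indicator {0..<B} t * ?q (loss_cdf t) \<partial>lborel) - ereal lam * density_div \<psi> unit_measure r \<le> ?E + ereal e"
    proof cases
      case 1
      show ?thesis unfolding 1 by simp
    next
      case 2
      have sample: "ereal ((\<integral>t. indicator {0..<B} t * ?q (emp_cdf s t) \<partial>lborel) - d) \<le> emp_value \<phi> \<psi> \<rho> lam s"
        if "s \<in> space S\<^sub>n" for s
      proof -
        have rng: "\<forall>i\<in>space U\<^sub>n. 0 \<le> Z (s i) \<and> Z (s i) \<le> B"
          using Z_component_range[OF that] by (simp add: space_uniform_count_measure)
        show ?thesis
          unfolding emp_value_def dro_value_spectral[OF U.prob_space_axioms measurable_U rng \<phi> \<psi> lam] cdf_sample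
          using r by (intro SUP_upper2[of r]) (auto simp: 2)
      qed
      have "ereal (\<integral>s. (\<integral>t. indicator {0..<B} t * ?q (emp_cdf s t) \<partial>lborel) - d \<partial>S\<^sub>n) \<le> ?E"
        unfolding expected_emp_value_def
        using sample_tail_integral(1)[OF r(1)] sample by (intro nn_integral_ge) auto
      then have E: "ereal ((\<integral>t. indicator {0..<B} t * ?b (loss_cdf t) \<partial>lborel) - d) \<le> ?E"
        using sample_tail_integral[OF r(1)] by (simp add: S.prob_space)
      have i1: "integrable lborel (\<lambda>t. indicator {0..<B} t * ?q (loss_cdf t))"
        using tail_nonneg[OF r(1)] tail_le_1[OF r(1) loss_cdf_range(1)]
        by (intro integrable_indicator_bounded[of _ 1]) auto
      have b: "0 \<le> ?b (loss_cdf t) \<and> ?b (loss_cdf t) \<le> 1" for t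
        using Bernstein_operator_tail_le[OF r(1,2) loss_cdf_range n_pos, of t] tail_le_1[OF r(1) loss_cdf_range(1), of t]
          tail_nonneg[OF r(1)] Bernstein_nonneg[OF loss_cdf_range]
        by (auto simp: Bernstein_operator_def intro!: sum_nonneg)
      have i2: "integrable lborel (\<lambda>t. indicator {0..<B} t * ?b (loss_cdf t))"
        using b by (intro integrable_indicator_bounded[of _ 1]) auto
      have "(\<integral>t. indicator {0..<B} t * ?q (loss_cdf t) \<partial>lborel) - (\<integral>t. indicator {0..<B} t * ?b (loss_cdf t) \<partial>lborel) \<le> e"
        using e[OF r] i1 i2 by (simp add: Bernstein_error_def right_diff_distrib)
      then have "ereal ((\<integral>t. indicator {0..<B} t * ?q (loss_cdf t) \<partial>lborel) - d)
          \<le> ereal ((\<integral>t. indicator {0..<B} t * ?b (loss_cdf t) \<partial>lborel) - d) + ereal e" by simp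
      also have "\<dots> \<le> ?E + ereal e" by (rule add_right_mono[OF E])
      finally show ?thesis by (simp add: 2)
    qed
  qed
qed

lemma bias_le_of_tail_bound:
  assumes r: "r \<in> densities unit_measure" and mono: "mono_on {0<..<1} r" and K: "0 \<le> K"
    and tail: "\<And>c. 0 \<le> c \<Longrightarrow> c \<le> 1 \<Longrightarrow> tail r c \<le> K * sqrt (1 - c)"
  shows "Bernstein_error r \<le> B * (K / sqrt n)"
proof -
  note tail_measurable[OF r, measurable]
  have b: "0 \<le> tail r (loss_cdf t) - Bernstein_operator n (tail r) (loss_cdf t)"
    "tail r (loss_cdf t) - Bernstein_operator n (tail r) (loss_cdf t) \<le> K / sqrt n" for t
    using Bernstein_operator_tail_le[OF r mono loss_cdf_range n_pos, of t]
      Bernstein_operator_tail_ge[OF r mono loss_cdf_range n_pos tail[OF loss_cdf_range] K, of t] by auto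
  have "Bernstein_error r \<le> (\<integral>t. indicator {0..<B} t * (K / sqrt n) \<partial>lborel)"
    unfolding Bernstein_error_def using b by (intro integral_mono integrable_indicator_bounded[of _ "K / sqrt n"])
      (auto simp: K split: split_indicator)
  also have "\<dots> = B * (K / sqrt n)" using B_nonneg by simp
  finally show ?thesis .
qed

end

section \<open>Lipschitz quantile functions\<close>

lemma integral_indicator_Ico_Icc:
  fixes f :: "real \<Rightarrow> real"
  assumes [measurable]: "f \<in> borel_measurable borel"
  shows "(\<integral>t. indicator {a..<b} t * f t \<partial>lborel) = (\<integral>t. f t * indicator {a..b} t \<partial>lborel)"
proof (rule integral_cong_AE)
  have "AE t in lborel. t \<noteq> b" by (rule AE_lborel_singleton)
  then show "AE t in lborel. indicator {a..<b} t * f t = f t * indicator {a..b} t"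
    by eventually_elim (auto split: split_indicator)
qed auto

lemma isCont_Bernstein: "isCont (Bernstein n k) x"
  unfolding Bernstein_def[abs_def] by (intro continuous_intros)

lemma Bernstein_measurable [measurable]: "Bernstein n k \<in> borel_measurable borel"
  by (intro borel_measurable_continuous_onI) (simp add: continuous_on_eq_continuous_at isCont_Bernstein)

text \<open>
  All Bernstein polynomials of degree \<open>n\<close> have the same integral, since the difference of two
  neighbouring ones is a multiple of the derivative of a polynomial that vanishes at both end points;
  and they add up to \<open>1\<close>.
\<close>
lemma integral_Bernstein:
  assumes "k \<le> n"
  shows "(\<integral>x. Bernstein n k x * indicator {0..1} x \<partial>lborel) = 1 / real (Suc n)"
proof -
  define m where "m k = (\<integral>x. Bernstein n k x * indicator {0..1} x \<partial>lborel)" for k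
  have int: "integrable lborel (\<lambda>x. Bernstein n k x * indicator {0..1} x)" for k
    by (rule borel_integrable_atLeastAtMost) (rule isCont_Bernstein)
  have step: "m k = m (Suc k)" if "k < n" for k
  proof -
    define d where "d = n - Suc k"
    have n: "n = Suc (k + d)" using that by (simp add: d_def)
    define F where "F x = real (n choose Suc k) * (x ^ Suc k * (1 - x) ^ Suc d)" for x :: real
    have ch: "real (n choose Suc k) * real (Suc k) = real (n choose k) * real (Suc d)"
    proof -
      have "(n choose Suc k) * Suc k = (n choose k) * (n - k)"
        using binomial_absorb_comp[of n k] binomial_absorption[of k n] by (simp only: mult.commute)
      then show ?thesis unfolding of_nat_mult[symmetric] of_nat_eq_iff by (simp add: n)
    qed
    have der: "DERIV F x :> real (Suc d) * (Bernstein n k x - Bernstein n (Suc k) x)" for x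
    proof -
      have "DERIV F x :> real (n choose Suc k) * (real (Suc k) * x ^ k * (1 - x) ^ Suc d - x ^ Suc k * (real (Suc d) * (1 - x) ^ d))"
        unfolding F_def by (auto intro!: derivative_eq_intros simp del: power_Suc)
      moreover have "real (n choose Suc k) * (real (Suc k) * x ^ k * (1 - x) ^ Suc d - x ^ Suc k * (real (Suc d) * (1 - x) ^ d))
          = (real (n choose Suc k) * real (Suc k)) * (x ^ k * (1 - x) ^ Suc d) - real (n choose Suc k) * (x ^ Suc k * (real (Suc d) * (1 - x) ^ d))"
        by (simp add: algebra_simps del: power_Suc of_nat_Suc)
      moreover have "\<dots> = real (Suc d) * (Bernstein n k x - Bernstein n (Suc k) x)"
        unfolding ch by (simp add: Bernstein_def n algebra_simps del: power_Suc of_nat_Suc)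
      ultimately show ?thesis by simp
    qed
    have "(\<integral>x. real (Suc d) * (Bernstein n k x - Bernstein n (Suc k) x) * indicator {0..1} x \<partial>lborel) = F 1 - F 0"
      by (rule integral_FTC_Icc_real) (use der in \<open>auto intro!: continuous_intros isCont_Bernstein simp del: of_nat_Suc\<close>)
    also have "\<dots> = 0" by (simp add: F_def)
    also have "(\<integral>x. real (Suc d) * (Bernstein n k x - Bernstein n (Suc k) x) * indicator {0..1} x \<partial>lborel)
        = real (Suc d) * (m k - m (Suc k))"
    proof -
      have *: "real (Suc d) * (Bernstein n k x - Bernstein n (Suc k) x) * indicator {0..1} x
        = real (Suc d) * (Bernstein n k x * indicator {0..1} x - Bernstein n (Suc k) x * indicator {0..1} x)" for x :: real
        by (simp add: algebra_simps)
      show ?thesis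
        unfolding * m_def integral_mult_right_zero Bochner_Integration.integral_diff[OF int int] ..
    qed
    finally show ?thesis by simp
  qed
  have const: "m k = m 0" if "k \<le> n" for k
    using that by (induction k) (auto simp: step)
  have "(\<Sum>k\<le>n. m k) = (\<integral>x. (\<Sum>k\<le>n. Bernstein n k x * indicator {0..1} x) \<partial>lborel)"
    unfolding m_def by (rule Bochner_Integration.integral_sum[symmetric]) (rule int)
  also have "\<dots> = (\<integral>x. (indicator {0..1::real} x :: real) \<partial>lborel)"
    by (simp flip: sum_distrib_right)
  also have "\<dots> = 1" by simp
  finally have "(\<Sum>k\<le>n. m k) = 1" .
  moreover have "(\<Sum>k\<le>n. m k) = (\<Sum>k\<le>n. m 0)" by (intro sum.cong refl, rule const) simp
  ultimately have "m 0 = 1 / real (Suc n)" by (simp add: field_simps)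
  then show ?thesis using const[OF assms] by (simp add: m_def)
qed

lemma integrable_indicator_Ico:
  fixes f :: "real \<Rightarrow> real"
  assumes "f \<in> borel_measurable borel" "\<And>t. a \<le> t \<Longrightarrow> t < b \<Longrightarrow> \<bar>f t\<bar> \<le> C" "a \<le> b"
  shows "integrable lborel (\<lambda>t. indicator {a..<b} t * f t)"
  by (rule integrableI_bounded_set[of "{a..<b}" _ _ C])
     (use assms in \<open>auto split: split_indicator\<close>)

lemma integral_tail_le_Riemann_sum:
  assumes r: "r \<in> densities unit_measure" and n: "0 < n"
  shows "(\<integral>t. indicator {0..<1} t * tail r t \<partial>lborel) \<le> (\<Sum>k<n. tail r (real k / n)) / n"
proof -
  note tail_measurable[OF r, measurable]
  have int: "integrable lborel (\<lambda>t. indicator {a..<b} t * tail r t)" if "0 \<le> a" "a \<le> b" for a b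
    using that tail_nonneg[OF r] tail_le_1[OF r] by (intro integrable_indicator_Ico[of _ _ _ 1]) auto
  have "(\<integral>t. indicator {0..<real m / n} t * tail r t \<partial>lborel) \<le> (\<Sum>k<m. tail r (real k / n)) / n" for m
  proof (induction m)
    case (Suc m)
    define a where "a = real m / n"
    define b where "b = real (Suc m) / n"
    have ab: "0 \<le> a" "a \<le> b" and ba: "b - a = 1 / n"
      using n by (auto simp: a_def b_def divide_right_mono field_simps)
    have split: "indicator {0..<b} t * tail r t = indicator {0..<a} t * tail r t + indicator {a..<b} t * tail r t" for t
      using ab by (auto split: split_indicator)
    have "(\<integral>t. indicator {a..<b} t * tail r t \<partial>lborel) \<le> (\<integral>t. indicator {a..<b} t * tail r a \<partial>lborel)"
      using ab by (intro integral_mono int integrable_indicator_Ico[of _ _ _ "\<bar>tail r a\<bar>"])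
        (auto split: split_indicator intro: tail_antimono[OF r])
    also have "\<dots> = (b - a) * tail r a" using ab by simp
    also have "\<dots> = tail r a / n" unfolding ba by simp
    finally have last: "(\<integral>t. indicator {a..<b} t * tail r t \<partial>lborel) \<le> tail r a / n" .
    have "(\<integral>t. indicator {0..<b} t * tail r t \<partial>lborel)
        = (\<integral>t. indicator {0..<a} t * tail r t \<partial>lborel) + (\<integral>t. indicator {a..<b} t * tail r t \<partial>lborel)"
      unfolding split using ab by (intro Bochner_Integration.integral_add int) auto
    also have "\<dots> \<le> (\<Sum>k<m. tail r (real k / n)) / n + tail r a / n"
      using Suc last unfolding a_def[symmetric] by (rule add_mono)
    finally show ?case unfolding b_def a_def by (simp add: add_divide_distrib)
  qed simp
  from this[of n] show ?thesis using n by simp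
qed

text \<open>
  The left Riemann sum, with weights \<open>1 / n\<close>, bounds the integral of the decreasing function \<open>tail r\<close>,
  and the Bernstein polynomial integrates to a sum of the same values with weights \<open>1 / (n + 1)\<close>.
\<close>
lemma integral_tail_minus_Bernstein:
  assumes r: "r \<in> densities unit_measure" and n: "0 < n"
  shows "(\<integral>t. indicator {0..<1} t * (tail r t - Bernstein_operator n (tail r) t) \<partial>lborel) \<le> 1 / (real n + 1)"
proof -
  note tail_measurable[OF r, measurable]
  define q where "q k = tail r (real k / n)" for k
  have q: "0 \<le> q k" "q k \<le> 1" for k using tail_nonneg[OF r] tail_le_1[OF r] by (auto simp: q_def)
  have i1: "integrable lborel (\<lambda>t. indicator {0..<1} t * tail r t)"
    using tail_nonneg[OF r] tail_le_1[OF r] by (intro integrable_indicator_Ico[of _ _ _ 1]) auto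
  have B01: "\<bar>Bernstein n k t\<bar> \<le> 1" if "0 \<le> t" "t < 1" "k \<le> n" for k t
  proof -
    have "Bernstein n k t \<le> (\<Sum>j\<le>n. Bernstein n j t)"
      using that by (intro member_le_sum Bernstein_nonneg) auto
    then show ?thesis using that Bernstein_nonneg[of t n k] by simp
  qed
  have ib: "integrable lborel (\<lambda>t. indicator {0..<1} t * Bernstein n k t)" if "k \<le> n" for k
    using B01 that by (intro integrable_indicator_Ico[of _ _ _ 1]) auto
  have eq: "indicator {0..<1} t * Bernstein_operator n (tail r) t = (\<Sum>k\<le>n. q k * (indicator {0..<1} t * Bernstein n k t))" for t
    by (simp add: Bernstein_operator_def q_def sum_distrib_left mult.left_commute)
  have i2: "integrable lborel (\<lambda>t. indicator {0..<1} t * Bernstein_operator n (tail r) t)"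
    unfolding eq using ib by (intro Bochner_Integration.integrable_sum integrable_mult_right) auto
  have "(\<integral>t. indicator {0..<1} t * Bernstein_operator n (tail r) t \<partial>lborel) = (\<Sum>k\<le>n. q k * (1 / real (Suc n)))"
    unfolding eq using ib
    by (subst Bochner_Integration.integral_sum) (auto simp: integral_indicator_Ico_Icc integral_Bernstein)
  also have "\<dots> \<ge> (\<Sum>k<n. q k * (1 / real (Suc n)))"
    using q by (intro sum_mono2) auto
  finally have "(\<Sum>k<n. q k * (1 / real (Suc n))) \<le> (\<integral>t. indicator {0..<1} t * Bernstein_operator n (tail r) t \<partial>lborel)" .
  then have "(\<Sum>k<n. q k) / (real n + 1) \<le> (\<integral>t. indicator {0..<1} t * Bernstein_operator n (tail r) t \<partial>lborel)"
    by (simp add: sum_divide_distrib add.commute)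
  moreover have "(\<integral>t. indicator {0..<1} t * tail r t \<partial>lborel) \<le> (\<Sum>k<n. q k) / n"
    using integral_tail_le_Riemann_sum[OF r n] by (simp add: q_def)
  moreover have "(\<Sum>k<n. q k) / n - (\<Sum>k<n. q k) / (real n + 1) \<le> 1 / (real n + 1)"
  proof -
    have "(\<Sum>k<n. q k) \<le> (\<Sum>k<n. 1)" by (intro sum_mono q)
    then have "(\<Sum>k<n. q k) / n \<le> 1" using n by simp
    then have "(\<Sum>k<n. q k) / n / (real n + 1) \<le> 1 / (real n + 1)" by (intro divide_right_mono) auto
    moreover have "(\<Sum>k<n. q k) / n - (\<Sum>k<n. q k) / (real n + 1) = (\<Sum>k<n. q k) / n / (real n + 1)"
      using n by (simp add: field_simps)
    ultimately show ?thesis by simp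
  qed
  ultimately show ?thesis using i1 i2 by (simp add: right_diff_distrib)
qed

text \<open>
  The density is minus the derivative of the Bernstein polynomial. It lets the Bernstein polynomial be
  treated on the same footing as \<open>tail r\<close>, namely as the tail of a density.
\<close>
lemma Bernstein_operator_density:
  assumes n: "0 < n" and q1: "q 1 = 0"
  shows "\<exists>k. integrable unit_measure k \<and> (\<forall>c\<in>{0..1}. tail k c = Bernstein_operator n q c)"
proof -
  define p where "p = (\<Sum>k\<le>n. smult (q (real k / n) * real (n choose k)) ([:0, 1:] ^ k * [:1, -1:] ^ (n - k)))"
  have p: "poly p x = Bernstein_operator n q x" for x
    by (simp add: p_def poly_sum Bernstein_operator_def Bernstein_def mult.assoc)
  define k where "k x = - poly (pderiv p) x" for x
  have cont: "continuous_on S k" for S unfolding k_def by (intro continuous_intros)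
  have km[measurable]: "k \<in> borel_measurable borel" by (rule borel_measurable_continuous_onI[OF cont])
  obtain C where C: "\<forall>x\<in>{0..1}. \<bar>k x\<bar> \<le> C"
    using compact_imp_bounded[OF compact_continuous_image[OF cont compact_Icc[of "0::real" 1]]]
    by (auto simp: bounded_iff)
  have "integrable unit_measure k"
    using C by (intro unit.integrable_const_bound[of _ C] AE_I2) auto
  moreover have "tail k c = Bernstein_operator n q c" if c: "c \<in> {0..1}" for c
  proof -
    have "AE x in lborel. x \<noteq> c \<and> x \<noteq> 1" using AE_lborel_singleton[of c] AE_lborel_singleton[of 1] by eventually_elim simp
    then have *: "AE x in lborel. indicator {0<..<1} x *\<^sub>R (k x * indicator {c<..} x) = k x * indicator {c..1} x"
      by eventually_elim (use c in \<open>auto split: split_indicator\<close>)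
    have "tail k c = (\<integral>x. indicator {0<..<1} x *\<^sub>R (k x * indicator {c<..} x) \<partial>lborel)"
      unfolding tail_def by (rule integral_restrict_space) simp
    also have "\<dots> = (\<integral>x. k x * indicator {c..1} x \<partial>lborel)"
      by (rule integral_cong_AE[OF _ _ *]) auto
    also have "\<dots> = (- poly p 1) - (- poly p c)"
      using c cont[of UNIV] by (intro integral_FTC_Icc_real)
        (auto simp: k_def continuous_on_eq_continuous_at intro!: derivative_eq_intros)
    also have "poly p 1 = 0"
    proof -
      have "poly p 1 = (\<Sum>k\<le>n. if k = n then q 1 else 0)"
        unfolding p Bernstein_operator_def using n by (intro sum.cong) (auto simp: Bernstein_1)
      then show ?thesis by (simp add: q1)
    qed
    finally show ?thesis by (simp add: p)
  qed
  ultimately show ?thesis by blast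
qed

context loss_sample
begin

text \<open>
  The lower quantile lies between the left limit and the value of the upper one, and the latter is
  continuous.
\<close>
lemma quantile_eq_inverse_cdf:
  assumes L: "G-lipschitz_on {0..<1} (inverse_cdf P Z)" and u: "0 < u" "u < 1"
  shows "quantile (distr P borel Z) u = inverse_cdf P Z u"
proof (rule antisym)
  have G: "0 \<le> G" using L by (simp add: lipschitz_on_def)
  have zero: "loss_cdf t = 0" if "t < 0" for t
  proof -
    have none: "{x \<in> space P. Z x \<le> t} = {}" using Z_range that by force
    show ?thesis unfolding loss_cdf_eq none by simp
  qed
  have one: "loss_cdf B = 1"
  proof -
    have all: "{x \<in> space P. Z x \<le> B} = space P" using Z_range by auto
    show ?thesis unfolding loss_cdf_eq all by (rule prob_space)
  qed
  note iff = le_cdf_iff_quantile_le[OF prob_space_axioms Z_measurable u]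
  show "quantile (distr P borel Z) u \<le> inverse_cdf P Z u"
    unfolding inverse_cdf_def
  proof (rule cInf_greatest)
    show "{t. u < loss_cdf t} \<noteq> {}" using one u by (auto intro: exI[of _ B])
    show "quantile (distr P borel Z) u \<le> t" if "t \<in> {t. u < loss_cdf t}" for t
      using iff[of t] that by simp
  qed
  have below: "inverse_cdf P Z v \<le> quantile (distr P borel Z) u" if v: "0 < v" "v < u" for v
    unfolding inverse_cdf_def
  proof (rule cInf_lower)
    have "u \<le> loss_cdf (quantile (distr P borel Z) u)" using iff by simp
    then show "quantile (distr P borel Z) u \<in> {t. v < loss_cdf t}" using v by simp
    show "bdd_below {t. v < loss_cdf t}"
      using zero v by (intro bdd_belowI[of _ 0]) (force simp: not_less[symmetric])
  qed
  show "inverse_cdf P Z u \<le> quantile (distr P borel Z) u"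
  proof (rule field_le_epsilon)
    fix e :: real assume e: "0 < e"
    \<comment> \<open>A point below \<open>u\<close> where the upper quantile has changed by at most \<open>e\<close>.\<close>
    define v where "v = max (u / 2) (u - e / (G + 1))"
    have v: "0 < v" "v < u" using u e G by (auto simp: v_def)
    have "G * (u - v) \<le> G * (e / (G + 1))" using G by (intro mult_left_mono) (auto simp: v_def)
    also have "\<dots> \<le> e" using G e by (simp add: field_simps)
    finally have "G * (u - v) \<le> e" .
    moreover have "\<bar>inverse_cdf P Z u - inverse_cdf P Z v\<bar> \<le> G * (u - v)"
      using lipschitz_onD[OF L, of u v] u v by (simp add: dist_real_def)
    ultimately show "inverse_cdf P Z u \<le> quantile (distr P borel Z) u + e"
      using below[OF v] by linarith
  qed
qed

text \<open>
  With \<open>k = r - b\<close>, where \<open>b\<close> has the Bernstein polynomial as its tail, the left-hand side is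
  \<open>\<integral> k u * g u du\<close> for the quantile function \<open>g\<close>. As \<open>tail k \<ge> 0\<close>, \<open>integral_mult_mono_nonneg\<close> applies to
  the nondecreasing function \<open>G * u - g u\<close>.
\<close>
lemma bias_le_of_lipschitz:
  assumes r: "r \<in> densities unit_measure" and mono: "mono_on {0<..<1} r"
    and L: "G-lipschitz_on {0..<1} (inverse_cdf P Z)"
  shows "Bernstein_error r \<le> G / real n"
proof -
  let ?g = "quantile (distr P borel Z)"
  have G: "0 \<le> G" using L by (simp add: lipschitz_on_def)
  obtain b where b: "integrable unit_measure b" "\<forall>c\<in>{0..1}. tail b c = Bernstein_operator n (tail r) c"
    using Bernstein_operator_density[where q = "tail r", OF n_pos tail_1] by blast
  define k where "k u = r u - b u" for u
  have k: "integrable unit_measure k" unfolding k_def using densitiesD(3)[OF r] b(1) by simp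
  have tk: "tail k c = tail r c - Bernstein_operator n (tail r) c" if "0 \<le> c" "c \<le> 1" for c
    unfolding k_def using tail_diff[OF densitiesD(3)[OF r] b(1)] b(2) that by simp
  have k0: "integral\<^sup>L unit_measure k = 0"
  proof -
    have "Bernstein_operator n (tail r) 0 = tail r 0"
      by (simp add: Bernstein_operator_def Bernstein_0 if_distrib sum.delta cong: if_cong)
    then show ?thesis using tk[of 0] by (simp add: tail_0[symmetric])
  qed
  have gb: "0 \<le> ?g u \<and> ?g u \<le> B" if "u \<in> {0<..<1}" for u
    using quantile_range[OF prob_space_axioms Z_measurable, of 0 u]
      quantile_upper[OF prob_space_axioms Z_measurable, of B u] Z_range that by auto
  have gm[measurable]: "?g \<in> borel_measurable unit_measure"
    by (rule measurable_unit_mono[OF mono_on_quantile[OF prob_space_axioms Z_measurable]])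
  have "0 \<le> (\<integral>u. k u * (G * u - ?g u) \<partial>unit_measure)"
  proof (rule integral_mult_mono_nonneg[OF k _ k0, of _ "G + B"])
    show "0 \<le> tail k c" if "0 \<le> c" "c \<le> 1" for c
      using Bernstein_operator_tail_le[OF r mono that n_pos] by (simp add: tk[OF that])
    show "mono_on {0<..<1} (\<lambda>u. G * u - ?g u)"
    proof (rule mono_onI)
      fix u v :: real assume uv: "u \<in> {0<..<1}" "v \<in> {0<..<1}" "u \<le> v"
      have "\<bar>inverse_cdf P Z v - inverse_cdf P Z u\<bar> \<le> G * (v - u)"
        using lipschitz_onD[OF L, of v u] uv by (simp add: dist_real_def)
      then show "G * u - ?g u \<le> G * v - ?g v"
        using uv by (simp add: quantile_eq_inverse_cdf[OF L] algebra_simps)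
    qed
    show "\<bar>G * u - ?g u\<bar> \<le> G + B" if u: "u \<in> {0<..<1}" for u
    proof -
      have "0 \<le> G * u" "G * u \<le> G * 1" using G u mult_left_mono[of u 1 G] by auto
      then show ?thesis using gb[OF u] G by (simp add: abs_le_iff)
    qed
  qed
  also have "(\<integral>u. k u * (G * u - ?g u) \<partial>unit_measure) = G * (\<integral>u. k u * u \<partial>unit_measure) - (\<integral>u. k u * ?g u \<partial>unit_measure)"
  proof -
    have i1: "integrable unit_measure (\<lambda>u. k u * u)" by (rule integrable_mult_bounded[OF k, of _ 1]) auto
    have i2: "integrable unit_measure (\<lambda>u. k u * ?g u)"
      by (rule integrable_mult_bounded[OF k, of _ B]) (use gb in auto)
    have "(\<integral>u. k u * (G * u - ?g u) \<partial>unit_measure) = (\<integral>u. G * (k u * u) - k u * ?g u \<partial>unit_measure)"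
      by (simp add: algebra_simps)
    then show ?thesis using i1 i2 by simp
  qed
  also have "(\<integral>u. k u * ?g u \<partial>unit_measure) = (\<integral>t. indicator {0..<B} t * tail k (loss_cdf t) \<partial>lborel)"
    by (rule integral_quantile_eq_tail[OF prob_space_axioms Z_measurable Z_range k])
  also have "(\<integral>u. k u * u \<partial>unit_measure) = (\<integral>t. indicator {0..<1} t * tail k t \<partial>lborel)"
    unfolding tail_def
    by (subst layer_cake[OF unit.sigma_finite_measure_axioms k, of _ 1])
       (auto intro!: Bochner_Integration.integral_cong split: split_indicator)
  also have "\<dots> = (\<integral>t. indicator {0..<1} t * (tail r t - Bernstein_operator n (tail r) t) \<partial>lborel)"
    by (intro Bochner_Integration.integral_cong refl) (auto simp: tk split: split_indicator)
  finally have "Bernstein_error r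
      \<le> G * (\<integral>t. indicator {0..<1} t * (tail r t - Bernstein_operator n (tail r) t) \<partial>lborel)"
    by (simp add: Bernstein_error_def tk loss_cdf_range)
  also have "\<dots> \<le> G * (1 / (real n + 1))"
    using G by (intro mult_left_mono integral_tail_minus_Bernstein[OF r n_pos])
  also have "\<dots> \<le> G / real n" using G n_pos by (simp add: divide_left_mono)
  finally show ?thesis .
qed

end

section \<open>The chi-square penalty\<close>

lemma density_div_chi2:
  assumes "integrable M (\<lambda>x. (f x - 1)\<^sup>2)"
  shows "density_div chi2_fun M f = ereal ((\<integral>x. (f x - 1)\<^sup>2 \<partial>M) / 2)"
proof -
  have "eintegral M (\<lambda>x. chi2_fun (f x)) = (SUP k::nat. ereal (\<integral>x. (f x - 1)\<^sup>2 / 2 \<partial>M))"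
    using assms by (intro eintegral_SUP) (auto simp: chi2_fun_def)
  then show ?thesis by (simp add: density_div_def)
qed

lemma density_div_chi2_infinite:
  assumes [measurable]: "f \<in> borel_measurable M" and "\<not> integrable M (\<lambda>x. (f x - 1)\<^sup>2)"
  shows "density_div chi2_fun M f = \<infinity>"
proof -
  have neg: "e2ennreal (- chi2_fun (f x)) = 0" for x by (simp add: chi2_fun_def ennreal_neg)
  have "\<not> integrable M (\<lambda>x. (f x - 1)\<^sup>2 / 2)"
  proof
    assume "integrable M (\<lambda>x. (f x - 1)\<^sup>2 / 2)"
    then have "integrable M (\<lambda>x. 2 * ((f x - 1)\<^sup>2 / 2))" by (rule integrable_mult_right)
    with assms(2) show False by simp
  qed
  then have "(\<integral>\<^sup>+x. ennreal ((f x - 1)\<^sup>2 / 2) \<partial>M) = \<infinity>"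
    by (rule contrapos_np) (auto intro!: integrableI_nonneg simp: top.not_eq_extremum)
  then have "(\<integral>\<^sup>+x. e2ennreal (chi2_fun (f x)) \<partial>M) = \<infinity>" by (simp add: chi2_fun_def)
  then show ?thesis by (simp add: density_div_def eintegral_def neg zero_ennreal.rep_eq)
qed

text \<open>
  The maximiser of \<open>f \<mapsto> f * z - lam * (f - 1)\<^sup>2 / 2 - \<eta> * f\<close> over \<open>f \<ge> 0\<close>, that is, the optimal density
  at loss \<open>z\<close> when \<open>\<eta>\<close> is the multiplier of the normalisation constraint.
\<close>
definition chi2_weight :: "real \<Rightarrow> real \<Rightarrow> real \<Rightarrow> real" where
  "chi2_weight lam \<eta> z = max 0 (1 + (z - \<eta>) / lam)"

context loss_sample
begin

lemma expectation_square_sample_mean: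
  fixes g :: "'s \<Rightarrow> real"
  assumes g[measurable]: "g \<in> borel_measurable P" and range: "\<forall>x\<in>space P. \<bar>g x\<bar> \<le> C"
    and mean: "expectation g = 0"
  shows "integrable S\<^sub>n (\<lambda>s. ((\<Sum>i<n. g (s i)) / n)\<^sup>2)"
    and "(\<integral>s. ((\<Sum>i<n. g (s i)) / n)\<^sup>2 \<partial>S\<^sub>n) = expectation (\<lambda>x. (g x)\<^sup>2) / n"
proof -
  interpret PP: product_sigma_finite "\<lambda>_ :: nat. P" by unfold_locales
  have bnd: "\<bar>g x\<bar> \<le> C" if "x \<in> space P" for x using range that by blast
  have gi: "integrable P g" using bnd by (intro integrable_const_bound[of _ C] AE_I2) auto
  have comp[measurable]: "(\<lambda>s. g (s i)) \<in> borel_measurable S\<^sub>n" if "i < n" for i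
    using that by (intro measurable_compose[OF _ g] measurable_component_singleton) auto
  have sb: "\<bar>g (s i)\<bar> \<le> C" if "s \<in> space S\<^sub>n" "i < n" for s i
    using that by (intro bnd) (auto simp: space_PiM)
  have pi: "integrable S\<^sub>n (\<lambda>s. g (s i) * g (s j))" if "i < n" "j < n" for i j
  proof (rule S.integrable_const_bound[of _ "C * C"])
    show "AE s in S\<^sub>n. norm (g (s i) * g (s j)) \<le> C * C"
    proof (rule AE_I2)
      fix s assume s: "s \<in> space S\<^sub>n"
      show "norm (g (s i) * g (s j)) \<le> C * C"
        unfolding real_norm_def abs_mult
        by (rule mult_mono) (use sb[OF s that(1)] sb[OF s that(2)] in auto)
    qed
    show "(\<lambda>s. g (s i) * g (s j)) \<in> borel_measurable S\<^sub>n"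
      using comp[OF that(1)] comp[OF that(2)] by (rule borel_measurable_times)
  qed
  have sq: "((\<Sum>i<n. g (s i)) / n)\<^sup>2 = (\<Sum>i<n. \<Sum>j<n. g (s i) * g (s j)) / (real n)\<^sup>2" for s
    by (simp add: power_divide power2_eq_square sum_product)
  show "integrable S\<^sub>n (\<lambda>s. ((\<Sum>i<n. g (s i)) / n)\<^sup>2)"
    unfolding sq using pi by (intro integrable_divide_zero Bochner_Integration.integrable_sum) auto
  have prod: "(\<integral>s. g (s i) * g (s j) \<partial>S\<^sub>n) = (if j = i then expectation (\<lambda>x. (g x)\<^sup>2) else 0)" if ij: "i < n" "j < n" for i j
  proof (cases "j = i")
    case True
    have "(\<integral>s. (g (s i))\<^sup>2 \<partial>S\<^sub>n) = (\<integral>x. (g x)\<^sup>2 \<partial>distr S\<^sub>n P (\<lambda>s. s i))"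
      using ij by (subst integral_distr) auto
    also have "distr S\<^sub>n P (\<lambda>s. s i) = P"
      using ij by (intro distr_PiM_component) (auto intro: prob_space_axioms)
    finally show ?thesis by (simp add: True power2_eq_square)
  next
    case False
    \<comment> \<open>The product of two distinct coordinates, as a product over all coordinates.\<close>
    define f where "f = (\<lambda>k x. if k = i \<or> k = j then g x else 1)"
    have "(\<integral>s. g (s i) * g (s j) \<partial>S\<^sub>n) = (\<integral>s. (\<Prod>k<n. f k (s k)) \<partial>S\<^sub>n)"
    proof (rule Bochner_Integration.integral_cong[OF refl])
      fix s
      have "(\<Prod>k<n. f k (s k)) = (\<Prod>k\<in>{i, j}. f k (s k))"
        using ij by (intro prod.mono_neutral_right) (auto simp: f_def)
      then show "g (s i) * g (s j) = (\<Prod>k<n. f k (s k))" using False by (simp add: f_def)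
    qed
    also have "\<dots> = (\<Prod>k<n. integral\<^sup>L P (f k))"
    proof (rule PP.product_integral_prod)
      show "integrable P (f k)" for k
        using gi by (cases "k = i \<or> k = j") (auto simp: f_def)
    qed simp
    also have "\<dots> = 0"
    proof (rule prod_zero)
      have "integral\<^sup>L P (f i) = 0" using mean by (simp add: f_def)
      then show "\<exists>k\<in>{..<n}. integral\<^sup>L P (f k) = 0" using ij by blast
    qed simp
    finally show ?thesis using False by simp
  qed
  have "(\<integral>s. ((\<Sum>i<n. g (s i)) / n)\<^sup>2 \<partial>S\<^sub>n) = (\<Sum>i<n. \<Sum>j<n. (\<integral>s. g (s i) * g (s j) \<partial>S\<^sub>n)) / (real n)\<^sup>2"
  proof -
    have "(\<integral>s. (\<Sum>i<n. \<Sum>j<n. g (s i) * g (s j)) \<partial>S\<^sub>n) = (\<Sum>i<n. (\<integral>s. (\<Sum>j<n. g (s i) * g (s j)) \<partial>S\<^sub>n))"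
      using pi by (intro Bochner_Integration.integral_sum Bochner_Integration.integrable_sum) auto
    also have "\<dots> = (\<Sum>i<n. \<Sum>j<n. (\<integral>s. g (s i) * g (s j) \<partial>S\<^sub>n))"
      using pi by (intro sum.cong refl Bochner_Integration.integral_sum) auto
    finally show ?thesis unfolding sq by simp
  qed
  also have "(\<Sum>i<n. \<Sum>j<n. (\<integral>s. g (s i) * g (s j) \<partial>S\<^sub>n)) = (\<Sum>i<n. expectation (\<lambda>x. (g x)\<^sup>2))"
    by (intro sum.cong refl) (simp add: prod)
  finally show "(\<integral>s. ((\<Sum>i<n. g (s i)) / n)\<^sup>2 \<partial>S\<^sub>n) = expectation (\<lambda>x. (g x)\<^sup>2) / n"
    using n_pos by (simp add: power2_eq_square)
qed

lemma expectation_sample_mean: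
  fixes g :: "'s \<Rightarrow> real"
  assumes g[measurable]: "g \<in> borel_measurable P" and range: "\<forall>x\<in>space P. \<bar>g x\<bar> \<le> C"
  shows "integrable S\<^sub>n (\<lambda>s. (\<Sum>i<n. g (s i)) / n)"
    and "(\<integral>s. (\<Sum>i<n. g (s i)) / n \<partial>S\<^sub>n) = expectation g"
proof -
  have bnd: "\<bar>g x\<bar> \<le> C" if "x \<in> space P" for x using range that by blast
  have comp: "(\<lambda>s. g (s i)) \<in> borel_measurable S\<^sub>n" if "i < n" for i
    using that by (intro measurable_compose[OF _ g] measurable_component_singleton) auto
  have ci: "integrable S\<^sub>n (\<lambda>s. g (s i))" if "i < n" for i
  proof (rule S.integrable_const_bound[OF _ comp[OF that], of C])
    show "AE s in S\<^sub>n. norm (g (s i)) \<le> C"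
      using that by (intro AE_I2) (auto simp: space_PiM intro!: bnd)
  qed
  show "integrable S\<^sub>n (\<lambda>s. (\<Sum>i<n. g (s i)) / n)"
    using ci by (intro integrable_divide_zero Bochner_Integration.integrable_sum) auto
  have mean: "(\<integral>s. g (s i) \<partial>S\<^sub>n) = expectation g" if "i < n" for i
  proof -
    have "(\<integral>s. g (s i) \<partial>S\<^sub>n) = (\<integral>x. g x \<partial>distr S\<^sub>n P (\<lambda>s. s i))"
      using that by (subst integral_distr) auto
    also have "distr S\<^sub>n P (\<lambda>s. s i) = P"
      using that by (intro distr_PiM_component) (auto intro: prob_space_axioms)
    finally show ?thesis .
  qed
  have "(\<integral>s. (\<Sum>i<n. g (s i)) / n \<partial>S\<^sub>n) = (\<Sum>i<n. (\<integral>s. g (s i) \<partial>S\<^sub>n)) / n"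
  proof -
    have "(\<integral>s. (\<Sum>i<n. g (s i)) \<partial>S\<^sub>n) = (\<Sum>i<n. (\<integral>s. g (s i) \<partial>S\<^sub>n))"
      using ci by (intro Bochner_Integration.integral_sum) auto
    then show ?thesis by simp
  qed
  also have "(\<Sum>i<n. (\<integral>s. g (s i) \<partial>S\<^sub>n)) = (\<Sum>i<n. expectation g)"
    by (intro sum.cong refl mean) simp
  finally show "(\<integral>s. (\<Sum>i<n. g (s i)) / n \<partial>S\<^sub>n) = expectation g" using n_pos by simp
qed

lemma emp_value_nonneg:
  assumes "s \<in> space S\<^sub>n" "divergence_fun \<phi>" "divergence_fun \<psi>" "0 \<le> lam" "0 \<le> \<rho>"
  shows "0 \<le> emp_value \<phi> \<psi> \<rho> lam s"
  unfolding emp_value_def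
  using Z_component_range[OF assms(1)] assms
  by (intro dro_value_bounds(1)[OF U.prob_space_axioms, of _ B]) (auto simp: space_uniform_count_measure)

lemma chi2_weight_bounds:
  assumes lam: "0 < lam" and \<eta>: "0 \<le> \<eta>" "\<eta> \<le> B" and z: "0 \<le> z" "z \<le> B"
  shows "0 \<le> chi2_weight lam \<eta> z" "chi2_weight lam \<eta> z \<le> 1 + B / lam" "\<bar>chi2_weight lam \<eta> z - 1\<bar> \<le> B / lam"
    and "chi2_weight lam \<eta> z * z = chi2_weight lam \<eta> z * \<eta> + lam * ((chi2_weight lam \<eta> z)\<^sup>2 - chi2_weight lam \<eta> z)"
proof -
  have le: "(z - \<eta>) / lam \<le> B / lam" "- (B / lam) \<le> (z - \<eta>) / lam"
    using lam \<eta> z divide_right_mono[of "z - \<eta>" B lam] divide_right_mono[of "- B" "z - \<eta>" lam] by auto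
  have B: "0 \<le> B / lam" using lam B_nonneg by simp
  show "0 \<le> chi2_weight lam \<eta> z" by (simp add: chi2_weight_def)
  show "chi2_weight lam \<eta> z \<le> 1 + B / lam" "\<bar>chi2_weight lam \<eta> z - 1\<bar> \<le> B / lam"
    using le B by (auto simp: chi2_weight_def max_def abs_le_iff)
  show "chi2_weight lam \<eta> z * z = chi2_weight lam \<eta> z * \<eta> + lam * ((chi2_weight lam \<eta> z)\<^sup>2 - chi2_weight lam \<eta> z)"
  proof (cases "0 \<le> 1 + (z - \<eta>) / lam")
    case True
    define r where "r = 1 + (z - \<eta>) / lam"
    have "z - \<eta> = lam * (r - 1)" using lam by (simp add: r_def)
    then have "r * (z - \<eta>) = r * (lam * (r - 1))" by simp
    moreover have "chi2_weight lam \<eta> z = r" using True by (simp add: chi2_weight_def r_def)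
    ultimately show ?thesis by (simp add: algebra_simps power2_eq_square)
  qed (simp add: chi2_weight_def max_def)
qed

text \<open>
  The mean weight is continuous in \<open>\<eta>\<close>, at least \<open>1\<close> for \<open>\<eta> = 0\<close> and at most \<open>1\<close> for \<open>\<eta> = B\<close>.
\<close>
lemma chi2_multiplier_exists:
  assumes lam: "0 < lam"
  shows "\<exists>\<eta>. 0 \<le> \<eta> \<and> \<eta> \<le> B \<and> expectation (\<lambda>x. chi2_weight lam \<eta> (Z x)) = 1"
proof -
  define m where "m \<eta> = expectation (\<lambda>x. chi2_weight lam \<eta> (Z x))" for \<eta>
  have wm: "(\<lambda>x. chi2_weight lam \<eta> (Z x)) \<in> borel_measurable P" for \<eta>
    unfolding chi2_weight_def by measurable
  have wi: "integrable P (\<lambda>x. chi2_weight lam \<eta> (Z x))" for \<eta>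
  proof (rule integrable_const_bound[OF _ wm, of _ "1 + (B + \<bar>\<eta>\<bar>) / lam"])
    show "AE x in P. norm (chi2_weight lam \<eta> (Z x)) \<le> 1 + (B + \<bar>\<eta>\<bar>) / lam"
    proof (rule AE_I2)
      fix x assume "x \<in> space P"
      then have "(Z x - \<eta>) / lam \<le> (B + \<bar>\<eta>\<bar>) / lam" "0 \<le> (B + \<bar>\<eta>\<bar>) / lam"
        using Z_range[of x] lam by (auto intro!: divide_right_mono)
      then show "norm (chi2_weight lam \<eta> (Z x)) \<le> 1 + (B + \<bar>\<eta>\<bar>) / lam"
        by (simp add: chi2_weight_def)
    qed
  qed
  have lip: "\<bar>m a - m b\<bar> \<le> \<bar>a - b\<bar> / lam" for a b
  proof -
    have "\<bar>m a - m b\<bar> = \<bar>expectation (\<lambda>x. chi2_weight lam a (Z x) - chi2_weight lam b (Z x))\<bar>"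
      unfolding m_def using wi by simp
    also have "\<dots> \<le> expectation (\<lambda>x. \<bar>chi2_weight lam a (Z x) - chi2_weight lam b (Z x)\<bar>)"
      by (rule integral_abs_bound)
    also have "\<dots> \<le> expectation (\<lambda>x. \<bar>a - b\<bar> / lam)"
    proof (intro integral_mono)
      fix x
      have "\<bar>max 0 u - max 0 v\<bar> \<le> \<bar>u - v\<bar>" for u v :: real by (simp add: max_def)
      then have "\<bar>chi2_weight lam a (Z x) - chi2_weight lam b (Z x)\<bar> \<le> \<bar>(1 + (Z x - a) / lam) - (1 + (Z x - b) / lam)\<bar>"
        unfolding chi2_weight_def .
      also have "(1 + (Z x - a) / lam) - (1 + (Z x - b) / lam) = (b - a) / lam"
        by (simp add: diff_divide_distrib)
      also have "\<bar>(b - a) / lam\<bar> = \<bar>a - b\<bar> / lam" using lam by (simp add: abs_minus_commute)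
      finally show "\<bar>chi2_weight lam a (Z x) - chi2_weight lam b (Z x)\<bar> \<le> \<bar>a - b\<bar> / lam" .
    qed (use wi in auto)
    finally show ?thesis by (simp add: prob_space)
  qed
  have "continuous_on {0..B} m"
    using lip lam
    by (intro lipschitz_on_continuous_on[of "1 / lam"] lipschitz_onI) (auto simp: dist_real_def)
  moreover have "m B \<le> 1"
  proof -
    have "chi2_weight lam B (Z x) \<le> 1" if "x \<in> space P" for x
      using Z_range[OF that] lam by (simp add: chi2_weight_def divide_nonpos_pos)
    then have "m B \<le> expectation (\<lambda>x. 1)" unfolding m_def using wi by (intro integral_mono) auto
    then show ?thesis by (simp add: prob_space)
  qed
  moreover have "1 \<le> m 0"
  proof -
    have "1 \<le> chi2_weight lam 0 (Z x)" if "x \<in> space P" for x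
      using Z_range[OF that] lam by (simp add: chi2_weight_def le_max_iff_disj)
    then have "expectation (\<lambda>x. 1) \<le> m 0" unfolding m_def using wi by (intro integral_mono) auto
    then show ?thesis by (simp add: prob_space)
  qed
  ultimately obtain \<eta> where "0 \<le> \<eta>" "\<eta> \<le> B" "m \<eta> = 1"
    using IVT2'[of m B 1 0] B_nonneg by blast
  then show ?thesis by (auto simp: m_def)
qed

text \<open>
  Weak duality: the Lagrangian is maximised pointwise by \<open>chi2_weight\<close>.
\<close>
lemma chi2_pen_value_le_dual:
  assumes lam: "0 < lam" and wi: "integrable P (\<lambda>x. (chi2_weight lam \<eta> (Z x))\<^sup>2)"
  shows "dro_value (\<lambda>_. 0) chi2_fun 0 lam P Z
    \<le> ereal (\<eta> - lam / 2 + lam / 2 * expectation (\<lambda>x. (chi2_weight lam \<eta> (Z x))\<^sup>2))"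
  unfolding dro_value_def
proof (rule SUP_least)
  fix f assume "f \<in> {f \<in> densities P. density_div (\<lambda>_. 0) P f \<le> ereal 0}"
  then have f: "f \<in> densities P" by simp
  note [measurable] = densitiesD(1)[OF f]
  let ?w = "\<lambda>x. chi2_weight lam \<eta> (Z x)"
  show "ereal (\<integral>x. f x * Z x \<partial>P) - ereal lam * density_div chi2_fun P f
      \<le> ereal (\<eta> - lam / 2 + lam / 2 * expectation (\<lambda>x. (?w x)\<^sup>2))"
  proof (cases "integrable P (\<lambda>x. (f x - 1)\<^sup>2)")
    case False
    then show ?thesis using lam by (simp add: density_div_chi2_infinite)
  next
    case True
    have pw: "f x * Z x - lam / 2 * (f x - 1)\<^sup>2 \<le> \<eta> * f x + lam / 2 * ((?w x)\<^sup>2 - 1)" for x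
    proof -
      define y where "y = 1 + (Z x - \<eta>) / lam"
      have z: "Z x = \<eta> + lam * (y - 1)" using lam by (simp add: y_def)
      have "f x * y \<le> f x * ?w x" using densitiesD(2)[OF f] by (intro mult_left_mono) (auto simp: chi2_weight_def y_def)
      moreover have "2 * (f x * ?w x) \<le> (f x)\<^sup>2 + (?w x)\<^sup>2" using sum_squares_bound[of "f x" "?w x"] by simp
      ultimately have "2 * (f x * y) - (f x)\<^sup>2 \<le> (?w x)\<^sup>2" by simp
      then have "lam / 2 * (2 * (f x * y) - (f x)\<^sup>2) \<le> lam / 2 * (?w x)\<^sup>2"
        using lam by (intro mult_left_mono) auto
      then show ?thesis unfolding z by (simp add: algebra_simps power2_eq_square)
    qed
    have i1: "integrable P (\<lambda>x. f x * Z x)"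
      using Z_range by (intro integrable_mult_bounded[of _ _ _ B] densitiesD(3)[OF f]) auto
    have "(\<integral>x. f x * Z x \<partial>P) - lam / 2 * (\<integral>x. (f x - 1)\<^sup>2 \<partial>P) = (\<integral>x. f x * Z x - lam / 2 * (f x - 1)\<^sup>2 \<partial>P)"
      using i1 True by simp
    also have "\<dots> \<le> (\<integral>x. \<eta> * f x + lam / 2 * ((?w x)\<^sup>2 - 1) \<partial>P)"
      using i1 True wi densitiesD(3)[OF f] pw by (intro integral_mono) auto
    also have "\<dots> = \<eta> - lam / 2 + lam / 2 * expectation (\<lambda>x. (?w x)\<^sup>2)"
      using wi densitiesD(3,4)[OF f] by (simp add: prob_space algebra_simps)
    finally show ?thesis using True by (simp add: density_div_chi2)
  qed
qed

text \<open>
  The left-hand side is the dual objective of the sample at \<open>\<eta>\<close>, less a quadratic correction. If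
  \<open>m \<ge> 1 / 2\<close>, the weights divided by \<open>m\<close> are feasible, and the duality gap is
  \<open>lam / 2 * q / m\<^sup>2 * (m - 1)\<^sup>2\<close>, where \<open>q \<le> (1 + B / lam) * m\<close>. If \<open>m < 1 / 2\<close>, the correction is at
  least the whole dual objective, and the empirical objective is nonnegative.
\<close>
lemma emp_chi2_pen_ge:
  assumes lam: "0 < lam" and \<eta>: "0 \<le> \<eta>" "\<eta> \<le> B" and s: "s \<in> space S\<^sub>n"
  defines "m \<equiv> (\<Sum>i<n. chi2_weight lam \<eta> (Z (s i))) / n"
    and "q \<equiv> (\<Sum>i<n. (chi2_weight lam \<eta> (Z (s i)))\<^sup>2) / n"
  shows "ereal (\<eta> - lam / 2 + lam / 2 * q - 5 * (lam + B) * (m - 1)\<^sup>2)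
    \<le> emp_value (\<lambda>_. 0) chi2_fun 0 lam s"
proof -
  define w where "w i = chi2_weight lam \<eta> (Z (s i))" for i
  have w0: "0 \<le> w i" for i by (simp add: w_def chi2_weight_def)
  have w: "w i \<le> 1 + B / lam" "w i * Z (s i) = w i * \<eta> + lam * ((w i)\<^sup>2 - w i)" if "i < n" for i
    using chi2_weight_bounds[OF lam \<eta>, of "Z (s i)"] Z_component_range[OF s that] by (auto simp: w_def)
  have m: "(\<Sum>i<n. w i) = n * m" and q: "(\<Sum>i<n. (w i)\<^sup>2) = n * q"
    using n_pos by (simp_all add: m_def q_def w_def)
  have qm: "q \<le> (1 + B / lam) * m"
  proof -
    have "n * q \<le> (\<Sum>i<n. (1 + B / lam) * w i)"
      unfolding q[symmetric] power2_eq_square using w(1) w0 by (intro sum_mono mult_right_mono) auto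
    also have "\<dots> = n * ((1 + B / lam) * m)" by (simp only: sum_distrib_left[symmetric] m) simp
    finally show ?thesis using n_pos by simp
  qed
  show ?thesis
  proof (cases "1 / 2 \<le> m")
    case True
    then have mp: "0 < m" by simp
    define v where "v i = w i / m" for i
    have v: "v \<in> densities U\<^sub>n" using w0 mp m by (simp add: densities_U v_def sum_divide_distrib[symmetric])
    have vz: "(\<integral>i. v i * Z (s i) \<partial>U\<^sub>n) = \<eta> + lam * (q / m - 1)"
    proof -
      have "(\<Sum>i<n. v i * Z (s i)) = (\<Sum>i<n. w i * \<eta> + lam * ((w i)\<^sup>2 - w i)) / m"
        unfolding sum_divide_distrib using w(2) by (intro sum.cong refl) (simp add: v_def)
      also have "(\<Sum>i<n. w i * \<eta> + lam * ((w i)\<^sup>2 - w i)) = n * m * \<eta> + lam * (n * q - n * m)"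
        by (simp add: sum.distrib sum_subtractf flip: sum_distrib_right sum_distrib_left m q)
      finally show ?thesis using n_pos mp unfolding integral_U by (simp add: field_simps)
    qed
    have vv: "(\<integral>i. (v i - 1)\<^sup>2 \<partial>U\<^sub>n) = q / m\<^sup>2 - 1"
    proof -
      have "(\<Sum>i<n. (v i - 1)\<^sup>2) = (\<Sum>i<n. (w i)\<^sup>2 / m\<^sup>2 - 2 / m * w i + 1)"
        using mp by (intro sum.cong refl) (simp add: v_def power2_eq_square field_simps)
      also have "\<dots> = n * q / m\<^sup>2 - 2 / m * (n * m) + n"
        by (simp add: sum.distrib sum_subtractf flip: sum_distrib_left sum_divide_distrib m q)
      finally show ?thesis using n_pos mp unfolding integral_U by (simp add: field_simps)
    qed
    have "ereal (\<integral>i. v i * Z (s i) \<partial>U\<^sub>n) - ereal lam * density_div chi2_fun U\<^sub>n v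
        \<le> emp_value (\<lambda>_. 0) chi2_fun 0 lam s"
      unfolding emp_value_def dro_value_def
      using v by (intro SUP_upper) (simp add: density_div_def eintegral_def zero_ennreal.rep_eq)
    then have V: "ereal (\<eta> + lam * (q / m - 1) - lam * ((q / m\<^sup>2 - 1) / 2)) \<le> emp_value (\<lambda>_. 0) chi2_fun 0 lam s"
      by (simp add: density_div_chi2 integrable_U vz vv)
    have "\<eta> - lam / 2 + lam / 2 * q - (\<eta> + lam * (q / m - 1) - lam * ((q / m\<^sup>2 - 1) / 2))
        = lam / 2 * (q / m\<^sup>2) * (m - 1)\<^sup>2"
      using mp by (simp add: field_simps power2_eq_square)
    also have "\<dots> \<le> (lam + B) * (m - 1)\<^sup>2"
    proof (rule mult_right_mono)
      have "q / m\<^sup>2 \<le> (1 + B / lam) * m / m\<^sup>2" using qm by (intro divide_right_mono) auto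
      also have "\<dots> = (1 + B / lam) * (1 / m)" using mp by (simp add: power2_eq_square)
      also have "\<dots> \<le> (1 + B / lam) * 2"
        using True mp lam B_nonneg by (intro mult_left_mono) (auto simp: field_simps)
      finally have "lam / 2 * (q / m\<^sup>2) \<le> lam / 2 * ((1 + B / lam) * 2)" using lam by (intro mult_left_mono) auto
      also have "\<dots> = lam + B" using lam by (simp add: field_simps)
      finally show "lam / 2 * (q / m\<^sup>2) \<le> lam + B" .
    qed simp
    also have "\<dots> \<le> 5 * (lam + B) * (m - 1)\<^sup>2" using lam B_nonneg by (intro mult_right_mono) auto
    finally have "\<eta> - lam / 2 + lam / 2 * q - 5 * (lam + B) * (m - 1)\<^sup>2
        \<le> \<eta> + lam * (q / m - 1) - lam * ((q / m\<^sup>2 - 1) / 2)" by simp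
    then have "ereal (\<eta> - lam / 2 + lam / 2 * q - 5 * (lam + B) * (m - 1)\<^sup>2)
        \<le> ereal (\<eta> + lam * (q / m - 1) - lam * ((q / m\<^sup>2 - 1) / 2))" by simp
    from order_trans[OF this V] show ?thesis .
  next
    case False
    have "(1 / 2)\<^sup>2 \<le> (1 - m)\<^sup>2" using False by (intro power_mono) auto
    then have "1 / 4 \<le> (m - 1)\<^sup>2" unfolding power2_commute[of 1 m] by (simp add: power_divide)
    then have "5 * (lam + B) * (1 / 4) \<le> 5 * (lam + B) * (m - 1)\<^sup>2"
      using lam B_nonneg by (intro mult_left_mono) auto
    moreover have "lam / 2 * q \<le> lam / 2 * ((1 + B / lam) * (1 / 2))"
    proof (rule mult_left_mono)
      have "(1 + B / lam) * m \<le> (1 + B / lam) * (1 / 2)" using False lam B_nonneg by (intro mult_left_mono) auto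
      with qm show "q \<le> (1 + B / lam) * (1 / 2)" by linarith
    qed (use lam in simp)
    moreover have "lam / 2 * ((1 + B / lam) * (1 / 2)) = lam / 4 + B / 4" using lam by (simp add: field_simps)
    ultimately have "\<eta> - lam / 2 + lam / 2 * q - 5 * (lam + B) * (m - 1)\<^sup>2 \<le> 0" using \<eta> lam by (simp add: algebra_simps)
    then have "ereal (\<eta> - lam / 2 + lam / 2 * q - 5 * (lam + B) * (m - 1)\<^sup>2) \<le> 0" by simp
    also have "0 \<le> emp_value (\<lambda>_. 0) chi2_fun 0 lam s"
      using lam by (intro emp_value_nonneg s divergence_fun_zero divergence_fun_chi2) auto
    finally show ?thesis .
  qed
qed

text \<open>
  Taking expectations in \<open>emp_chi2_pen_ge\<close> at the optimal \<open>\<eta>\<close>, the dual objective becomes the upper bound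
  of \<open>chi2_pen_value_le_dual\<close>, and the correction becomes \<open>5 * (lam + B) * v / n\<close> with \<open>v\<close> the variance of
  the weight. The two bounds \<open>v \<le> B / lam\<close> and \<open>v \<le> (B / lam)\<^sup>2\<close> handle small and large \<open>lam\<close>.
\<close>
lemma chi2_pen_bias:
  assumes lam: "0 < lam"
  shows "dro_value (\<lambda>_. 0) chi2_fun 0 lam P Z
    \<le> expected_emp_value (\<lambda>_. 0) chi2_fun 0 lam + ereal (10 * B\<^sup>2 / (lam * n))"
proof -
  obtain \<eta> where \<eta>: "0 \<le> \<eta>" "\<eta> \<le> B" and E1: "expectation (\<lambda>x. chi2_weight lam \<eta> (Z x)) = 1"
    using chi2_multiplier_exists[OF lam] by blast
  define w where "w x = chi2_weight lam \<eta> (Z x)" for x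
  have wm[measurable]: "w \<in> borel_measurable P" unfolding w_def chi2_weight_def by measurable
  have wb: "0 \<le> w x" "w x \<le> 1 + B / lam" "\<bar>w x - 1\<bar> \<le> B / lam" if "x \<in> space P" for x
    using chi2_weight_bounds(1-3)[OF lam \<eta>, of "Z x"] Z_range[OF that] by (auto simp: w_def)
  have Bl: "0 \<le> B / lam" using lam B_nonneg by simp
  have sb: "(w x)\<^sup>2 \<le> (1 + B / lam) * w x" if "x \<in> space P" for x
    unfolding power2_eq_square using wb[OF that] by (intro mult_right_mono) auto
  have sb2: "\<bar>(w x)\<^sup>2\<bar> \<le> (1 + B / lam) * (1 + B / lam)" if "x \<in> space P" for x
  proof -
    have "(1 + B / lam) * w x \<le> (1 + B / lam) * (1 + B / lam)" using wb[OF that] Bl by (intro mult_left_mono) auto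
    with sb[OF that] show ?thesis by simp
  qed
  have i1: "integrable P w" using wb Bl by (intro integrable_const_bound[of _ "1 + B / lam"] AE_I2) auto
  have i2: "integrable P (\<lambda>x. (w x)\<^sup>2)"
    using sb2 by (intro integrable_const_bound[of _ "(1 + B / lam) * (1 + B / lam)"] AE_I2) auto
  have Ew: "expectation w = 1" using E1 by (simp add: w_def[abs_def])
  define v where "v = expectation (\<lambda>x. (w x - 1)\<^sup>2)"
  have v1: "v = expectation (\<lambda>x. (w x)\<^sup>2) - 1"
  proof -
    have "v = expectation (\<lambda>x. (w x)\<^sup>2 - 2 * w x + 1)" unfolding v_def by (simp add: power2_diff algebra_simps)
    also have "\<dots> = expectation (\<lambda>x. (w x)\<^sup>2) - 2 * expectation w + 1" using i1 i2 by (simp add: prob_space)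
    finally show ?thesis using Ew by simp
  qed
  have vB: "v \<le> B / lam"
  proof -
    have "expectation (\<lambda>x. (w x)\<^sup>2) \<le> expectation (\<lambda>x. (1 + B / lam) * w x)"
      using i1 i2 sb by (intro integral_mono) auto
    then show ?thesis using v1 Ew by simp
  qed
  have i3: "integrable P (\<lambda>x. (w x - 1)\<^sup>2)" using i1 i2 by (simp add: power2_diff)
  have vB2: "v \<le> (B / lam)\<^sup>2"
  proof -
    have "(w x - 1)\<^sup>2 \<le> (B / lam)\<^sup>2" if "x \<in> space P" for x
      using power_mono[OF wb(3)[OF that], of 2] by simp
    then have "v \<le> expectation (\<lambda>x. (B / lam)\<^sup>2)"
      unfolding v_def using i3 by (intro integral_mono) auto
    then show ?thesis by (simp add: prob_space)
  qed
  have err: "5 * (lam + B) * (v / n) \<le> 10 * B\<^sup>2 / (lam * n)"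
  proof -
    have v0: "0 \<le> v" unfolding v_def by (intro integral_nonneg_AE AE_I2) simp
    have "(lam + B) * v \<le> 2 * (B\<^sup>2 / lam)"
    proof (cases "B \<le> lam")
      case True
      have "(lam + B) * v \<le> (2 * lam) * v" using True v0 by (intro mult_right_mono) auto
      also have "\<dots> \<le> (2 * lam) * (B / lam)\<^sup>2" using vB2 lam by (intro mult_left_mono) auto
      also have "\<dots> = 2 * (B\<^sup>2 / lam)" using lam by (simp add: power2_eq_square)
      finally show ?thesis .
    next
      case False
      have "(lam + B) * v \<le> (2 * B) * v" using False v0 by (intro mult_right_mono) auto
      also have "\<dots> \<le> (2 * B) * (B / lam)" using vB B_nonneg by (intro mult_left_mono) auto
      finally show ?thesis by (simp add: power2_eq_square)
    qed
    then have "5 * ((lam + B) * v) / n \<le> 5 * (2 * (B\<^sup>2 / lam)) / n"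
      by (intro divide_right_mono mult_left_mono) auto
    moreover have "5 * (lam + B) * (v / n) = 5 * ((lam + B) * v) / n" by (simp only: mult.assoc times_divide_eq_right)
    moreover have "5 * (2 * (B\<^sup>2 / lam)) / n = 10 * B\<^sup>2 / (lam * n)" by simp
    ultimately show ?thesis by (simp only:)
  qed
  define h where "h s = \<eta> - lam / 2 + lam / 2 * ((\<Sum>i<n. (w (s i))\<^sup>2) / n) - 5 * (lam + B) * ((\<Sum>i<n. w (s i) - 1) / n)\<^sup>2" for s
  have wm1: "(\<lambda>x. w x - 1) \<in> borel_measurable P" and wm2: "(\<lambda>x. (w x)\<^sup>2) \<in> borel_measurable P" by measurable
  have E0: "expectation (\<lambda>x. w x - 1) = 0" using i1 Ew by (simp add: prob_space)
  have "\<forall>x\<in>space P. \<bar>w x - 1\<bar> \<le> B / lam" using wb(3) by blast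
  note var = expectation_square_sample_mean[OF wm1 this E0]
  have "\<forall>x\<in>space P. \<bar>(w x)\<^sup>2\<bar> \<le> (1 + B / lam) * (1 + B / lam)" using sb2 by blast
  note sm = expectation_sample_mean[OF wm2 this]
  have gen: "integrable S\<^sub>n (\<lambda>s. k + c * a s - d * b s)"
      "(\<integral>s. k + c * a s - d * b s \<partial>S\<^sub>n) = k + c * integral\<^sup>L S\<^sub>n a - d * integral\<^sup>L S\<^sub>n b"
    if "integrable S\<^sub>n a" "integrable S\<^sub>n b" for k c d :: real and a b
    using that by (simp_all add: S.prob_space)
  have hi: "integrable S\<^sub>n h" unfolding h_def by (rule gen(1)[OF sm(1) var(1)])
  have Eh: "(\<integral>s. h s \<partial>S\<^sub>n) = \<eta> - lam / 2 + lam / 2 * expectation (\<lambda>x. (w x)\<^sup>2) - 5 * (lam + B) * (v / n)"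
    unfolding h_def v_def gen(2)[OF sm(1) var(1)] sm(2) var(2) ..
  have hs: "ereal (h s) \<le> emp_value (\<lambda>_. 0) chi2_fun 0 lam s" if "s \<in> space S\<^sub>n" for s
  proof -
    have "(\<Sum>i<n. w (s i) - 1) / n = (\<Sum>i<n. w (s i)) / n - 1"
      using n_pos by (simp add: sum_subtractf diff_divide_distrib)
    then show ?thesis using emp_chi2_pen_ge[OF lam \<eta> that] by (simp add: h_def w_def)
  qed
  have "dro_value (\<lambda>_. 0) chi2_fun 0 lam P Z \<le> ereal (\<eta> - lam / 2 + lam / 2 * expectation (\<lambda>x. (w x)\<^sup>2))"
    unfolding w_def by (rule chi2_pen_value_le_dual[OF lam]) (use i2 in \<open>simp add: w_def\<close>)
  also have "\<dots> \<le> ereal (integral\<^sup>L S\<^sub>n h) + ereal (10 * B\<^sup>2 / (lam * n))"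
    using err by (simp add: Eh)
  also have "\<dots> \<le> expected_emp_value (\<lambda>_. 0) chi2_fun 0 lam + ereal (10 * B\<^sup>2 / (lam * n))"
    unfolding expected_emp_value_def by (rule add_right_mono, rule nn_integral_ge[OF hi], rule hs)
  finally show ?thesis .
qed

end

section \<open>The four bounds\<close>

lemma minibatch_cong:
  assumes "\<And>s. s \<in> space (Pi\<^sub>M {..<n} (\<lambda>_. P)) \<Longrightarrow> L (empirical P n s) = L' (empirical P n s)"
  shows "minibatch L P n = minibatch L' P n"
  unfolding minibatch_def eintegral_def
  using assms by (intro arg_cong2[where f="(-)"] arg_cong[where f=enn2ereal] nn_integral_cong) auto

text \<open>
  The tail is at most \<open>1\<close> and at most \<open>(1 - c) / \<alpha>\<close>, hence at most the geometric mean of the two.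
\<close>
lemma tail_le_of_cvar:
  assumes \<alpha>: "0 < \<alpha>" and r: "r \<in> densities unit_measure"
    and div: "density_div (cvar_fun \<alpha>) unit_measure r \<le> ereal 0" and c: "0 \<le> c" "c \<le> 1"
  shows "tail r c \<le> 1 / sqrt \<alpha> * sqrt (1 - c)"
proof -
  note [measurable] = densitiesD(1)[OF r]
  have neg: "e2ennreal (- cvar_fun \<alpha> t) = 0" and pos: "e2ennreal (cvar_fun \<alpha> t) = (if t \<le> 1 / \<alpha> then 0 else \<infinity>)" for t
    by (auto simp: cvar_fun_def e2ennreal_neg)
  have "enn2ereal (\<integral>\<^sup>+u. (if r u \<le> 1 / \<alpha> then 0 else \<infinity>) \<partial>unit_measure) \<le> 0"
    using div by (simp add: density_div_def eintegral_def neg pos zero_ennreal.rep_eq flip: zero_ereal_def)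
  then have "(\<integral>\<^sup>+u. (if r u \<le> 1 / \<alpha> then 0 else \<infinity>) \<partial>unit_measure) = 0"
    by (metis antisym enn2ereal_nonneg zero_ennreal.rep_eq enn2ereal_inject)
  then have AE: "AE u in unit_measure. r u \<le> 1 / \<alpha>"
    by (subst (asm) nn_integral_0_iff_AE) (auto elim: eventually_mono split: if_splits)
  note ind = integrable_indicator_greaterThan
  have "tail r c \<le> (\<integral>u. 1 / \<alpha> * indicator {c<..} u \<partial>unit_measure)"
    unfolding tail_def
  proof (rule integral_mono_AE)
    show "AE u in unit_measure. r u * indicator {c<..} u \<le> 1 / \<alpha> * indicator {c<..} u"
      using AE by eventually_elim (auto split: split_indicator)
    show "integrable unit_measure (\<lambda>u. r u * indicator {c<..} u)"
      by (rule integrable_mult_indicator_greaterThan[OF densitiesD(3)[OF r]])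
  qed (use ind in auto)
  also have "\<dots> = (1 - c) / \<alpha>"
    unfolding integral_mult_right_zero integral_indicator_greaterThan[OF c] by simp
  finally have le: "tail r c \<le> (1 - c) / \<alpha>" .
  have "tail r c * tail r c \<le> 1 * ((1 - c) / \<alpha>)"
    using le tail_le_1[OF r c(1)] tail_nonneg[OF r] by (intro mult_mono) auto
  then have "tail r c \<le> sqrt ((1 - c) / \<alpha>)"
    by (intro real_le_rsqrt) (simp add: power2_eq_square)
  then show ?thesis by (simp add: real_sqrt_divide)
qed

text \<open>
  The Cauchy-Schwarz inequality, as the arithmetic-geometric mean inequality with the optimal weight
  \<open>\<theta>\<close>; the square of the density integrates to at most \<open>1 + 2 * \<rho>\<close>.
\<close>
lemma tail_le_of_chi2:
  assumes \<rho>: "0 \<le> \<rho>" and r: "r \<in> densities unit_measure"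
    and div: "density_div chi2_fun unit_measure r \<le> ereal \<rho>" and c: "0 \<le> c" "c \<le> 1"
  shows "tail r c \<le> sqrt (1 + 2 * \<rho>) * sqrt (1 - c)"
proof (cases "c = 1")
  case True
  then show ?thesis by (simp add: tail_1)
next
  case False
  note [measurable] = densitiesD(1)[OF r]
  have i: "integrable unit_measure (\<lambda>u. (r u - 1)\<^sup>2)"
  proof (rule ccontr)
    assume "\<not> ?thesis"
    then have "density_div chi2_fun unit_measure r = \<infinity>" by (intro density_div_chi2_infinite) auto
    with div show False by simp
  qed
  have ir: "integrable unit_measure r" by (rule densitiesD(3)[OF r])
  have eq: "(r u)\<^sup>2 = (r u - 1)\<^sup>2 + (2 * r u - 1)" for u by (simp add: power2_diff)
  have i2: "integrable unit_measure (\<lambda>u. (r u)\<^sup>2)" unfolding eq using i ir by simp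
  have "(\<integral>u. (r u)\<^sup>2 \<partial>unit_measure) = (\<integral>u. (r u - 1)\<^sup>2 \<partial>unit_measure) + 1"
    unfolding eq using i ir densitiesD(4)[OF r] by (simp add: unit.prob_space[unfolded space_unit])
  then have sq: "(\<integral>u. (r u)\<^sup>2 \<partial>unit_measure) \<le> 1 + 2 * \<rho>"
    using div unfolding density_div_chi2[OF i] by simp
  define \<theta> where "\<theta> = sqrt ((1 - c) / (1 + 2 * \<rho>))"
  have p: "0 < 1 - c" "0 < 1 + 2 * \<rho>" using False c \<rho> by auto
  have \<theta>: "0 < \<theta>" using p by (simp add: \<theta>_def)
  note ind = integrable_indicator_greaterThan
  have pw: "r u * indicator {c<..} u \<le> \<theta> / 2 * (r u)\<^sup>2 + 1 / (2 * \<theta>) * indicator {c<..} u" for u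
  proof -
    have "0 \<le> (\<theta> * r u - 1)\<^sup>2 / (2 * \<theta>)" using \<theta> by simp
    also have "\<dots> = \<theta> / 2 * (r u)\<^sup>2 + 1 / (2 * \<theta>) - r u" using \<theta> by (simp add: field_simps power2_eq_square)
    finally show ?thesis using \<theta> by (auto split: split_indicator)
  qed
  have "tail r c \<le> (\<integral>u. \<theta> / 2 * (r u)\<^sup>2 + 1 / (2 * \<theta>) * indicator {c<..} u \<partial>unit_measure)"
    unfolding tail_def using pw i2 ind
    by (intro integral_mono integrable_mult_indicator_greaterThan ir) auto
  also have "\<dots> = \<theta> / 2 * (\<integral>u. (r u)\<^sup>2 \<partial>unit_measure) + 1 / (2 * \<theta>) * (\<integral>u. indicator {c<..} u \<partial>unit_measure)"
    by (subst Bochner_Integration.integral_add) (use i2 ind in \<open>auto simp del: integral_indicator\<close>)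
  also have "\<dots> \<le> \<theta> / 2 * (1 + 2 * \<rho>) + 1 / (2 * \<theta>) * (1 - c)"
    unfolding integral_indicator_greaterThan[OF c] using sq \<theta> by (intro add_mono mult_left_mono) auto
  also have "\<dots> = sqrt (1 + 2 * \<rho>) * sqrt (1 - c)"
  proof -
    define a where "a = sqrt (1 + 2 * \<rho>)"
    define b where "b = sqrt (1 - c)"
    have ab: "0 < a" "0 < b" "1 + 2 * \<rho> = a * a" "1 - c = b * b" using p by (auto simp: a_def b_def)
    have \<theta>_eq: "\<theta> = b / a" by (simp add: \<theta>_def a_def b_def real_sqrt_divide)
    have "b / a / 2 * (a * a) + 1 / (2 * (b / a)) * (b * b) = a * b" using ab(1,2) by (simp add: field_simps)
    then show ?thesis unfolding ab(3,4) \<theta>_eq using ab(1,2) by simp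
  qed
  finally show ?thesis .
qed

context loss_sample
begin

lemma empirical_measurable:
  assumes "s \<in> space S\<^sub>n"
  shows "s \<in> measurable U\<^sub>n P"
proof (rule measurableI)
  show "s i \<in> space P" if "i \<in> space U\<^sub>n" for i
    using assms that by (auto simp: space_uniform_count_measure space_PiM PiE_mem)
next
  show "s -` A \<inter> space U\<^sub>n \<in> sets U\<^sub>n" for A
    by (simp add: uniform_count_measure_def space_point_measure sets_point_measure)
qed

lemma prob_space_empirical:
  assumes "s \<in> space S\<^sub>n"
  shows "prob_space (empirical P n s)"
  unfolding empirical_def by (rule U.prob_space_distr[OF empirical_measurable[OF assms]])

lemma dro_objective_empirical:
  assumes s: "s \<in> space S\<^sub>n" and Z: "Z = loss x"
    and \<phi>: "divergence_fun \<phi>" and \<psi>: "divergence_fun \<psi>" and lam: "0 \<le> lam"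
  shows "dro_objective \<phi> \<psi> \<rho> lam loss x (empirical P n s) = emp_value \<phi> \<psi> \<rho> lam s"
proof -
  have "Z \<in> borel_measurable (empirical P n s)" by (simp add: empirical_def)
  then have "dro_objective \<phi> \<psi> \<rho> lam loss x (empirical P n s) = dro_value \<phi> \<psi> \<rho> lam (empirical P n s) Z"
    unfolding Z by (rule dro_objective_eq_dro_value[OF prob_space_empirical[OF s]])
  also have "\<dots> = emp_value \<phi> \<psi> \<rho> lam s"
    unfolding empirical_def emp_value_def
    by (rule dro_value_distr[OF U.prob_space_axioms empirical_measurable[OF s] Z_measurable \<phi> \<psi> lam])
  finally show ?thesis .
qed

lemma minibatch_dro_objective:
  assumes Z: "Z = loss x" and \<phi>: "divergence_fun \<phi>" and \<psi>: "divergence_fun \<psi>" and lam: "0 \<le> lam" and \<rho>: "0 \<le> \<rho>"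
  shows "minibatch (dro_objective \<phi> \<psi> \<rho> lam loss x) P n = expected_emp_value \<phi> \<psi> \<rho> lam"
proof -
  have eq: "dro_objective \<phi> \<psi> \<rho> lam loss x (empirical P n s) = emp_value \<phi> \<psi> \<rho> lam s" if "s \<in> space S\<^sub>n" for s
    by (rule dro_objective_empirical[where loss = loss and x = x, OF that Z \<phi> \<psi> lam])
  have 1: "(\<integral>\<^sup>+s. e2ennreal (dro_objective \<phi> \<psi> \<rho> lam loss x (empirical P n s)) \<partial>S\<^sub>n)
      = (\<integral>\<^sup>+s. e2ennreal (emp_value \<phi> \<psi> \<rho> lam s) \<partial>S\<^sub>n)"
    by (intro nn_integral_cong) (simp add: eq)
  have 2: "(\<integral>\<^sup>+s. e2ennreal (- dro_objective \<phi> \<psi> \<rho> lam loss x (empirical P n s)) \<partial>S\<^sub>n) = (\<integral>\<^sup>+s. 0 \<partial>S\<^sub>n)"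
    using emp_value_nonneg[OF _ \<phi> \<psi> lam \<rho>] by (intro nn_integral_cong) (simp add: eq e2ennreal_neg)
  show ?thesis unfolding minibatch_def eintegral_def expected_emp_value_def 1 2 by (simp add: zero_ennreal.rep_eq)
qed

lemma dro_gap:
  assumes Z: "Z = loss x" and \<phi>: "divergence_fun \<phi>" and \<psi>: "divergence_fun \<psi>" and lam: "0 \<le> lam" and \<rho>: "0 \<le> \<rho>"
  shows "0 \<le> dro_objective \<phi> \<psi> \<rho> lam loss x P - minibatch (dro_objective \<phi> \<psi> \<rho> lam loss x) P n"
    and "dro_objective \<phi> \<psi> \<rho> lam loss x P - minibatch (dro_objective \<phi> \<psi> \<rho> lam loss x) P n \<le> ereal B"
    and "dro_value \<phi> \<psi> \<rho> lam P Z \<le> expected_emp_value \<phi> \<psi> \<rho> lam + ereal e \<Longrightarrow>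
      dro_objective \<phi> \<psi> \<rho> lam loss x P - minibatch (dro_objective \<phi> \<psi> \<rho> lam loss x) P n \<le> ereal e"
proof -
  let ?L = "dro_value \<phi> \<psi> \<rho> lam P Z" and ?E = "expected_emp_value \<phi> \<psi> \<rho> lam"
  have L: "dro_objective \<phi> \<psi> \<rho> lam loss x P = ?L"
    unfolding Z by (rule dro_objective_eq_dro_value) (use prob_space_axioms Z_measurable Z in auto)
  have rng: "Z y \<in> {0..B}" if "y \<in> space P" for y using Z_range[OF that] by simp
  have b: "0 \<le> ?L" "?L \<le> ereal B"
    by (rule dro_value_bounds[OF prob_space_axioms Z_measurable rng \<phi> \<psi> lam \<rho>]; assumption)+
  then obtain l where l: "?L = ereal l" by (cases ?L) auto
  have "?E \<le> enn2ereal (e2ennreal ?L)"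
    using nn_integral_emp_value_le[OF \<phi> \<psi> lam \<rho>] by (simp add: expected_emp_value_def less_eq_ennreal.rep_eq)
  then have EL: "?E \<le> ereal l" using b by (simp add: enn2ereal_e2ennreal l)
  have E0: "0 \<le> ?E" by (simp add: expected_emp_value_def)
  with EL obtain v where v: "?E = ereal v" by (cases ?E) auto
  note eqs = L minibatch_dro_objective[where loss = loss and x = x, OF Z \<phi> \<psi> lam \<rho>] v l
  show "0 \<le> dro_objective \<phi> \<psi> \<rho> lam loss x P - minibatch (dro_objective \<phi> \<psi> \<rho> lam loss x) P n"
    unfolding eqs using EL unfolding v by simp
  show "dro_objective \<phi> \<psi> \<rho> lam loss x P - minibatch (dro_objective \<phi> \<psi> \<rho> lam loss x) P n \<le> ereal B"
    unfolding eqs using b E0 unfolding v l by simp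
  show "dro_objective \<phi> \<psi> \<rho> lam loss x P - minibatch (dro_objective \<phi> \<psi> \<rho> lam loss x) P n \<le> ereal e"
    if "?L \<le> ?E + ereal e"
    unfolding eqs using that unfolding v l by simp
qed

lemma cvar_gap:
  assumes Z: "Z = loss x" and \<alpha>: "0 < \<alpha>" "\<alpha> \<le> 1"
  shows "cvar_objective \<alpha> loss x P - minibatch (cvar_objective \<alpha> loss x) P n
    \<le> ereal (B * min 1 ((\<alpha> * real n) powr (- 1 / 2)))"
proof -
  let ?L = "dro_objective (cvar_fun \<alpha>) (\<lambda>_. 0) 0 0 loss x"
  have eq: "cvar_objective \<alpha> loss x P = ?L P"
    by (rule cvar_objective_eq_dro[OF prob_space_axioms \<alpha>(1)])
  have eqm: "minibatch (cvar_objective \<alpha> loss x) P n = minibatch ?L P n"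
    by (intro minibatch_cong cvar_objective_eq_dro prob_space_empirical \<alpha>)
  note div = divergence_fun_cvar[OF \<alpha>] divergence_fun_zero
  have "?L P - minibatch ?L P n \<le> ereal (B * (1 / sqrt \<alpha> / sqrt n))"
    using \<alpha> by (intro dro_gap(3)[where loss = loss and x = x, OF Z div] dro_value_le_of_bias_bound div bias_le_of_tail_bound tail_le_of_cvar) auto
  moreover have "1 / sqrt \<alpha> / sqrt n = (\<alpha> * real n) powr (- 1 / 2)"
  proof -
    have half: "- 1 / 2 = - (1 / 2 :: real)" by simp
    have "(\<alpha> * real n) powr (- 1 / 2) = inverse (sqrt (\<alpha> * real n))"
      unfolding half powr_minus using \<alpha> by (subst powr_half_sqrt) auto
    then show ?thesis by (simp only: real_sqrt_mult inverse_eq_divide divide_divide_eq_left)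
  qed
  moreover have "?L P - minibatch ?L P n \<le> ereal B" by (rule dro_gap(2)[where loss = loss and x = x, OF Z div]) auto
  ultimately show ?thesis unfolding eq eqm by (cases "1 \<le> (\<alpha> * real n) powr (- 1 / 2)") (simp_all only: min_def if_True if_False mult_1_right)
qed

lemma chi2_gap:
  assumes Z: "Z = loss x" and \<rho>: "0 \<le> \<rho>"
  shows "chi2_objective \<rho> loss x P - minibatch (chi2_objective \<rho> loss x) P n
    \<le> ereal (B * (sqrt (1 + 2 * \<rho>) / sqrt n))"
proof -
  let ?L = "dro_objective chi2_fun (\<lambda>_. 0) \<rho> 0 loss x"
  have eq: "chi2_objective \<rho> loss x = ?L" by (rule ext) (rule chi2_objective_eq_dro)
  note div = divergence_fun_chi2 divergence_fun_zero
  show ?thesis unfolding eq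
    using \<rho> by (intro dro_gap(3)[where loss = loss and x = x, OF Z div] dro_value_le_of_bias_bound div bias_le_of_tail_bound tail_le_of_chi2) auto
qed

lemma chi2_pen_gap:
  assumes Z: "Z = loss x" and lam: "0 < lam"
  shows "chi2_pen_objective lam loss x P - minibatch (chi2_pen_objective lam loss x) P n
    \<le> ereal (10 * B\<^sup>2 / (lam * n))"
proof -
  have eq: "chi2_pen_objective lam loss x = dro_objective (\<lambda>_. 0) chi2_fun 0 lam loss x"
    by (rule ext) (rule chi2_pen_objective_eq_dro)
  show ?thesis unfolding eq
    using lam by (intro dro_gap(3)[where loss = loss and x = x, OF Z divergence_fun_zero divergence_fun_chi2] chi2_pen_bias) auto
qed

lemma lipschitz_gap:
  assumes Z: "Z = loss x" and L: "G-lipschitz_on {0..<1} (inverse_cdf P Z)"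
    and "divergence_fun \<phi>" "divergence_fun \<psi>" "0 \<le> \<rho>" "0 \<le> lam"
  shows "dro_objective \<phi> \<psi> \<rho> lam loss x P - minibatch (dro_objective \<phi> \<psi> \<rho> lam loss x) P n \<le> ereal (G / n)"
  using assms by (intro dro_gap(3)[where loss = loss and x = x, OF Z] dro_value_le_of_bias_bound bias_le_of_lipschitz) auto

end

theorem proposition1:
  shows "\<exists>C::real. 0 < C \<and> C \<le> 100 \<and>
    (\<forall>(P0 :: 's measure) (X :: (real ^ 'd) set) R loss B G. dro_problem P0 X R loss B G \<longrightarrow>
      (\<forall>x\<in>X. \<forall>n::nat. 1 \<le> n \<longrightarrow>
        (\<forall>\<phi> \<psi> \<rho> lam. divergence_fun \<phi> \<and> divergence_fun \<psi> \<and> 0 \<le> \<rho> \<and> 0 \<le> lam \<longrightarrow>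
           0 \<le> dro_objective \<phi> \<psi> \<rho> lam loss x P0
               - minibatch (dro_objective \<phi> \<psi> \<rho> lam loss x) P0 n) \<and>
        (\<forall>\<alpha>. 0 < \<alpha> \<and> \<alpha> \<le> 1 \<longrightarrow>
           cvar_objective \<alpha> loss x P0 - minibatch (cvar_objective \<alpha> loss x) P0 n
             \<le> ereal (C * B * min 1 ((\<alpha> * real n) powr (- 1 / 2)))) \<and>
        (\<forall>\<rho>. 0 \<le> \<rho> \<and> 2 \<le> n \<longrightarrow>
           chi2_objective \<rho> loss x P0 - minibatch (chi2_objective \<rho> loss x) P0 n
             \<le> ereal (C * B * sqrt ((1 + \<rho>) * ln (real n) / real n))) \<and>
        (\<forall>lam. 0 < lam \<longrightarrow>
           chi2_pen_objective lam loss x P0 - minibatch (chi2_pen_objective lam loss x) P0 n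
             \<le> ereal (C * B\<^sup>2 / (lam * real n))) \<and>
        (\<forall>Gi. (\<forall>y\<in>X. Gi-lipschitz_on {0..<1} (inverse_cdf P0 (loss y))) \<longrightarrow>
          (\<forall>\<phi> \<psi> \<rho> lam. divergence_fun \<phi> \<and> divergence_fun \<psi> \<and> 0 \<le> \<rho> \<and> 0 \<le> lam \<longrightarrow>
             dro_objective \<phi> \<psi> \<rho> lam loss x P0
               - minibatch (dro_objective \<phi> \<psi> \<rho> lam loss x) P0 n
               \<le> ereal (C * Gi / real n)))))"
proof (rule exI[of _ 10], intro conjI allI impI ballI; (elim conjE)?)
  fix P0 :: "'s measure" and X :: "(real ^ 'd) set" and R B G :: real and loss x and n :: nat
  assume "dro_problem P0 X R loss B G" and x: "x \<in> X" and n: "1 \<le> n"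
  then interpret dro_problem P0 X R loss B G by simp
  interpret loss_sample P0 "loss x" B n
    using loss_measurable[OF x] loss_range[OF x] n by unfold_locales auto
  show "0 \<le> dro_objective \<phi> \<psi> \<rho> lam loss x P0 - minibatch (dro_objective \<phi> \<psi> \<rho> lam loss x) P0 n"
    if "divergence_fun \<phi>" "divergence_fun \<psi>" "0 \<le> \<rho>" "0 \<le> lam" for \<phi> \<psi> \<rho> lam
    by (rule dro_gap(1)[where loss = loss and x = x, OF refl that(1,2,4,3)])
  show "cvar_objective \<alpha> loss x P0 - minibatch (cvar_objective \<alpha> loss x) P0 n
      \<le> ereal (10 * B * min 1 ((\<alpha> * real n) powr (- 1 / 2)))" if "0 < \<alpha>" "\<alpha> \<le> 1" for \<alpha>
  proof -
    have "0 \<le> B * min 1 ((\<alpha> * real n) powr (- 1 / 2))" using B_nonneg by simp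
    then have "ereal (B * min 1 ((\<alpha> * real n) powr (- 1 / 2))) \<le> ereal (10 * B * min 1 ((\<alpha> * real n) powr (- 1 / 2)))"
      by simp
    from order_trans[OF cvar_gap[where loss = loss and x = x, OF refl that] this] show ?thesis .
  qed
  show "chi2_objective \<rho> loss x P0 - minibatch (chi2_objective \<rho> loss x) P0 n
      \<le> ereal (10 * B * sqrt ((1 + \<rho>) * ln (real n) / real n))" if \<rho>: "0 \<le> \<rho>" and "2 \<le> n" for \<rho>
  proof -
    \<comment> \<open>The bound without the logarithm is stronger once \<open>n \<ge> 2\<close> keeps the logarithm away from zero.\<close>
    have "1 / 2 \<le> ln (real n)"
    proof -
      have "ln (1 / real n) \<le> 1 / real n - 1" using n by (intro ln_le_minus_one) auto
      moreover have "1 / real n \<le> 1 / 2" using \<open>2 \<le> n\<close> by (intro divide_left_mono) auto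
      moreover have "ln (1 / real n) = - ln (real n)" using n by (simp add: ln_div)
      ultimately show ?thesis by linarith
    qed
    then have "(1 + \<rho>) * (1 / 2) \<le> (1 + \<rho>) * ln (real n)" using \<rho> by (intro mult_left_mono) auto
    then have "100 * ((1 + \<rho>) * (1 / 2)) \<le> 100 * ((1 + \<rho>) * ln (real n))" by simp
    moreover have "1 + 2 * \<rho> \<le> 100 * ((1 + \<rho>) * (1 / 2))" using \<rho> by (simp add: algebra_simps)
    ultimately have "1 + 2 * \<rho> \<le> 100 * ((1 + \<rho>) * ln (real n))" by (rule order_trans[rotated])
    then have "sqrt (1 + 2 * \<rho>) \<le> sqrt (100 * ((1 + \<rho>) * ln (real n)))" by (rule real_sqrt_le_mono)
    also have "\<dots> = 10 * sqrt ((1 + \<rho>) * ln (real n))" by (simp add: real_sqrt_mult)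
    finally have "sqrt (1 + 2 * \<rho>) / sqrt n \<le> 10 * sqrt ((1 + \<rho>) * ln (real n)) / sqrt n"
      by (rule divide_right_mono) simp
    then have "B * (sqrt (1 + 2 * \<rho>) / sqrt n) \<le> B * (10 * sqrt ((1 + \<rho>) * ln (real n)) / sqrt n)"
      using B_nonneg by (rule mult_left_mono)
    also have "B * (10 * sqrt ((1 + \<rho>) * ln (real n)) / sqrt n) = 10 * B * sqrt ((1 + \<rho>) * ln (real n) / real n)"
      by (simp add: real_sqrt_divide)
    finally have "ereal (B * (sqrt (1 + 2 * \<rho>) / sqrt n)) \<le> ereal (10 * B * sqrt ((1 + \<rho>) * ln (real n) / real n))"
      by simp
    from order_trans[OF chi2_gap[where loss = loss and x = x, OF refl \<rho>] this] show ?thesis .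
  qed
  show "chi2_pen_objective lam loss x P0 - minibatch (chi2_pen_objective lam loss x) P0 n
      \<le> ereal (10 * B\<^sup>2 / (lam * real n))" if "0 < lam" for lam
    by (rule chi2_pen_gap[where loss = loss and x = x, OF refl that])
  show "dro_objective \<phi> \<psi> \<rho> lam loss x P0 - minibatch (dro_objective \<phi> \<psi> \<rho> lam loss x) P0 n
      \<le> ereal (10 * Gi / real n)"
    if L: "\<forall>y\<in>X. Gi-lipschitz_on {0..<1} (inverse_cdf P0 (loss y))"
      and div: "divergence_fun \<phi>" "divergence_fun \<psi>" "0 \<le> \<rho>" "0 \<le> lam" for Gi \<phi> \<psi> \<rho> lam
  proof -
    have Lx: "Gi-lipschitz_on {0..<1} (inverse_cdf P0 (loss x))" using L x by blast
    then have "0 \<le> Gi" by (simp add: lipschitz_on_def)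
    then have "ereal (Gi / real n) \<le> ereal (10 * Gi / real n)" by (simp add: divide_right_mono)
    from order_trans[OF lipschitz_gap[where loss = loss and x = x, OF refl Lx div] this] show ?thesis .
  qed
qed simp_all

end
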